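(* Let the finite group $G$ act on the nonempty set $\Omega$. Assume that $|\mathrm{Fix}_\Omega(g)|\in\{1,2\}$ for all $g\in G\setminus\{1\}$. Then one of the following holds. (a) There is an orbit of length one or two. (b) $G$ is a platonic group in its action on $\Omega$. (c) There exists a finite field $F$ such that $G\cong\mathrm{PSL}_2(F)$ or $\mathrm{PGL}_2(F)$. More precisely: (i) there exists a nonregular orbit $\Gamma$ which may be identified (via a bijection) with $F^\infty$ so that the elements of $G$ induce linear fractional transformations of $\Gamma$; (ii) $G$ acts faithfully on $\Gamma$ and induces $\mathrm{PSL}_2(F)$ or $\mathrm{PGL}_2(F)$ on $\Gamma$; and (iii) there is exactly one other nonregular orbit and it has length $|F|(|F|-1)$. (d) $G\cong\mathrm{Alt}(5)$, there are exactly two nonregular orbits, and they have lengths $10$ and $12$.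
   Context: $\mathrm{Fix}_\Omega(g)$ is the set of points of $\Omega$ fixed by $g$. An orbit is regular if point stabilizers on it are trivial, and nonregular otherwise. A group $G$ acting on a set $\Omega$ is a *platonic group in its action on $\Omega$* if the action is faithful, there are exactly three nonregular orbits, and the isomorphism type of $G$ together with the lengths of the three nonregular orbits is one of: $G\cong\mathrm{Alt}(4)$ with lengths $6,4,4$; $G\cong\mathrm{Sym}(4)$ with lengths $12,8,6$; $G\cong\mathrm{Alt}(5)$ with lengths $30,20,12$. For a field $F$, $F^\infty=F\cup\{\infty\}$ with arithmetic extended in the usual way (i.e. $F^\infty$ is the projective line over $F$). A linear fractional transformation of $F^\infty$ is a map $x\mapsto\frac{ax+c}{bx+d}$ with $a,b,c,d\in F$, $ad-bc\neq0$. As permutation groups on $F^\infty$, $\mathrm{PGL}_2(F)$ is the group of all linear fractional transformations and $\mathrm{PSL}_2(F)$ is the subgroup of those for which $ad-bc$ is a nonzero square in $F$. *)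

theory Defs
  imports
    "HOL-Library.Multiset"
    "HOL-Algebra.Group_Action"
    "HOL-Algebra.Sym_Groups"
    "HOL-Algebra.Ring"
begin

section \<open>Nonregular orbits and platonic groups\<close>

definition regular_orbit :: "('a, 'm) monoid_scheme \<Rightarrow> ('a \<Rightarrow> 'b \<Rightarrow> 'b) \<Rightarrow> 'b set \<Rightarrow> bool"
  where "regular_orbit G \<phi> \<Gamma> \<longleftrightarrow> (\<forall>x\<in>\<Gamma>. stabilizer G \<phi> x = {\<one>\<^bsub>G\<^esub>})"

definition nonregular_orbits ::
    "('a, 'm) monoid_scheme \<Rightarrow> 'b set \<Rightarrow> ('a \<Rightarrow> 'b \<Rightarrow> 'b) \<Rightarrow> 'b set set"
  where "nonregular_orbits G E \<phi> = {\<Gamma> \<in> orbits G E \<phi>. \<not> regular_orbit G \<phi> \<Gamma>}"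

definition nonregular_lengths ::
    "('a, 'm) monoid_scheme \<Rightarrow> 'b set \<Rightarrow> ('a \<Rightarrow> 'b \<Rightarrow> 'b) \<Rightarrow> nat multiset"
  where "nonregular_lengths G E \<phi> = image_mset card (mset_set (nonregular_orbits G E \<phi>))"

definition platonic_group ::
    "('a, 'm) monoid_scheme \<Rightarrow> 'b set \<Rightarrow> ('a \<Rightarrow> 'b \<Rightarrow> 'b) \<Rightarrow> bool"
  where "platonic_group G E \<phi> \<longleftrightarrow>
    faithful_action G E \<phi> \<and>
    card (nonregular_orbits G E \<phi>) = 3 \<and>
    (G \<cong> alt_group 4 \<and> nonregular_lengths G E \<phi> = {#6, 4, 4#} \<or>
     G \<cong> sym_group 4 \<and> nonregular_lengths G E \<phi> = {#12, 8, 6#} \<or>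
     G \<cong> alt_group 5 \<and> nonregular_lengths G E \<phi> = {#30, 20, 12#})"

section \<open>Linear fractional transformations of the projective line\<close>

text \<open>The point \<open>None\<close> plays the role of infinity.\<close>

definition proj_line :: "('c, 'n) ring_scheme \<Rightarrow> 'c option set"
  where "proj_line F = insert None (Some ` carrier F)"

text \<open>The map \<open>x \<mapsto> (a x + c) / (b x + d)\<close>; it is made extensional on the projective line
  so that it is an element of \<open>BijGroup (proj_line F)\<close> when \<open>a d - b c\<close> is nonzero.\<close>

definition lin_frac ::
    "('c, 'n) ring_scheme \<Rightarrow> 'c \<Rightarrow> 'c \<Rightarrow> 'c \<Rightarrow> 'c \<Rightarrow> 'c option \<Rightarrow> 'c option"
  where "lin_frac F a b c d = (\<lambda>z\<in>proj_line F.
    case z of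
      None \<Rightarrow> if b = \<zero>\<^bsub>F\<^esub> then None else Some (a \<otimes>\<^bsub>F\<^esub> inv\<^bsub>F\<^esub> b)
    | Some x \<Rightarrow>
        if b \<otimes>\<^bsub>F\<^esub> x \<oplus>\<^bsub>F\<^esub> d = \<zero>\<^bsub>F\<^esub> then None
        else Some ((a \<otimes>\<^bsub>F\<^esub> x \<oplus>\<^bsub>F\<^esub> c) \<otimes>\<^bsub>F\<^esub> inv\<^bsub>F\<^esub> (b \<otimes>\<^bsub>F\<^esub> x \<oplus>\<^bsub>F\<^esub> d)))"

definition PGL2 :: "('c, 'n) ring_scheme \<Rightarrow> ('c option \<Rightarrow> 'c option) monoid"
  where "PGL2 F = BijGroup (proj_line F) \<lparr>carrier :=
    {lin_frac F a b c d | a b c d.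
       a \<in> carrier F \<and> b \<in> carrier F \<and> c \<in> carrier F \<and> d \<in> carrier F \<and>
       a \<otimes>\<^bsub>F\<^esub> d \<ominus>\<^bsub>F\<^esub> b \<otimes>\<^bsub>F\<^esub> c \<noteq> \<zero>\<^bsub>F\<^esub>}\<rparr>"

definition PSL2 :: "('c, 'n) ring_scheme \<Rightarrow> ('c option \<Rightarrow> 'c option) monoid"
  where "PSL2 F = BijGroup (proj_line F) \<lparr>carrier :=
    {lin_frac F a b c d | a b c d.
       a \<in> carrier F \<and> b \<in> carrier F \<and> c \<in> carrier F \<and> d \<in> carrier F \<and>
       a \<otimes>\<^bsub>F\<^esub> d \<ominus>\<^bsub>F\<^esub> b \<otimes>\<^bsub>F\<^esub> c \<noteq> \<zero>\<^bsub>F\<^esub> \<and>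
       (\<exists>e\<in>carrier F. a \<otimes>\<^bsub>F\<^esub> d \<ominus>\<^bsub>F\<^esub> b \<otimes>\<^bsub>F\<^esub> c = e \<otimes>\<^bsub>F\<^esub> e)}\<rparr>"

text \<open>For a bijection \<open>\<beta>\<close> from \<open>\<Gamma>\<close> onto \<open>S\<close>, the permutation of \<open>S\<close> corresponding to the
  permutation of \<open>\<Gamma>\<close> induced by \<open>f\<close>.\<close>

definition transport :: "('b \<Rightarrow> 's) \<Rightarrow> 'b set \<Rightarrow> 's set \<Rightarrow> ('b \<Rightarrow> 'b) \<Rightarrow> 's \<Rightarrow> 's"
  where "transport \<beta> \<Gamma> S f = (\<lambda>y\<in>S. \<beta> (f (inv_into \<Gamma> \<beta> y)))"

end

theory Submission
  imports Defs Complex_Main "HOL-Algebra.Weak_Morphisms" "HOL-Algebra.Multiplicative_Group"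
begin

text \<open>Call two points partners if their common stabilizer is nontrivial. A count of the nonidentity
  elements of a point stabilizer \<open>H\<close> shows that the partners of a point form a single \<open>H\<close>-orbit, so \<open>H\<close> has
  the shape of a Frobenius group: it has order \<open>k d\<close>, with \<open>k - 1\<close> elements fixing one point and
  \<open>k (d - 1)\<close> elements fixing two. Weighting every nonidentity element by the inverse of its number of
  fixed points gives \<open>1 - 1 / |G| = (\<Sum>\<Gamma>. 1 / 2 + 1 / (2 d) - 1 / (k d))\<close>, the sum running over the
  nonregular orbits. Without orbits of length one or two there are two or three summands. Three summands
  give Klein's list of platonic groups. With two of them, divisibility leaves only the group of order 60 in
  (d) and the case of an orbit of length \<open>k + 1\<close> with \<open>c d = k - 1\<close> and \<open>c\<close> equal to 1 or 2.

  In the last case the elements of \<open>H\<close> with one fixed point form, together with the identity, an abelian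
  group \<open>K\<close> of order \<open>k\<close>. An element \<open>t\<close> interchanging two points is an involution, because \<open>t\<^sup>2\<close> fixes these
  two points and a fixed point of \<open>t\<close>. Hence a two-point stabilizer \<open>D\<close> is inverted by such a \<open>t\<close> and thus
  abelian, and it acts irreducibly on \<open>K\<close>; by Schur's lemma \<open>K\<close> becomes the additive group of a field in
  which \<open>D\<close> acts by all nonzero elements or by all nonzero squares. The same fact about interchanges
  forces \<open>t\<close> to be of the form \<open>x \<mapsto> m / x\<close>.\<close>

section \<open>Actions of subgroups\<close>

text \<open>The delicate value is \<open>c = 2\<close>. For \<open>c = 1\<close> a two-point
  stabilizer is transitive on the nonidentity elements of \<open>K\<close>; for \<open>c = 2\<close>
  it has two orbits there, and every step needs a count that tolerates a factor of two.
  Commutativity of \<open>K\<close>: a nonidentity element of \<open>K\<close> has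
  \<open>d j\<close> conjugates in \<open>H\<close>, where \<open>j\<close> is at most
  \<open>c\<close> and divides \<open>k\<close>, and \<open>k = 2 d + 1\<close> is odd.
  Irreducibility: an invariant subgroup of \<open>K\<close> has more than \<open>k / 2\<close>
  elements. The shape of \<open>t\<close>: inverting \<open>D\<close> yields
  \<open>x * t(x) = m\<close> on the squares, but a priori another constant on the nonsquares; if
  the constants differed, then in the hard case, \<open>m\<close> a square, the fact about
  interchanges would inject the nonsquares into the squares other than \<open>m\<close>.

  The field is built from a centre so that its product commutes by construction. Alternating groups
  are recognised by their squares, which are even in every permutation representation: a group of
  order \<open>m! / 2\<close> inside \<open>Sym(m)\<close> in which more than half of the elements
  are squares must be \<open>Alt(m)\<close>.\<close>

locale subgroup_action = group G for G (structure) +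
  fixes H :: "'a set" and X :: "'c set" and a :: "'a \<Rightarrow> 'c \<Rightarrow> 'c"
  assumes sub: "subgroup H G"
    and finH: "finite H"
    and a_closed: "\<And>h x. h \<in> H \<Longrightarrow> x \<in> X \<Longrightarrow> a h x \<in> X"
    and a_mult: "\<And>h k x. h \<in> H \<Longrightarrow> k \<in> H \<Longrightarrow> x \<in> X \<Longrightarrow> a (h \<otimes> k) x = a h (a k x)"
    and a_one: "\<And>x. x \<in> X \<Longrightarrow> a \<one> x = x"
begin

lemma a_inv: "h \<in> H \<Longrightarrow> x \<in> X \<Longrightarrow> a (inv h) (a h x) = x"
  using a_mult[of "inv h" h x] a_one[of x] subgroup.m_inv_closed[OF sub, of h]
    subgroup.mem_carrier[OF sub, of h] by simp

lemma orbit_card: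
  assumes x: "x \<in> X"
  shows "card ((\<lambda>h. a h x) ` H) * card {h \<in> H. a h x = x} = card H"
proof -
  let ?O = "(\<lambda>h. a h x) ` H" and ?S = "{h \<in> H. a h x = x}"
  have fib: "card {h \<in> H. a h x = y} = card ?S" if y: "y \<in> ?O" for y
  proof -
    obtain k where k: "k \<in> H" "y = a k x" using y by auto
    have kc: "k \<in> carrier G" using k sub subgroup.mem_carrier by metis
    have "bij_betw (\<lambda>h. k \<otimes> h) ?S {h \<in> H. a h x = y}"
    proof (rule bij_betwI[where g = "\<lambda>h. inv k \<otimes> h"])
      show "(\<lambda>h. k \<otimes> h) \<in> ?S \<rightarrow> {h \<in> H. a h x = y}"
        using k x a_mult subgroup.m_closed[OF sub] by auto
      show "(\<lambda>h. inv k \<otimes> h) \<in> {h \<in> H. a h x = y} \<rightarrow> ?S"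
        using k x a_mult a_inv subgroup.m_closed[OF sub] subgroup.m_inv_closed[OF sub] by auto
      show "inv k \<otimes> (k \<otimes> h) = h" if "h \<in> ?S" for h
        using that kc subgroup.mem_carrier[OF sub] by (simp add: m_assoc[symmetric])
      show "k \<otimes> (inv k \<otimes> h) = h" if "h \<in> {h \<in> H. a h x = y}" for h
        using that kc subgroup.mem_carrier[OF sub] by (simp add: m_assoc[symmetric])
    qed
    thus ?thesis by (simp add: bij_betw_same_card)
  qed
  have "card H = (\<Sum>y\<in>?O. card {h \<in> H. a h x = y})"
    using sum.image_gen[OF finH, of "\<lambda>_. 1::nat" "\<lambda>h. a h x"] by simp
  also have "\<dots> = card ?O * card ?S" using fib by simp
  finally show ?thesis by simp
qed

lemma orbit_disjoint:
  assumes "x \<in> X" "y \<in> X" "(\<lambda>h. a h x) ` H \<inter> (\<lambda>h. a h y) ` H \<noteq> {}"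
  shows "(\<lambda>h. a h x) ` H = (\<lambda>h. a h y) ` H"
proof -
  have *: "(\<lambda>h. a h u) ` H \<subseteq> (\<lambda>h. a h v) ` H"
    if uv: "u \<in> X" "v \<in> X" and hk: "h \<in> H" "k \<in> H" "a h u = a k v" for u v h k
  proof
    fix w assume "w \<in> (\<lambda>h. a h u) ` H"
    then obtain l where l: "l \<in> H" "w = a l u" by auto
    have "u = a (inv h) (a k v)" using a_inv[OF hk(1) uv(1)] hk by simp
    hence "w = a (l \<otimes> (inv h \<otimes> k)) v"
      using l hk uv a_mult subgroup.m_closed[OF sub] subgroup.m_inv_closed[OF sub] a_closed by simp
    moreover have "l \<otimes> (inv h \<otimes> k) \<in> H"
      using l hk subgroup.m_closed[OF sub] subgroup.m_inv_closed[OF sub] by simp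
    ultimately show "w \<in> (\<lambda>h. a h v) ` H" by simp
  qed
  obtain h k where hk: "h \<in> H" "k \<in> H" "a h x = a k y" using assms(3) by auto
  show ?thesis using *[OF assms(1,2) hk] *[OF assms(2,1) hk(2,1) hk(3)[symmetric]] by blast
qed

text \<open>A free action cuts \<open>X\<close> into orbits of length \<open>card H\<close>. The
  lemma will be applied to permutations of points, to conjugation and to left multiplication; this
  is why the locale works with an arbitrary map \<open>a\<close> instead of a homomorphism into a
  permutation group.\<close>

lemma semiregular_dvd:
  assumes "finite X" and free: "\<And>h x. h \<in> H \<Longrightarrow> x \<in> X \<Longrightarrow> a h x = x \<Longrightarrow> h = \<one>"
  shows "card H dvd card X"
proof -
  let ?C = "(\<lambda>x. (\<lambda>h. a h x) ` H) ` X"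
  have U: "\<Union> ?C = X"
  proof
    show "\<Union> ?C \<subseteq> X" using a_closed by blast
    show "X \<subseteq> \<Union> ?C"
    proof
      fix x assume x: "x \<in> X"
      have "x = a \<one> x" using a_one x by simp
      thus "x \<in> \<Union> ?C" using x subgroup.one_closed[OF sub] by blast
    qed
  qed
  have "card H dvd card (\<Union> ?C)"
  proof (rule dvd_partition)
    show "finite (\<Union> ?C)" using U assms(1) by simp
    show "\<forall>c\<in>?C. card H dvd card c"
    proof
      fix c assume "c \<in> ?C"
      then obtain x where x: "x \<in> X" "c = (\<lambda>h. a h x) ` H" by auto
      have "{h \<in> H. a h x = x} = {\<one>}"
        using free[OF _ x(1)] subgroup.one_closed[OF sub] a_one[OF x(1)] by blast
      thus "card H dvd card c" using orbit_card[OF x(1)] x(2) by simp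
    qed
    show "\<forall>c1\<in>?C. \<forall>c2\<in>?C. c1 \<noteq> c2 \<longrightarrow> c1 \<inter> c2 = {}"
      using orbit_disjoint by blast
  qed
  thus ?thesis using U by simp
qed

end

section \<open>Conjugation in a group\<close>

context group
begin

lemma inv_mult_cancel [simp]: "g \<in> carrier G \<Longrightarrow> h \<in> carrier G \<Longrightarrow> inv g \<otimes> (g \<otimes> h) = h"
  by (simp add: m_assoc[symmetric])

definition conj_by where "conj_by g h = g \<otimes> h \<otimes> inv g"

lemma conj_closed [simp]: "g \<in> carrier G \<Longrightarrow> h \<in> carrier G \<Longrightarrow> conj_by g h \<in> carrier G"
  by (simp add: conj_by_def)

lemma conj_mult: "g \<in> carrier G \<Longrightarrow> h \<in> carrier G \<Longrightarrow> x \<in> carrier G \<Longrightarrow> conj_by (g \<otimes> h) x = conj_by g (conj_by h x)"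
  by (simp add: conj_by_def inv_mult_group m_assoc)

lemma conj_one [simp]: "x \<in> carrier G \<Longrightarrow> conj_by \<one> x = x"
  by (simp add: conj_by_def)

lemma conj_inv [simp]: "g \<in> carrier G \<Longrightarrow> x \<in> carrier G \<Longrightarrow> conj_by (inv g) (conj_by g x) = x"
  by (metis conj_mult conj_one inv_closed l_inv)

lemma conj_inv' [simp]: "g \<in> carrier G \<Longrightarrow> x \<in> carrier G \<Longrightarrow> conj_by g (conj_by (inv g) x) = x"
  by (metis conj_mult conj_one inv_closed r_inv)

lemma conj_hom: "g \<in> carrier G \<Longrightarrow> x \<in> carrier G \<Longrightarrow> y \<in> carrier G \<Longrightarrow> conj_by g (x \<otimes> y) = conj_by g x \<otimes> conj_by g y"
  by (simp add: conj_by_def m_assoc inv_mult_cancel)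

lemma conj_id [simp]: "g \<in> carrier G \<Longrightarrow> conj_by g \<one> = \<one>"
  by (simp add: conj_by_def)

lemma conj_eq_iff: "g \<in> carrier G \<Longrightarrow> x \<in> carrier G \<Longrightarrow> y \<in> carrier G \<Longrightarrow> conj_by g x = conj_by g y \<longleftrightarrow> x = y"
  by (metis conj_inv)

lemma conj_fix_iff: "g \<in> carrier G \<Longrightarrow> x \<in> carrier G \<Longrightarrow> conj_by g x = x \<longleftrightarrow> g \<otimes> x = x \<otimes> g"
  by (metis conj_by_def inv_solve_right m_closed)

lemma inj_conj: "g \<in> carrier G \<Longrightarrow> inj_on (conj_by g) (carrier G)"
  by (simp add: inj_on_def conj_eq_iff)

end

section \<open>Finite groups acting: stabilizers, orbits and their conjugates\<close>

locale finite_action = group_action G E \<phi> for G (structure) and E and \<phi> +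
  assumes fin: "finite (carrier G)"

sublocale finite_action \<subseteq> group G
  using group_hom group_hom.axioms(1) by auto

context finite_action
begin

abbreviation stab where "stab \<equiv> stabilizer G \<phi>"

lemma act_closed [simp]: "g \<in> carrier G \<Longrightarrow> x \<in> E \<Longrightarrow> \<phi> g x \<in> E"
  using element_image by blast

lemma act_mult: "g \<in> carrier G \<Longrightarrow> h \<in> carrier G \<Longrightarrow> x \<in> E \<Longrightarrow> \<phi> (g \<otimes> h) x = \<phi> g (\<phi> h x)"
  using composition_rule by simp

lemma act_one [simp]: "x \<in> E \<Longrightarrow> \<phi> \<one> x = x"
  by (metis id_eq_one restrict_apply')

lemma act_inv [simp]: "g \<in> carrier G \<Longrightarrow> x \<in> E \<Longrightarrow> \<phi> (inv g) (\<phi> g x) = x"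
  using orbit_sym_aux by blast

lemma act_inv' [simp]: "g \<in> carrier G \<Longrightarrow> x \<in> E \<Longrightarrow> \<phi> g (\<phi> (inv g) x) = x"
  using act_inv[of "inv g" x] by simp

lemma act_eq_iff: "g \<in> carrier G \<Longrightarrow> x \<in> E \<Longrightarrow> y \<in> E \<Longrightarrow> \<phi> g x = \<phi> g y \<longleftrightarrow> x = y"
  by (metis act_inv)

lemma stab_iff: "g \<in> stab x \<longleftrightarrow> g \<in> carrier G \<and> \<phi> g x = x"
  by (simp add: stabilizer_def)

lemma stab_carrier [simp]: "g \<in> stab x \<Longrightarrow> g \<in> carrier G"
  by (simp add: stab_iff)

lemma finite_stab [simp]: "finite (stab x)"
  using fin stabilizer_subset finite_subset by metis

lemma subgroup_stab: "x \<in> E \<Longrightarrow> subgroup (stab x) G"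
  by (rule stabilizer_subgroup)

lemma subgroup_stab2: "x \<in> E \<Longrightarrow> y \<in> E \<Longrightarrow> subgroup (stab x \<inter> stab y) G"
  by (intro subgroups_Inter_pair subgroup_stab)

lemma one_stab [simp]: "x \<in> E \<Longrightarrow> \<one> \<in> stab x"
  by (simp add: stab_iff)

lemma card_subgroup_pos: "subgroup H G \<Longrightarrow> card H > 0"
  using fin finite_subset subgroup.one_closed subgroup.subset by (metis card_gt_0_iff empty_iff)

lemma subgroup_card_1: "subgroup H G \<Longrightarrow> card H = 1 \<Longrightarrow> H = {\<one>}"
  by (metis card_1_singletonE singletonD subgroup.one_closed)

lemma card_subgroup_ge2: "subgroup H G \<Longrightarrow> H \<noteq> {\<one>} \<Longrightarrow> card H \<ge> 2"
  using card_subgroup_pos[of H] subgroup_card_1[of H] by linarith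

lemma subgroup_actionI:
  assumes "subgroup H G" "\<And>h x. h \<in> H \<Longrightarrow> x \<in> X \<Longrightarrow> a h x \<in> X"
    "\<And>h k x. h \<in> H \<Longrightarrow> k \<in> H \<Longrightarrow> x \<in> X \<Longrightarrow> a (h \<otimes> k) x = a h (a k x)" "\<And>x. x \<in> X \<Longrightarrow> a \<one> x = x"
  shows "subgroup_action G H X a"
  using assms finite_subset[OF subgroup.subset fin, of H]
  by (intro subgroup_action.intro subgroup_action_axioms.intro is_group) auto

lemma act_subgroup: "subgroup H G \<Longrightarrow> X \<subseteq> E \<Longrightarrow> (\<And>h x. h \<in> H \<Longrightarrow> x \<in> X \<Longrightarrow> \<phi> h x \<in> X)
   \<Longrightarrow> subgroup_action G H X \<phi>"
  using subgroup.mem_carrier[of H G] by (intro subgroup_actionI) (auto simp: act_mult subset_iff)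

lemma orbit_stab_card:
  assumes "subgroup H G" "x \<in> E"
  shows "card ((\<lambda>h. \<phi> h x) ` H) * card (H \<inter> stab x) = card H"
proof -
  interpret subgroup_action G H E \<phi>
    by (rule act_subgroup) (use assms subgroup.mem_carrier[of H G] in auto)
  have "{h \<in> H. \<phi> h x = x} = H \<inter> stab x"
    using assms subgroup.mem_carrier by (auto simp: stab_iff)
  thus ?thesis using orbit_card[OF assms(2)] by simp
qed

lemma orbit_eq: "orbit G \<phi> x = (\<lambda>g. \<phi> g x) ` carrier G"
  by (auto simp: orbit_def)

lemma card_orbit: "x \<in> E \<Longrightarrow> card (orbit G \<phi> x) * card (stab x) = order G"
  using orbit_stab_card[OF subgroup_self, of x] stabilizer_subset
  by (simp add: orbit_eq order_def Int_absorb1)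

lemma finite_orbit [simp]: "finite (orbit G \<phi> x)"
  using fin by (simp add: orbit_eq)

lemma order_pos: "order G > 0"
  using card_subgroup_pos[OF subgroup_self] by (simp add: order_def)

lemma conj_stab: "g \<in> carrier G \<Longrightarrow> h \<in> carrier G \<Longrightarrow> x \<in> E \<Longrightarrow> conj_by g h \<in> stab (\<phi> g x) \<longleftrightarrow> h \<in> stab x"
  by (simp add: stab_iff conj_by_def act_mult act_eq_iff)

lemma conj_stab_image:
  assumes "g \<in> carrier G" "x \<in> E"
  shows "stab (\<phi> g x) = conj_by g ` stab x"
proof
  show "conj_by g ` stab x \<subseteq> stab (\<phi> g x)" using assms conj_stab by auto
  show "stab (\<phi> g x) \<subseteq> conj_by g ` stab x"
  proof
    fix h assume h: "h \<in> stab (\<phi> g x)"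
    hence "h = conj_by g (conj_by (inv g) h)" "conj_by (inv g) h \<in> stab x"
      using assms conj_stab[of g "conj_by (inv g) h" x] by auto
    thus "h \<in> conj_by g ` stab x" by blast
  qed
qed

lemma conj_stab2_image:
  assumes "g \<in> carrier G" "x \<in> E" "y \<in> E"
  shows "stab (\<phi> g x) \<inter> stab (\<phi> g y) = conj_by g ` (stab x \<inter> stab y)"
  using conj_stab_image assms
  by (simp add: inj_on_image_Int[OF inj_conj] stabilizer_subset)

lemma card_conj_stab2:
  assumes "g \<in> carrier G" "x \<in> E" "y \<in> E"
  shows "card (stab (\<phi> g x) \<inter> stab (\<phi> g y)) = card (stab x \<inter> stab y)"
  using assms conj_stab2_image card_image inj_on_subset[OF inj_conj[OF assms(1)]] stabilizer_subset
  by (metis le_infI1)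

lemma card_conj_stab:
  assumes "g \<in> carrier G" "x \<in> E"
  shows "card (stab (\<phi> g x)) = card (stab x)"
  using card_conj_stab2[of g x x] assms by simp

end

section \<open>Actions with at most two fixed points per element\<close>

text \<open>Only the upper bound on fixed points survives restriction to a single orbit, since an
  element may have its fixed points outside it. The existence of a fixed point is therefore kept in
  a separate locale.\<close>

locale two_fixed_points = finite_action +
  assumes two: "\<lbrakk>g \<in> carrier G; g \<noteq> \<one>; x \<in> E; y \<in> E; z \<in> E; \<phi> g x = x; \<phi> g y = y; \<phi> g z = z\<rbrakk>
    \<Longrightarrow> x = y \<or> y = z \<or> x = z"
begin

definition partner where
  "partner x y \<longleftrightarrow> x \<in> E \<and> y \<in> E \<and> x \<noteq> y \<and> stab x \<inter> stab y \<noteq> {\<one>}"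

lemma partner_sym: "partner x y \<Longrightarrow> partner y x"
  by (auto simp: partner_def)

lemma partnerI: "g \<in> stab x \<Longrightarrow> g \<in> stab y \<Longrightarrow> g \<noteq> \<one> \<Longrightarrow> x \<in> E \<Longrightarrow> y \<in> E \<Longrightarrow> x \<noteq> y \<Longrightarrow> partner x y"
  by (auto simp: partner_def)

lemma third_fixed_point:
  "\<lbrakk>g \<in> stab x; g \<in> stab y; g \<in> stab z; g \<noteq> \<one>; x \<in> E; y \<in> E; z \<in> E; x \<noteq> y\<rbrakk> \<Longrightarrow> z = x \<or> z = y"
  using two[of g x y z] by (auto simp: stab_iff)

definition two_point_elements where
  "two_point_elements x = {g \<in> stab x. g \<noteq> \<one> \<and> (\<exists>y\<in>E. y \<noteq> x \<and> \<phi> g y = y)}"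

text \<open>The Frobenius kernel of \<open>stab x\<close>, at first merely as a set: its nonidentity
  elements fix no partner of \<open>x\<close>. Closure under products is established in
  \<open>kernel_set_subgroup\<close> under numerical assumptions.\<close>

definition kernel_set where
  "kernel_set x = {g \<in> stab x. g = \<one> \<or> (\<forall>y\<in>E. \<phi> g y = y \<longrightarrow> y = x)}"

definition complement_orbit where
  "complement_orbit x y = (\<lambda>h. \<phi> h y) ` stab x"

text \<open>The sets \<open>stab x \<inter> stab w\<close> are the conjugates of
  \<open>stab x \<inter> stab y\<close> in \<open>stab x\<close>; for a partner \<open>y\<close>
  they are the Frobenius complements.\<close>

definition complement_elements where
  "complement_elements x y = (\<Union>w\<in>complement_orbit x y. stab x \<inter> stab w - {\<one>})"

lemma complement_orbit_subset:
  assumes "x \<in> E" "y \<in> E" "x \<noteq> y"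
  shows "complement_orbit x y \<subseteq> E - {x}"
proof
  fix w assume "w \<in> complement_orbit x y"
  then obtain h where h: "h \<in> stab x" "w = \<phi> h y" by (auto simp: complement_orbit_def)
  hence "w = x \<Longrightarrow> \<phi> h x = \<phi> h y" by (simp add: stab_iff)
  thus "w \<in> E - {x}" using h assms act_eq_iff[of h x y] by (auto simp: stab_iff)
qed

lemma card_complement_orbit:
  assumes "x \<in> E" "y \<in> E"
  shows "card (complement_orbit x y) * card (stab x \<inter> stab y) = card (stab x)"
  using orbit_stab_card[OF subgroup_stab[OF assms(1)] assms(2)] by (simp add: complement_orbit_def)

lemma card_stab2_complement_orbit:
  assumes "x \<in> E" "y \<in> E" "w \<in> complement_orbit x y"
  shows "card (stab x \<inter> stab w) = card (stab x \<inter> stab y)"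
proof -
  obtain h where h: "h \<in> stab x" "w = \<phi> h y" using assms by (auto simp: complement_orbit_def)
  hence "\<phi> h x = x" by (simp add: stab_iff)
  thus ?thesis using card_conj_stab2[of h x y] h assms by simp
qed

text \<open>Two different conjugates meet only in the identity, because a common nonidentity element
  would fix \<open>x\<close> and two further points. The union is therefore counted by one summand
  for each point of the orbit.\<close>

lemma card_complement_elements:
  assumes xy: "x \<in> E" "y \<in> E" "x \<noteq> y"
  shows "card (complement_elements x y) = card (complement_orbit x y) * (card (stab x \<inter> stab y) - 1)"
proof -
  let ?O = "complement_orbit x y"
  have fO: "finite ?O" by (simp add: complement_orbit_def)
  have dis: "(stab x \<inter> stab w - {\<one>}) \<inter> (stab x \<inter> stab v - {\<one>}) = {}"
    if "w \<in> ?O" "v \<in> ?O" "w \<noteq> v" for w v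
    using that complement_orbit_subset[OF xy] xy(1) third_fixed_point[of _ x w v] by blast
  have "card (complement_elements x y) = (\<Sum>w\<in>?O. card (stab x \<inter> stab w - {\<one>}))"
    unfolding complement_elements_def
    by (rule card_UN_disjoint) (use fO dis in auto)
  also have "\<dots> = (\<Sum>w\<in>?O. card (stab x \<inter> stab y) - 1)"
  proof (rule sum.cong)
    fix w assume w: "w \<in> ?O"
    hence "w \<in> E" using complement_orbit_subset[OF xy] by blast
    hence "card (stab x \<inter> stab w - {\<one>}) = card (stab x \<inter> stab w) - 1"
      using xy by (subst card_Diff_singleton) auto
    thus "card (stab x \<inter> stab w - {\<one>}) = card (stab x \<inter> stab y) - 1"
      using card_stab2_complement_orbit[OF xy(1,2) w] by simp
  qed simp
  finally show ?thesis by simp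
qed

lemma complement_elements_subset:
  "x \<in> E \<Longrightarrow> y \<in> E \<Longrightarrow> x \<noteq> y \<Longrightarrow> complement_elements x y \<subseteq> two_point_elements x"
  using complement_orbit_subset[of x y] by (fastforce simp: complement_elements_def two_point_elements_def stab_iff)

text \<open>Two classes of complements with at least two elements each would together contain
  more than \<open>card (stab x) - 1\<close> elements.\<close>

lemma partner_orbit:
  assumes p: "partner x y" "partner x z"
  shows "z \<in> complement_orbit x y"
proof (rule ccontr)
  assume z: "z \<notin> complement_orbit x y"
  have E: "x \<in> E" "y \<in> E" "x \<noteq> y" "z \<in> E" "x \<noteq> z" using p by (auto simp: partner_def)
  interpret A: subgroup_action G "stab x" E \<phi>
    by (rule act_subgroup) (use E subgroup_stab in auto)
  have disO: "complement_orbit x y \<inter> complement_orbit x z = {}"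
  proof (rule ccontr)
    assume "complement_orbit x y \<inter> complement_orbit x z \<noteq> {}"
    hence "complement_orbit x y = complement_orbit x z"
      using A.orbit_disjoint[OF E(2,4)] by (simp add: complement_orbit_def)
    moreover have "\<phi> \<one> z \<in> complement_orbit x z"
      unfolding complement_orbit_def by (rule imageI) (simp add: E)
    ultimately show False using z E by simp
  qed
  have dis: "complement_elements x y \<inter> complement_elements x z = {}"
  proof (rule ccontr)
    assume "complement_elements x y \<inter> complement_elements x z \<noteq> {}"
    then obtain g w v where g: "g \<in> stab x" "g \<in> stab w" "g \<in> stab v" "g \<noteq> \<one>"
      "w \<in> complement_orbit x y" "v \<in> complement_orbit x z"
      by (auto simp: complement_elements_def)
    hence "w = v" using third_fixed_point[of g x w v] E complement_orbit_subset[of x y] complement_orbit_subset[of x z]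
      by blast
    thus False using g disO by blast
  qed
  let ?a = "card (complement_orbit x y)" and ?b = "card (complement_orbit x z)"
  let ?d = "card (stab x \<inter> stab y)" and ?e = "card (stab x \<inter> stab z)" and ?h = "card (stab x)"
  have fin': "finite (complement_elements x w)" for w
    by (rule finite_subset[OF _ finite_stab[of x]]) (auto simp: complement_elements_def)
  have "card (complement_elements x y \<union> complement_elements x z) \<le> card (stab x - {\<one>})"
    by (rule card_mono) (auto simp: complement_elements_def)
  also have "\<dots> = ?h - 1" using E by (subst card_Diff_singleton) auto
  finally have "?a * (?d - 1) + ?b * (?e - 1) \<le> ?h - 1"
    using card_Un_disjoint[OF fin' fin' dis] card_complement_elements E by simp
  moreover have "?a * ?d = ?h" "?b * ?e = ?h" using card_complement_orbit E by auto
  moreover have "?d \<ge> 2" "?e \<ge> 2"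
    using p card_subgroup_ge2[OF subgroup_stab2] E by (auto simp: partner_def)
  moreover have "?h > 0" using card_subgroup_pos subgroup_stab E by blast
  \<comment> \<open>With \<open>a d = h\<close> and \<open>d\<close> at least 2, the number
    \<open>a\<close> is at most \<open>h / 2\<close>, so \<open>a (d - 1) = h - a\<close> is at
    least \<open>h / 2\<close>, and likewise for \<open>b\<close> and \<open>e\<close>. Together
    they would exceed \<open>h - 1\<close>.\<close>
  moreover have "?a * ?d \<ge> ?a * 2" "?b * ?e \<ge> ?b * 2" using calculation(4,5) by auto
  ultimately show False by (simp add: diff_mult_distrib2)
qed

text \<open>By \<open>partner_orbit\<close> all partners are conjugate under \<open>stab x\<close>,
  so the choice does not affect the value. The default 1 treats a point without partners as having a
  trivial complement, and then \<open>kernel_order x\<close> is the full order of the stabilizer;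
  the formulas below hold in both cases.\<close>

definition comp_order where
  "comp_order x = (if \<exists>y. partner x y then card (stab x \<inter> stab (SOME y. partner x y)) else 1)"

definition kernel_order where "kernel_order x = card (stab x) div comp_order x"

lemma comp_order_partner:
  assumes "partner x y" shows "comp_order x = card (stab x \<inter> stab y)"
proof -
  have s: "partner x (SOME y. partner x y)" using assms by (rule someI)
  hence "y \<in> complement_orbit x (SOME y. partner x y)" using partner_orbit assms by blast
  thus ?thesis using card_stab2_complement_orbit assms s by (auto simp: comp_order_def partner_def)
qed

lemma comp_order_ge2: "partner x y \<Longrightarrow> comp_order x \<ge> 2"
  using card_subgroup_ge2[OF subgroup_stab2, of x y] comp_order_partner[of x y]
  by (simp add: partner_def)

lemma partner_comp_order: "partner x y \<Longrightarrow> comp_order x = comp_order y"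
  using comp_order_partner[of x y] comp_order_partner[of y x] partner_sym[of x y]
  by (simp add: Int_commute)

lemma kernel_order_partner:
  assumes "partner x y" shows "kernel_order x = card (complement_orbit x y)"
  using card_complement_orbit[of x y] comp_order_partner[OF assms] comp_order_ge2[OF assms] assms
  by (metis kernel_order_def nonzero_mult_div_cancel_right not_numeral_le_zero partner_def)

lemma kernel_comp_order:
  assumes "x \<in> E" shows "kernel_order x * comp_order x = card (stab x)"
proof (cases "\<exists>y. partner x y")
  case True
  then obtain y where y: "partner x y" by blast
  hence "y \<in> E" by (simp add: partner_def)
  thus ?thesis using kernel_order_partner[OF y] comp_order_partner[OF y] card_complement_orbit[OF assms] by simp
next
  case False
  thus ?thesis by (simp add: comp_order_def kernel_order_def)
qed

lemma orders_pos:
  assumes "x \<in> E" shows "kernel_order x \<ge> 1" "comp_order x \<ge> 1"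
  using kernel_comp_order[OF assms] card_subgroup_pos[OF subgroup_stab[OF assms]]
  by (auto simp: Suc_le_eq intro!: Nat.gr0I)

lemma two_point_elements_partner:
  assumes p: "partner x y"
  shows "two_point_elements x = complement_elements x y"
proof
  have E: "x \<in> E" "y \<in> E" "x \<noteq> y" using p by (auto simp: partner_def)
  show "complement_elements x y \<subseteq> two_point_elements x" by (rule complement_elements_subset[OF E])
  show "two_point_elements x \<subseteq> complement_elements x y"
  proof
    fix g assume "g \<in> two_point_elements x"
    then obtain w where w: "g \<in> stab x" "g \<noteq> \<one>" "w \<in> E" "w \<noteq> x" "g \<in> stab w"
      by (auto simp: two_point_elements_def stab_iff)
    hence "partner x w" using E by (intro partnerI) auto
    thus "g \<in> complement_elements x y" using partner_orbit[OF p] w by (auto simp: complement_elements_def)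
  qed
qed

lemma card_two_point_elements:
  assumes "x \<in> E"
  shows "card (two_point_elements x) = kernel_order x * (comp_order x - 1)"
proof (cases "\<exists>y. partner x y")
  case True
  then obtain y where y: "partner x y" by blast
  hence "y \<in> E" "x \<noteq> y" by (auto simp: partner_def)
  thus ?thesis using card_complement_elements[OF assms] two_point_elements_partner[OF y]
      kernel_order_partner[OF y] comp_order_partner[OF y] by simp
next
  case False
  hence "two_point_elements x = {}"
    using assms by (force simp: two_point_elements_def stab_iff intro: partnerI)
  thus ?thesis using False by (simp add: comp_order_def)
qed

lemma kernel_set_eq: "kernel_set x = stab x - two_point_elements x"
  by (auto simp: kernel_set_def two_point_elements_def stab_iff)

text \<open>The conjugates of the complement use up \<open>k (d - 1)\<close> of the
  \<open>k d\<close> elements of the stabilizer, which leaves \<open>k\<close>.\<close>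

lemma card_kernel_set:
  assumes "x \<in> E"
  shows "card (kernel_set x) = kernel_order x"
proof -
  have "card (kernel_set x) = card (stab x) - kernel_order x * (comp_order x - 1)"
    unfolding kernel_set_eq
    using card_two_point_elements[OF assms] by (subst card_Diff_subset) (auto simp: two_point_elements_def)
  moreover have "kernel_order x * (comp_order x - 1) = card (stab x) - kernel_order x"
    using kernel_comp_order[OF assms] by (simp add: diff_mult_distrib2)
  moreover have "kernel_order x \<le> card (stab x)"
    using kernel_comp_order[OF assms] orders_pos[OF assms] by (metis mult_le_mono2 mult.right_neutral)
  ultimately show ?thesis by simp
qed

lemma partner_act:
  assumes "partner x y" "g \<in> carrier G" shows "partner (\<phi> g x) (\<phi> g y)"
proof -
  have E: "x \<in> E" "y \<in> E" "x \<noteq> y" using assms by (auto simp: partner_def)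
  have "card (stab (\<phi> g x) \<inter> stab (\<phi> g y)) \<ge> 2"
    using card_conj_stab2 E assms comp_order_ge2 comp_order_partner by simp
  hence "stab (\<phi> g x) \<inter> stab (\<phi> g y) \<noteq> {\<one>}" by auto
  thus ?thesis using E assms(2) by (simp add: partner_def act_eq_iff)
qed

lemma comp_order_act:
  assumes "x \<in> E" "g \<in> carrier G" shows "comp_order (\<phi> g x) = comp_order x"
proof (cases "\<exists>y. partner x y")
  case True
  then obtain y where y: "partner x y" by blast
  hence "y \<in> E" by (simp add: partner_def)
  thus ?thesis
    using comp_order_partner[OF y] comp_order_partner[OF partner_act[OF y assms(2)]] card_conj_stab2 assms by simp
next
  case False
  have "\<not> partner (\<phi> g x) y" for y
  proof
    assume "partner (\<phi> g x) y"
    from partner_act[OF this, of "inv g"] show False using False assms by simp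
  qed
  thus ?thesis using False by (simp add: comp_order_def)
qed

lemma kernel_order_act:
  assumes "x \<in> E" "g \<in> carrier G" shows "kernel_order (\<phi> g x) = kernel_order x"
  using comp_order_act card_conj_stab assms by (simp add: kernel_order_def)

text \<open>An element commuting with a nonidentity element of the kernel set cannot fix a second
  point, because the latter would be moved to a third one.\<close>

lemma commute_kernel_set:
  assumes x: "x \<in> E" and u: "u \<in> kernel_set x" "u \<noteq> \<one>" and g: "g \<in> stab x" "g \<otimes> u = u \<otimes> g"
  shows "g \<in> kernel_set x"
proof (rule ccontr)
  assume "g \<notin> kernel_set x"
  then obtain y where y: "y \<in> E" "y \<noteq> x" "\<phi> g y = y" "g \<noteq> \<one>" using g by (auto simp: kernel_set_def)
  have uc: "u \<in> stab x" "u \<in> carrier G" "g \<in> carrier G" using u g by (auto simp: kernel_set_def)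
  have "\<phi> g (\<phi> u y) = \<phi> u (\<phi> g y)" using uc y act_mult g(2) by metis
  hence "g \<in> stab (\<phi> u y)" using y uc by (simp add: stab_iff)
  hence "\<phi> u y = x \<or> \<phi> u y = y"
    using third_fixed_point[of g x y "\<phi> u y"] g y x uc by (simp add: stab_iff)
  moreover have "\<phi> u y \<noteq> x" using uc y x act_eq_iff[of u y x] by (auto simp: stab_iff)
  ultimately show False using u y by (auto simp: kernel_set_def)
qed

lemma conj_kernel_set:
  assumes x: "x \<in> E" and u: "u \<in> kernel_set x" and g: "g \<in> stab x"
  shows "conj_by g u \<in> kernel_set x"
proof -
  have gc: "g \<in> carrier G" "\<phi> g x = x" "u \<in> stab x" "u \<in> carrier G" using g u by (auto simp: stab_iff kernel_set_def)
  have 1: "conj_by g u \<in> stab x" using conj_stab[of g u x] gc x by simp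
  have "y = x" if y: "y \<in> E" "\<phi> (conj_by g u) y = y" and n: "u \<noteq> \<one>" for y
  proof -
    let ?w = "\<phi> (inv g) y"
    have "conj_by g u \<in> stab (\<phi> g ?w)" using y gc by (simp add: stab_iff)
    hence "u \<in> stab ?w" using conj_stab[of g u ?w] gc y by simp
    hence "?w = x" using u n gc y by (auto simp: kernel_set_def stab_iff)
    thus "y = x" using gc y act_inv' by metis
  qed
  moreover have "conj_by g u = \<one>" if "u = \<one>" using that gc by simp
  ultimately show ?thesis using 1 by (auto simp: kernel_set_def)
qed

lemma one_kernel_set: "x \<in> E \<Longrightarrow> \<one> \<in> kernel_set x"
  by (simp add: kernel_set_def)

lemma kernel_set_carrier: "u \<in> kernel_set x \<Longrightarrow> u \<in> carrier G"
  by (auto simp: kernel_set_def dest: stab_carrier)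

text \<open>One inclusion is \<open>commute_kernel_set\<close>. For the other the class of
  \<open>u\<close> under \<open>stab x\<close> is counted: it lies in the \<open>q - 1 = c d\<close>
  nonidentity elements of the kernel set, and its size is a multiple \<open>d j\<close> of
  \<open>d\<close>. By orbit counting the centralizer then has order \<open>q / j\<close>, and
  \<open>j = 1\<close> remains to be seen.\<close>

lemma centralizer_kernel_set:
  assumes x: "x \<in> E" and y: "y \<in> E" "x \<noteq> y" and q: "card (kernel_set x) = q"
    and d: "card (stab x \<inter> stab y) = d" and h: "card (stab x) = q * d" and c: "c * d = q - 1" "c = 1 \<or> c = 2"
    and u: "u \<in> kernel_set x" "u \<noteq> \<one>"
  shows "{g \<in> stab x. g \<otimes> u = u \<otimes> g} = kernel_set x"
proof -
  let ?C = "{g \<in> stab x. g \<otimes> u = u \<otimes> g}" and ?K = "kernel_set x" and ?D = "stab x \<inter> stab y"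
  let ?cl = "(\<lambda>g. conj_by g u) ` stab x"
  have uc: "u \<in> carrier G" using u kernel_set_carrier by blast
  have sub: "?C \<subseteq> ?K" using commute_kernel_set[OF x u] by blast
  interpret A: subgroup_action G "stab x" "carrier G" conj_by
    by (rule subgroup_actionI[OF subgroup_stab[OF x]]) (auto simp: conj_mult dest: stab_carrier)
  have "{g \<in> stab x. conj_by g u = u} = ?C" using conj_fix_iff uc by auto
  hence m: "card ?cl * card ?C = q * d" using A.orbit_card[OF uc] h by simp
  have clK: "?cl \<subseteq> ?K - {\<one>}"
  proof
    fix v assume "v \<in> ?cl"
    then obtain g where g: "g \<in> stab x" "v = conj_by g u" by auto
    hence "v \<noteq> \<one>" using u uc conj_eq_iff[of g u \<one>] by auto
    thus "v \<in> ?K - {\<one>}" using conj_kernel_set[OF x u(1)] g by auto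
  qed
  interpret B: subgroup_action G ?D ?cl conj_by
  proof (rule subgroup_actionI[OF subgroup_stab2[OF x y(1)]])
    fix g v assume g: "g \<in> ?D" and v: "v \<in> ?cl"
    then obtain k where k: "k \<in> stab x" "v = conj_by k u" by auto
    hence "conj_by g v = conj_by (g \<otimes> k) u"
      using g uc conj_mult[of g k u] stab_carrier[of g x] stab_carrier[of k x] by auto
    thus "conj_by g v \<in> ?cl" using g k subgroup.m_closed[OF subgroup_stab[OF x]] by blast
  next
    fix g h v assume "g \<in> ?D" "h \<in> ?D" "v \<in> ?cl"
    thus "conj_by (g \<otimes> h) v = conj_by g (conj_by h v)" using conj_mult uc by auto
  next
    fix v assume "v \<in> ?cl" thus "conj_by \<one> v = v" using uc by auto
  qed
  \<comment> \<open>The complement acts freely on the class of \<open>u\<close>: an element of it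
    commuting with a nonidentity kernel element lies in the kernel set itself, yet it also fixes
    \<open>y\<close>.\<close>
  have "card ?D dvd card ?cl"
  proof (rule B.semiregular_dvd)
    fix g v assume g: "g \<in> ?D" and v: "v \<in> ?cl" "conj_by g v = v"
    hence vK: "v \<in> ?K" "v \<noteq> \<one>" using clK by auto
    hence "g \<in> ?K" using commute_kernel_set[OF x vK, of g] g v conj_fix_iff[of g v] kernel_set_carrier by auto
    thus "g = \<one>" using g y by (auto simp: kernel_set_def stab_iff)
  qed simp
  then obtain j where j: "card ?cl = d * j" using d by (auto elim: dvdE)
  have d0: "d > 0" using d card_subgroup_pos[OF subgroup_stab2[OF x y(1)]] by simp
  have Kfin: "finite ?K" by (rule finite_subset[OF _ finite_stab[of x]]) (auto simp: kernel_set_def)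
  have "card ?cl \<le> q - 1"
    using card_mono[OF _ clK] Kfin q one_kernel_set[OF x] by (simp add: card_Diff_singleton)
  hence "d * j \<le> c * d" using j c by simp
  hence jc: "j \<le> c" using d0 by (simp add: mult.commute)
  have "d * (j * card ?C) = d * q" using m j by (simp add: ac_simps)
  hence jq: "j * card ?C = q" using d0 by simp
  have q0: "q > 0" using q one_kernel_set[OF x] Kfin by (metis card_gt_0_iff empty_iff)
  \<comment> \<open>Here \<open>j\<close> is at most \<open>c\<close> and divides \<open>q\<close>.
    For \<open>c = 2\<close> the equation \<open>c d = q - 1\<close> makes \<open>q\<close> odd,
    which rules out \<open>j = 2\<close>.\<close>
  have "j = 1"
  proof (cases "c = 1")
    case True thus ?thesis using jc jq q0 by (cases j) auto
  next
    case False
    hence "c = 2" using c by simp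
    hence "odd q" using c q0 by presburger
    hence "j \<noteq> 2" "j \<noteq> 0" using jq q0 by auto
    thus ?thesis using jc \<open>c = 2\<close> by linarith
  qed
  hence "card ?C = card ?K" using jq q by simp
  thus ?thesis using sub Kfin card_subset_eq by blast
qed

text \<open>Commutativity comes from the centralizers, and closure follows from it:
  \<open>u \<otimes> v\<close> commutes with \<open>u\<close>, so for \<open>u\<close> different
  from the identity \<open>commute_kernel_set\<close> puts it into the kernel set. The inverse of
  \<open>u\<close> is treated in the same way.\<close>

lemma kernel_set_subgroup:
  assumes x: "x \<in> E" and y: "y \<in> E" "x \<noteq> y" and q: "card (kernel_set x) = q"
    and d: "card (stab x \<inter> stab y) = d" and h: "card (stab x) = q * d" and c: "c * d = q - 1" "c = 1 \<or> c = 2"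
  shows "subgroup (kernel_set x) G" "u \<in> kernel_set x \<Longrightarrow> v \<in> kernel_set x \<Longrightarrow> u \<otimes> v = v \<otimes> u"
proof -
  show comm: "u \<otimes> v = v \<otimes> u" if "u \<in> kernel_set x" "v \<in> kernel_set x" for u v
    using that centralizer_kernel_set[OF assms, of v] kernel_set_carrier by (cases "v = \<one>") auto
  show "subgroup (kernel_set x) G"
  proof (rule subgroupI)
    show "kernel_set x \<subseteq> carrier G" using kernel_set_carrier by blast
    show "kernel_set x \<noteq> {}" using one_kernel_set[OF x] by blast
    fix u assume u: "u \<in> kernel_set x"
    hence uc: "u \<in> stab x" "u \<in> carrier G" by (auto simp: kernel_set_def)
    show "inv u \<in> kernel_set x"
    proof (cases "u = \<one>")
      case True thus ?thesis using one_kernel_set[OF x] by simp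
    next
      case False
      show ?thesis
        by (rule commute_kernel_set[OF x u False])
           (use uc subgroup.m_inv_closed[OF subgroup_stab[OF x]] in auto)
    qed
    fix v assume v: "v \<in> kernel_set x"
    hence vc: "v \<in> stab x" "v \<in> carrier G" by (auto simp: kernel_set_def)
    show "u \<otimes> v \<in> kernel_set x"
    proof (cases "u = \<one>")
      case True thus ?thesis using v vc by simp
    next
      case False
      have "u \<otimes> v \<otimes> u = u \<otimes> (u \<otimes> v)" using comm[OF u v] uc vc by (metis m_assoc)
      thus ?thesis using commute_kernel_set[OF x u False, of "u \<otimes> v"]
          uc vc subgroup.m_closed[OF subgroup_stab[OF x]] by simp
    qed
  qed
qed

end

section \<open>The class formula\<close>

locale one_or_two_fixed_points = two_fixed_points +
  assumes fixed_point: "\<lbrakk>g \<in> carrier G; g \<noteq> \<one>\<rbrakk> \<Longrightarrow> \<exists>x\<in>E. \<phi> g x = x"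
begin

lemma invariants_cases:
  assumes "g \<in> stab x" "g \<noteq> \<one>" "x \<in> E"
  shows "g \<in> kernel_set x \<Longrightarrow> invariants E \<phi> g = {x}"
    and "g \<in> two_point_elements x \<Longrightarrow> \<exists>y. y \<noteq> x \<and> invariants E \<phi> g = {x, y}"
proof -
  show "invariants E \<phi> g = {x}" if "g \<in> kernel_set x"
  proof -
    have "\<phi> g x = x" using assms(1) by (simp add: stab_iff)
    moreover have "\<forall>y\<in>E. \<phi> g y = y \<longrightarrow> y = x" using assms(2) that unfolding kernel_set_def by blast
    ultimately show ?thesis using assms(3) unfolding invariants_def by blast
  qed
  show "\<exists>y. y \<noteq> x \<and> invariants E \<phi> g = {x, y}" if two_pt: "g \<in> two_point_elements x"
  proof -
    obtain y where y: "y \<in> E" "y \<noteq> x" "g \<in> stab y"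
      using two_pt by (auto simp: two_point_elements_def stab_iff)
    have "invariants E \<phi> g = {x, y}"
      using third_fixed_point[of g x y] y assms by (auto simp: invariants_def stab_iff)
    thus ?thesis using y by blast
  qed
qed

lemma invariants_finite:
  assumes "g \<in> carrier G" "g \<noteq> \<one>"
  shows "finite (invariants E \<phi> g)" "invariants E \<phi> g \<noteq> {}" "card (invariants E \<phi> g) \<le> 2"
proof -
  obtain x where x: "x \<in> E" "g \<in> stab x" using fixed_point assms by (auto simp: stab_iff)
  hence "g \<in> kernel_set x \<or> g \<in> two_point_elements x" by (auto simp: kernel_set_eq)
  hence "(\<exists>y. invariants E \<phi> g = {x, y})"
    using invariants_cases[OF x(2) assms(2) x(1)] by auto
  then obtain y where y: "invariants E \<phi> g = {x, y}" by blast
  thus "finite (invariants E \<phi> g)" "invariants E \<phi> g \<noteq> {}" by auto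
  show "card (invariants E \<phi> g) \<le> 2" using y card_insert_le_m1[of 2 "{y}" x] by simp
qed

definition nonregular_points where "nonregular_points = {x \<in> E. stab x \<noteq> {\<one>}}"

lemma finite_nonregular_points: "finite nonregular_points"
proof -
  have "nonregular_points \<subseteq> (\<Union>g\<in>carrier G - {\<one>}. invariants E \<phi> g)"
  proof
    fix x assume x: "x \<in> nonregular_points"
    then obtain g where "g \<in> stab x" "g \<noteq> \<one>" using one_stab by (auto simp: nonregular_points_def)
    thus "x \<in> (\<Union>g\<in>carrier G - {\<one>}. invariants E \<phi> g)" using x
      by (auto simp: nonregular_points_def invariants_def stab_iff)
  qed
  moreover have "finite (\<Union>g\<in>carrier G - {\<one>}. invariants E \<phi> g)"
    using fin invariants_finite by blast
  ultimately show ?thesis using finite_subset by blast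
qed

lemma weight_sum:
  assumes x: "x \<in> E"
  shows "(\<Sum>g\<in>stab x - {\<one>}. 1 / real (card (invariants E \<phi> g)))
    = real (kernel_order x) * (real (comp_order x) + 1) / 2 - 1"
proof -
  let ?f = "\<lambda>g. 1 / real (card (invariants E \<phi> g))"
  let ?A = "kernel_set x - {\<one>}" and ?B = "two_point_elements x"
  have fA: "finite ?A" by (rule finite_subset[OF _ finite_stab[of x]]) (auto simp: kernel_set_def)
  have fB: "finite ?B" by (rule finite_subset[OF _ finite_stab[of x]]) (auto simp: two_point_elements_def)
  have U: "stab x - {\<one>} = ?A \<union> ?B" by (auto simp: kernel_set_eq two_point_elements_def)
  have "(\<Sum>g\<in>stab x - {\<one>}. ?f g) = sum ?f ?A + sum ?f ?B"
    unfolding U by (rule sum.union_disjoint[OF fA fB]) (auto simp: kernel_set_eq)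
  also have "sum ?f ?A = (\<Sum>g\<in>?A. 1)"
    using invariants_cases(1)[OF _ _ x] by (intro sum.cong) (auto simp: kernel_set_def)
  also have "sum ?f ?B = (\<Sum>g\<in>?B. 1 / 2)"
  proof (intro sum.cong refl)
    fix g assume g: "g \<in> ?B"
    then obtain y where "y \<noteq> x" "invariants E \<phi> g = {x, y}"
      using invariants_cases(2)[OF _ _ x] by (auto simp: two_point_elements_def)
    thus "?f g = 1 / 2" by simp
  qed
  also have "(\<Sum>g\<in>?A. 1) = real (kernel_order x) - 1"
    using card_kernel_set[OF x] orders_pos[OF x] one_kernel_set[OF x] by (simp add: card_Diff_singleton)
  also have "(\<Sum>g\<in>?B. 1 / 2) = real (kernel_order x) * (real (comp_order x) - 1) / 2"
    using card_two_point_elements[OF x] orders_pos[OF x] by simp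
  finally show ?thesis by (simp add: field_simps)
qed

text \<open>Double counting of the pairs of a nonregular point and a nonidentity element fixing it.
  An element occurs once for each of its fixed points, every time with the inverse of their number,
  and so contributes exactly 1.\<close>

lemma total_weight:
  "(\<Sum>x\<in>nonregular_points. real (kernel_order x) * (real (comp_order x) + 1) / 2 - 1) = real (order G) - 1"
proof -
  let ?f = "\<lambda>g. 1 / real (card (invariants E \<phi> g))" and ?C = "carrier G - {\<one>}"
  have "(\<Sum>x\<in>nonregular_points. real (kernel_order x) * (real (comp_order x) + 1) / 2 - 1)
    = (\<Sum>x\<in>nonregular_points. \<Sum>g | g \<in> ?C \<and> \<phi> g x = x. ?f g)"
  proof (intro sum.cong refl)
    fix x assume x: "x \<in> nonregular_points"
    have "{g. g \<in> ?C \<and> \<phi> g x = x} = stab x - {\<one>}" by (auto simp: stab_iff)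
    thus "real (kernel_order x) * (real (comp_order x) + 1) / 2 - 1 = (\<Sum>g | g \<in> ?C \<and> \<phi> g x = x. ?f g)"
      using weight_sum x by (simp add: nonregular_points_def)
  qed
  also have "\<dots> = (\<Sum>g\<in>?C. \<Sum>x | x \<in> nonregular_points \<and> \<phi> g x = x. ?f g)"
    using fin by (intro sum.swap_restrict finite_nonregular_points) auto
  also have "\<dots> = (\<Sum>g\<in>?C. 1)"
  proof (intro sum.cong refl)
    fix g assume g: "g \<in> ?C"
    have "{x. x \<in> nonregular_points \<and> \<phi> g x = x} = invariants E \<phi> g"
      unfolding nonregular_points_def invariants_def
      using g stab_iff[of g] by blast
    thus "(\<Sum>x | x \<in> nonregular_points \<and> \<phi> g x = x. ?f g) = 1"
      using invariants_finite[of g] g by (simp add: card_gt_0_iff)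
  qed
  also have "\<dots> = real (order G) - 1"
    using fin order_pos by (simp add: order_def of_nat_diff Suc_le_eq)
  finally show ?thesis .
qed

lemma nonregular_orbits_eq: "nonregular_orbits G E \<phi> = orbit G \<phi> ` nonregular_points"
proof
  show "nonregular_orbits G E \<phi> \<subseteq> orbit G \<phi> ` nonregular_points"
  proof
    fix \<Gamma> assume "\<Gamma> \<in> nonregular_orbits G E \<phi>"
    then obtain x y where x: "x \<in> E" "\<Gamma> = orbit G \<phi> x" "y \<in> \<Gamma>" "stab y \<noteq> {\<one>}"
      by (auto simp: nonregular_orbits_def orbits_def regular_orbit_def)
    then obtain g where "g \<in> carrier G" "y = \<phi> g x" by (auto simp: orbit_def)
    hence "stab x \<noteq> {\<one>}" using x conj_stab_image[of g x] by auto
    thus "\<Gamma> \<in> orbit G \<phi> ` nonregular_points" using x by (auto simp: nonregular_points_def)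
  qed
  show "orbit G \<phi> ` nonregular_points \<subseteq> nonregular_orbits G E \<phi>"
    using orbit_refl by (auto simp: nonregular_orbits_def orbits_def regular_orbit_def nonregular_points_def)
qed

lemma orbit_subset: "x \<in> E \<Longrightarrow> orbit G \<phi> x \<subseteq> E"
  by (auto simp: orbit_def)

lemma mem_orbit_act: "x \<in> E \<Longrightarrow> y \<in> orbit G \<phi> x \<Longrightarrow> \<exists>g\<in>carrier G. y = \<phi> g x"
  by (auto simp: orbit_def)

lemma act_mem_orbit:
  assumes "x \<in> E" "y \<in> orbit G \<phi> x" "h \<in> carrier G"
  shows "\<phi> h y \<in> orbit G \<phi> x"
proof -
  obtain g where g: "g \<in> carrier G" "y = \<phi> g x" using mem_orbit_act assms by blast
  hence "\<phi> h y = \<phi> (h \<otimes> g) x" using act_mult assms by simp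
  thus ?thesis unfolding orbit_eq using g assms m_closed by blast
qed

lemma orbit_orders:
  assumes "x \<in> E" "y \<in> orbit G \<phi> x"
  shows "kernel_order y = kernel_order x" "comp_order y = comp_order x" "card (stab y) = card (stab x)"
  using mem_orbit_act[OF assms] kernel_order_act[OF assms(1)] comp_order_act[OF assms(1)] card_conj_stab[OF _ assms(1)]
  by auto

lemma orbit_eqI:
  assumes "x \<in> E" "y \<in> orbit G \<phi> x" shows "orbit G \<phi> y = orbit G \<phi> x"
proof -
  have y: "y \<in> E" using assms orbit_subset by blast
  show ?thesis
    using disjoint_union[of "orbit G \<phi> y" "orbit G \<phi> x"] orbit_refl[OF y] assms y by (auto simp: orbits_def)
qed

lemma orbit_nonregular_points: "x \<in> nonregular_points \<Longrightarrow> orbit G \<phi> x \<subseteq> nonregular_points"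
proof
  fix y assume x: "x \<in> nonregular_points" and y: "y \<in> orbit G \<phi> x"
  hence "card (stab y) = card (stab x)" using orbit_orders by (auto simp: nonregular_points_def)
  moreover have "card (stab x) \<ge> 2" using x card_subgroup_ge2 subgroup_stab by (auto simp: nonregular_points_def)
  ultimately have "stab y \<noteq> {\<one>}" by auto
  thus "y \<in> nonregular_points" using x y orbit_subset by (auto simp: nonregular_points_def)
qed

text \<open>The weight found at all points of the orbit of \<open>x\<close>, divided by
  \<open>order G\<close>: the orbit has \<open>order G / (k d)\<close> points of weight
  \<open>k (d + 1) / 2 - 1\<close> each.\<close>

definition orbit_term where
  "orbit_term x = 1 / 2 + 1 / (2 * real (comp_order x)) - 1 / real (card (stab x))"

lemma orbit_term_mult:
  assumes "x \<in> E"
  shows "real (card (orbit G \<phi> x)) * (real (kernel_order x) * (real (comp_order x) + 1) / 2 - 1)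
    = real (order G) * orbit_term x"
proof -
  have h: "real (card (stab x)) = real (kernel_order x) * real (comp_order x)"
    using kernel_comp_order[OF assms] by (metis of_nat_mult)
  have n: "real (order G) = real (card (orbit G \<phi> x)) * (real (kernel_order x) * real (comp_order x))"
    using card_orbit[OF assms] h by (metis of_nat_mult)
  have "real (kernel_order x) > 0" "real (comp_order x) > 0" using orders_pos[OF assms] by auto
  thus ?thesis unfolding orbit_term_def h n by (simp add: field_simps)
qed

text \<open>The orders of kernel and complement are constant on orbits, so the formula may be stated
  for any choice \<open>r\<close> of representatives. It is the total weight divided by
  \<open>order G\<close>.\<close>

lemma class_formula:
  assumes r: "\<And>\<Gamma>. \<Gamma> \<in> nonregular_orbits G E \<phi> \<Longrightarrow> r \<Gamma> \<in> \<Gamma>"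
  shows "(\<Sum>\<Gamma>\<in>nonregular_orbits G E \<phi>. orbit_term (r \<Gamma>)) = 1 - 1 / real (order G)"
proof -
  let ?N = "nonregular_orbits G E \<phi>"
  let ?w = "\<lambda>x. real (kernel_order x) * (real (comp_order x) + 1) / 2 - 1"
  have N: "\<Gamma> \<in> ?N \<Longrightarrow> r \<Gamma> \<in> E \<and> \<Gamma> = orbit G \<phi> (r \<Gamma>)" for \<Gamma>
  proof -
    assume G: "\<Gamma> \<in> ?N"
    then obtain x where x: "x \<in> E" "\<Gamma> = orbit G \<phi> x"
      unfolding nonregular_orbits_eq nonregular_points_def by blast
    have "r \<Gamma> \<in> orbit G \<phi> x" using r[OF G] x(2) by simp
    thus ?thesis using orbit_eqI[OF x(1)] orbit_subset[OF x(1)] x(2) by blast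
  qed
  have U: "\<Union>?N = nonregular_points"
    using orbit_nonregular_points orbit_refl unfolding nonregular_orbits_eq by (auto simp: nonregular_points_def)
  have "real (order G) - 1 = sum ?w (\<Union>?N)" using total_weight U by simp
  also have "\<dots> = (\<Sum>\<Gamma>\<in>?N. sum ?w \<Gamma>)"
  proof (rule sum.Union_disjoint[simplified comp_def])
    show "\<forall>A\<in>?N. finite A" using finite_subset[OF _ finite_nonregular_points] U by blast
    show "\<forall>A\<in>?N. \<forall>B\<in>?N. A \<noteq> B \<longrightarrow> A \<inter> B = {}"
      using disjoint_union unfolding nonregular_orbits_def by blast
  qed
  also have "\<dots> = (\<Sum>\<Gamma>\<in>?N. real (order G) * orbit_term (r \<Gamma>))"
  proof (intro sum.cong refl)
    fix \<Gamma> assume "\<Gamma> \<in> ?N"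
    hence g: "r \<Gamma> \<in> E" "\<Gamma> = orbit G \<phi> (r \<Gamma>)" using N by auto
    have "sum ?w \<Gamma> = (\<Sum>x\<in>\<Gamma>. ?w (r \<Gamma>))"
      using orbit_orders[OF g(1)] g(2) by (intro sum.cong) auto
    thus "sum ?w \<Gamma> = real (order G) * orbit_term (r \<Gamma>)" using orbit_term_mult[OF g(1)] g(2) by simp
  qed
  finally have "real (order G) * (\<Sum>\<Gamma>\<in>?N. orbit_term (r \<Gamma>)) = real (order G) - 1"
    by (simp add: sum_distrib_left)
  thus ?thesis using order_pos by (simp add: field_simps)
qed

end

section \<open>The Diophantine equations for three and for two nonregular orbits\<close>

lemma triple_numerics:
  fixes a b c n :: nat
  assumes "2 \<le> a" "a \<le> b" "b \<le> c" "n > 0" and s: "1 / real a + 1 / real b + 1 / real c = 1 + 2 / real n"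
  shows "(n = 2 * c) \<or> (a = 2 \<and> b = 3 \<and> (c = 3 \<and> n = 12 \<or> c = 4 \<and> n = 24 \<or> c = 5 \<and> n = 60))"
proof -
  \<comment> \<open>If even the smallest number were at least 3, the left side would be at most 1.
    The bounds on \<open>b\<close> and then on \<open>c\<close> arise in the same way after
    inserting the numbers already found.\<close>
  have a2: "a = 2"
  proof (rule ccontr)
    assume "a \<noteq> 2"
    hence "real a \<ge> 3" "real b \<ge> 3" "real c \<ge> 3" using assms by auto
    hence "1 / real a \<le> 1 / 3" "1 / real b \<le> 1 / 3" "1 / real c \<le> 1 / 3" by (auto simp: field_simps)
    moreover have "2 / real n > 0" using assms by simp
    ultimately show False using s by linarith
  qed
  have b3: "b \<le> 3"
  proof (rule ccontr)
    assume "\<not> b \<le> 3"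
    hence "real b \<ge> 4" "real c \<ge> 4" using assms by auto
    hence "1 / real b \<le> 1 / 4" "1 / real c \<le> 1 / 4" by (auto simp: field_simps)
    moreover have "2 / real n > 0" using assms by simp
    moreover have "1 / 2 + 1 / real b + 1 / real c = 1 + 2 / real n" using s a2 by simp
    ultimately show False by linarith
  qed
  have "b = 2 \<or> b = 3" using assms b3 by linarith
  thus ?thesis
  proof
    \<comment> \<open>The dihedral solution. It is discarded later, because \<open>n = 2 * c\<close>
      produces an orbit of length two.\<close>
    assume "b = 2"
    hence "1 / real c = 2 / real n" using s a2 by simp
    hence "real n = real (2 * c)" using assms by (simp add: field_simps)
    thus ?thesis by linarith
  next
    assume b: "b = 3"
    have s': "1 / real c = 1 / 6 + 2 / real n" using s a2 b by simp
    have c5: "c \<le> 5"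
    proof (rule ccontr)
      assume "\<not> c \<le> 5"
      hence "real c \<ge> 6" by auto
      hence "1 / real c \<le> 1 / 6" by (auto simp: field_simps)
      moreover have "2 / real n > 0" using assms by simp
      ultimately show False using s' by simp
    qed
    have "c = 3 \<or> c = 4 \<or> c = 5" using assms b c5 by linarith
    moreover have "c = 3 \<Longrightarrow> real n = 12" "c = 4 \<Longrightarrow> real n = 24" "c = 5 \<Longrightarrow> real n = 60"
      using s' assms by (auto simp: field_simps)
    ultimately show ?thesis using a2 b by auto
  qed
qed

text \<open>\<open>N\<close> is the length of one orbit, \<open>k\<close> and \<open>d\<close> are
  the orders of kernel and complement there, \<open>e\<close> is the stabilizer order in the other
  orbit, and \<open>r\<close> counts regular orbits of a point stabilizer on the first. With
  \<open>N = e f\<close> and \<open>K = k - 2\<close> the equation shrinks to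
  \<open>f d = (K + 1) + K r d\<close>. Hence \<open>K + 1 = c d\<close> and
  \<open>f = c + K r\<close>; this number divides \<open>2 (1 + r d)\<close> and is coprime to
  \<open>1 + r d\<close>, so it is 1 or 2.\<close>

lemma pair_numerics:
  fixes k d e r N :: nat
  assumes k: "k \<ge> 3" and d: "d \<ge> 1" and e: "e \<ge> 2" and N: "N = 1 + k + r * k * d" and dv: "e dvd N"
    and eq: "N * k * d = 2 * e + (k - 2) * e * N"
  shows "(r = 0 \<and> (\<exists>c. (c = 1 \<or> c = 2) \<and> c * d = k - 1 \<and> c * e = k + 1)) \<or> (k = 3 \<and> d = 2 \<and> r = 1 \<and> e = 5)"
proof -
  obtain f where f: "N = e * f" using dv by (auto elim: dvdE)
  define K where "K = k - 2"
  have kK: "k = K + 2" "K \<ge> 1" using k K_def by auto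
  have "e * (f * k * d) = e * (2 + K * N)" using eq f K_def by (simp add: algebra_simps)
  hence 1: "f * k * d = 2 + K * N" using e by (metis mult_cancel1 not_numeral_le_zero)
  \<comment> \<open>Inserting \<open>N\<close> turns \<open>2 + K * N\<close> into
    \<open>(K + 1) * (K + 2) + K * r * k * d\<close>, and \<open>K + 2 = k\<close> is a common
    factor.\<close>
  have "k * (f * d) = k * ((K + 1) + K * r * d)" using 1 N kK by (simp add: algebra_simps)
  hence 2: "f * d = (K + 1) + K * r * d" using k by (metis mult_cancel1 not_numeral_le_zero)
  have "d dvd (K + 1) + K * r * d" using 2 by (metis dvd_triv_right)
  hence "d dvd K + 1" by (metis dvd_add_left_iff dvd_triv_right)
  then obtain c where c: "K + 1 = c * d" by (metis dvdE mult.commute)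
  have c1: "c \<ge> 1" using c by (cases c) auto
  have "d * f = d * (c + K * r)" using 2 c by (simp add: algebra_simps)
  hence ff: "f = c + K * r" using d by simp
  have main: "e * (c + K * r) = d * (c + K * r) + 2 * (1 + r * d)"
    using N f ff c kK by (simp add: algebra_simps)
  have "(c + K * r) dvd 2 * (1 + r * d)"
    using main by (metis dvd_add_right_iff dvd_triv_right)
  moreover have "coprime (c + K * r) (1 + r * d)"
  proof -
    \<comment> \<open>A common divisor of \<open>c + K * r\<close> and \<open>1 + r * d\<close>
      divides \<open>r\<close> by this identity, and hence divides 1.\<close>
    have "c + K * r + r = c * (1 + r * d)" using c by (metis add.assoc add_mult_distrib distrib_left mult.assoc mult.commute mult_1 nat_mult_1_right)
    have "is_unit g" if g: "g dvd c + K * r" "g dvd 1 + r * d" for g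
    proof -
      have "g dvd c + K * r + r" using g(2) \<open>c + K * r + r = c * (1 + r * d)\<close> by (metis dvd_mult)
      hence "g dvd r" using g(1) by (metis dvd_add_right_iff)
      thus ?thesis using g(2) by (metis add.commute dvd_add_right_iff dvd_mult2)
    qed
    thus ?thesis by (rule coprimeI)
  qed
  ultimately have "(c + K * r) dvd 2" using coprime_dvd_mult_left_iff by blast
  hence v: "c + K * r = 1 \<or> c + K * r = 2"
    by (metis dvd_imp_le dvd_0_left_iff le_neq_implies_less less_2_cases neq0_conv pos2 zero_neq_numeral One_nat_def)
  show ?thesis
  proof (cases "r = 0")
    case True
    hence "c = 1 \<or> c = 2" using v by simp
    moreover have "c * d = k - 1" using c kK by simp
    moreover have "c * e = k + 1" using N True f ff by (simp add: mult.commute)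
    ultimately show ?thesis using True by blast
  next
    case False
    hence "K * r \<ge> 1" using kK by simp
    hence "c = 1" "K * r = 1" using v c1 by linarith+
    hence "K = 1" "r = 1" by auto
    thus ?thesis using \<open>c = 1\<close> c kK N f ff by auto
  qed
qed

text \<open>The class formula for two orbits with \<open>N k d\<close> written for the group order,
  multiplied by \<open>2 e N k d\<close>.\<close>

lemma orbit_equation_clear:
  fixes N k d e :: real
  assumes p: "N > 0" "k > 0" "d > 0" "e > 0"
    and f: "1 / (2 * e) + 1 / (k * d) = 1 / (N * k * d) + 1 / (2 * d)"
  shows "N * k * d = 2 * e + (k - 2) * e * N"
proof -
  let ?m = "2 * e * N * k * d"
  have "?m * (1 / (2 * e) + 1 / (k * d)) = N * k * d + 2 * e * N"
    using p by (simp add: field_simps)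
  moreover have "?m * (1 / (N * k * d) + 1 / (2 * d)) = 2 * e + e * N * k"
    using p by (simp add: field_simps)
  moreover have "?m * (1 / (2 * e) + 1 / (k * d)) = ?m * (1 / (N * k * d) + 1 / (2 * d))"
    by (simp only: f)
  ultimately have "N * k * d + 2 * e * N = 2 * e + e * N * k" by simp
  thus ?thesis by (simp add: algebra_simps)
qed

section \<open>The number of nonregular orbits and their lengths\<close>

context one_or_two_fixed_points
begin

text \<open>Since the terms sum to less than 1, the bound 1/4 admits at most three orbits, and the
  bound 1/2 limits the orbits with nontrivial kernel to one among two orbits and to none among
  three.\<close>

lemma orbit_term_bounds:
  assumes x: "x \<in> nonregular_points"
  shows "orbit_term x \<ge> 1 / 4" "kernel_order x \<noteq> 1 \<Longrightarrow> orbit_term x \<ge> 1 / 2"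
    "kernel_order x = 1 \<Longrightarrow> orbit_term x = 1 / 2 - 1 / (2 * real (card (stab x)))"
    "orbit_term x \<le> 1 - 1 / real (card (stab x))"
proof -
  have E: "x \<in> E" using x by (simp add: nonregular_points_def)
  have h2: "card (stab x) \<ge> 2"
    using x card_subgroup_ge2 subgroup_stab by (auto simp: nonregular_points_def)
  have h: "real (card (stab x)) = real (kernel_order x) * real (comp_order x)"
    using kernel_comp_order[OF E] by (metis of_nat_mult)
  have k: "kernel_order x \<ge> 1" and d: "comp_order x \<ge> 1" using orders_pos[OF E] by auto
  show eq: "orbit_term x = 1 / 2 - 1 / (2 * real (card (stab x)))" if "kernel_order x = 1"
    using h that by (simp add: orbit_term_def)
  show ge: "orbit_term x \<ge> 1 / 2" if "kernel_order x \<noteq> 1"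
  proof -
    have "2 \<le> real (kernel_order x)" using k that by simp
    hence "2 * real (comp_order x) \<le> real (card (stab x))"
      unfolding h by (intro mult_right_mono) auto
    hence "1 / real (card (stab x)) \<le> 1 / (2 * real (comp_order x))"
      using d by (intro divide_left_mono) (auto intro!: mult_pos_pos)
    thus ?thesis by (simp add: orbit_term_def)
  qed
  show "orbit_term x \<ge> 1 / 4"
  proof (cases "kernel_order x = 1")
    case True
    have "1 / (2 * real (card (stab x))) \<le> 1 / (2 * 2)"
      using h2 by (intro divide_left_mono) auto
    thus ?thesis using eq[OF True] by simp
  qed (use ge in auto)
  have "1 / (2 * real (comp_order x)) \<le> 1 / 2" using d by (simp add: field_simps)
  thus "orbit_term x \<le> 1 - 1 / real (card (stab x))" by (simp add: orbit_term_def)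
qed

lemma nonregular_rep:
  assumes "\<Gamma> \<in> nonregular_orbits G E \<phi>"
  shows "(SOME x. x \<in> \<Gamma>) \<in> \<Gamma>" "orbit G \<phi> (SOME x. x \<in> \<Gamma>) = \<Gamma>" "(SOME x. x \<in> \<Gamma>) \<in> nonregular_points"
proof -
  obtain x where x: "x \<in> nonregular_points" "\<Gamma> = orbit G \<phi> x" using assms nonregular_orbits_eq by blast
  hence E: "x \<in> E" by (simp add: nonregular_points_def)
  show r: "(SOME x. x \<in> \<Gamma>) \<in> \<Gamma>" using orbit_refl[OF E] x(2) by (metis someI)
  show "orbit G \<phi> (SOME x. x \<in> \<Gamma>) = \<Gamma>" using orbit_eqI[OF E] r x(2) by simp
  show "(SOME x. x \<in> \<Gamma>) \<in> nonregular_points" using orbit_nonregular_points[OF x(1)] r x(2) by blast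
qed

text \<open>For distinct orbits its negation lets \<open>stab y\<close> act freely on the orbit of
  \<open>x\<close> and keeps partners of points of that orbit away from the orbit of
  \<open>y\<close>.\<close>

definition "linked x y \<longleftrightarrow> (\<exists>u\<in>orbit G \<phi> x. \<exists>v\<in>orbit G \<phi> y. partner u v)"

lemma three_orbits:
  assumes big: "\<And>x. x \<in> E \<Longrightarrow> 3 \<le> card (orbit G \<phi> x)" and NR: "card (nonregular_orbits G E \<phi>) = 3"
  shows "\<exists>x y z. x \<in> nonregular_points \<and> y \<in> nonregular_points \<and> z \<in> nonregular_points \<and>
     nonregular_orbits G E \<phi> = {orbit G \<phi> x, orbit G \<phi> y, orbit G \<phi> z} \<and>
     orbit G \<phi> x \<noteq> orbit G \<phi> y \<and> orbit G \<phi> x \<noteq> orbit G \<phi> z \<and> orbit G \<phi> y \<noteq> orbit G \<phi> z \<and>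
     kernel_order x = 1 \<and> kernel_order y = 1 \<and> kernel_order z = 1 \<and>
     card (stab x) = 2 \<and> card (stab y) = 3 \<and>
      (card (stab z) = 3 \<and> order G = 12 \<or> card (stab z) = 4 \<and> order G = 24 \<or> card (stab z) = 5 \<and> order G = 60)"
proof -
  let ?N = "nonregular_orbits G E \<phi>" and ?r = "\<lambda>\<Gamma>. SOME x. x \<in> \<Gamma>"
  define s where "s \<Gamma> = card (stab (?r \<Gamma>))" for \<Gamma>
  have "\<exists>A B C. ?N = {A, B, C} \<and> A \<noteq> B \<and> A \<noteq> C \<and> B \<noteq> C \<and> s A \<le> s B \<and> s B \<le> s C"
  proof -
    obtain A B C where N: "?N = {A, B, C}" "A \<noteq> B" "A \<noteq> C" "B \<noteq> C" using NR by (auto simp: card_3_iff)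
    have p: "{A,B,C} = {A,C,B}" "{A,B,C} = {B,A,C}" "{A,B,C} = {B,C,A}" "{A,B,C} = {C,A,B}" "{A,B,C} = {C,B,A}"
      by auto
    consider "s A \<le> s B" "s B \<le> s C" | "s A \<le> s C" "s C \<le> s B" | "s B \<le> s A" "s A \<le> s C"
      | "s B \<le> s C" "s C \<le> s A" | "s C \<le> s A" "s A \<le> s B" | "s C \<le> s B" "s B \<le> s A" by linarith
    thus ?thesis
      by cases (use N p in metis)+
  qed
  then obtain A B C where N: "?N = {A, B, C}" "A \<noteq> B" "A \<noteq> C" "B \<noteq> C" and le: "s A \<le> s B" "s B \<le> s C" by blast
  define x y z where "x = ?r A" and "y = ?r B" and "z = ?r C"
  have o: "orbit G \<phi> x = A" "orbit G \<phi> y = B" "orbit G \<phi> z = C"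
    and m: "x \<in> nonregular_points" "y \<in> nonregular_points" "z \<in> nonregular_points"
    using nonregular_rep N(1) unfolding x_def y_def z_def by auto
  have "(\<Sum>\<Gamma>\<in>?N. orbit_term (?r \<Gamma>)) = 1 - 1 / real (order G)"
    using nonregular_rep(1) by (rule class_formula)
  hence sum: "orbit_term x + orbit_term y + orbit_term z = 1 - 1 / real (order G)"
    using N by (simp add: x_def y_def z_def)
  have n0: "1 / real (order G) > 0" using order_pos by simp
  note b = orbit_term_bounds[OF m(1)] orbit_term_bounds[OF m(2)] orbit_term_bounds[OF m(3)]
  \<comment> \<open>Any two of the terms contribute at least 1/2, so a nontrivial kernel at the
    third point would bring the sum to 1.\<close>
  have k: "kernel_order x = 1" "kernel_order y = 1" "kernel_order z = 1"
  proof -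
    show "kernel_order x = 1" using b(2) b(5) b(9) sum n0 by linarith
    show "kernel_order y = 1" using b(6) b(1) b(9) sum n0 by linarith
    show "kernel_order z = 1" using b(10) b(1) b(5) sum n0 by linarith
  qed
  have "1 / (2 * real (card (stab x))) + 1 / (2 * real (card (stab y))) + 1 / (2 * real (card (stab z)))
      = 1 / 2 + 1 / real (order G)"
    using sum b(3)[OF k(1)] b(7)[OF k(2)] b(11)[OF k(3)] by linarith
  hence "1 / real (card (stab x)) + 1 / real (card (stab y)) + 1 / real (card (stab z)) = 1 + 2 / real (order G)"
    by (simp add: field_simps)
  moreover have "2 \<le> card (stab x)"
    using m(1) card_subgroup_ge2 subgroup_stab by (auto simp: nonregular_points_def)
  ultimately have "order G = 2 * card (stab z) \<or> (card (stab x) = 2 \<and> card (stab y) = 3 \<and>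
      (card (stab z) = 3 \<and> order G = 12 \<or> card (stab z) = 4 \<and> order G = 24 \<or> card (stab z) = 5 \<and> order G = 60))"
    using le order_pos unfolding s_def x_def y_def z_def by (intro triple_numerics) auto
  moreover have "order G \<noteq> 2 * card (stab z)"
  proof
    assume "order G = 2 * card (stab z)"
    moreover have zE: "z \<in> E" using m by (simp add: nonregular_points_def)
    ultimately have "card (orbit G \<phi> z) * card (stab z) = 2 * card (stab z)" using card_orbit by simp
    hence "card (orbit G \<phi> z) = 2" using card_subgroup_pos[OF subgroup_stab[OF zE]] by auto
    thus False using big[OF zE] by simp
  qed
  ultimately have h: "card (stab x) = 2 \<and> card (stab y) = 3 \<and>
      (card (stab z) = 3 \<and> order G = 12 \<or> card (stab z) = 4 \<and> order G = 24 \<or> card (stab z) = 5 \<and> order G = 60)"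
    by blast
  show ?thesis
    by (rule exI[of _ x], rule exI[of _ y], rule exI[of _ z], unfold o) (intro conjI m k N h[THEN conjunct1]
      h[THEN conjunct2, THEN conjunct1] h[THEN conjunct2, THEN conjunct2])
qed

text \<open>With a trivial kernel at \<open>y\<close> the class formula reads
  \<open>1 / (2 e) + 1 / (k d) = 1 / n + 1 / (2 d)\<close>. Free actions on the orbit of
  \<open>x\<close> supply the two divisibility conditions for \<open>pair_numerics\<close>: that of
  \<open>stab y\<close> on the whole orbit, and that of \<open>stab x\<close> on the points other
  than \<open>x\<close> and its partners.\<close>

lemma two_orbits_ordered:
  assumes big: "\<And>x. x \<in> E \<Longrightarrow> 3 \<le> card (orbit G \<phi> x)"
    and m: "x \<in> nonregular_points" "y \<in> nonregular_points"
    and sum: "orbit_term x + orbit_term y = 1 - 1 / real (order G)"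
    and N: "nonregular_orbits G E \<phi> = {orbit G \<phi> x, orbit G \<phi> y}" "orbit G \<phi> x \<noteq> orbit G \<phi> y"
    and ky: "kernel_order y = 1"
  shows "\<not> linked x y"
    "((\<exists>c. (c = 1 \<or> c = 2) \<and> c * comp_order x = kernel_order x - 1 \<and> c * card (stab y) = kernel_order x + 1)
        \<and> kernel_order x \<ge> 3 \<and> card (orbit G \<phi> x) = kernel_order x + 1)
     \<or> (kernel_order x = 3 \<and> comp_order x = 2 \<and> card (orbit G \<phi> x) = 10 \<and> card (stab y) = 5)"
proof -
  let ?k = "kernel_order x" and ?d = "comp_order x" and ?e = "card (stab y)" and ?n = "order G"
  let ?N = "card (orbit G \<phi> x)"
  have E: "x \<in> E" "y \<in> E" using m by (auto simp: nonregular_points_def)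
  have kd: "card (stab x) = ?k * ?d" using kernel_comp_order[OF E(1)] by simp
  have ey: "comp_order y = ?e" using kernel_comp_order[OF E(2)] ky by simp
  have pos: "?k \<ge> 1" "?d \<ge> 1" using orders_pos[OF E(1)] by auto
  have e2: "?e \<ge> 2" using m(2) card_subgroup_ge2 subgroup_stab by (auto simp: nonregular_points_def)
  have nx: "?N * (?k * ?d) = ?n" using card_orbit[OF E(1)] kd by simp
  have ny: "card (orbit G \<phi> y) * ?e = ?n" using card_orbit[OF E(2)] .
  have big_x: "3 \<le> ?N" and big_y: "3 \<le> card (orbit G \<phi> y)" using big E by auto
  have n3x: "3 * (?k * ?d) \<le> ?n" using nx big_x mult_le_mono1 by metis
  have n3y: "3 * ?e \<le> ?n" using ny big_y mult_le_mono1 by metis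
  have n0: "real ?n > 0" using order_pos by simp
  have f: "1 / (2 * real ?e) + 1 / (real ?k * real ?d) = 1 / real ?n + 1 / (2 * real ?d)"
    using sum orbit_term_bounds(3)[OF m(2) ky] by (simp add: orbit_term_def kd)
  \<comment> \<open>Partners have the same complement order, so a link means \<open>d = e\<close>.
    Then the class formula gives \<open>k d = n\<close>, and \<open>x\<close> would be fixed by all
    of \<open>G\<close>.\<close>
  show unl: "\<not> linked x y"
  proof
    assume "linked x y"
    then obtain u v where uv: "u \<in> orbit G \<phi> x" "v \<in> orbit G \<phi> y" "partner u v" by (auto simp: linked_def)
    hence "?d = ?e" using partner_comp_order[OF uv(3)] orbit_orders(2)[OF E(1) uv(1)] orbit_orders(2)[OF E(2) uv(2)] ey
      by simp
    hence "1 / (real ?k * real ?d) = 1 / real ?n" using f by simp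
    hence "real (?k * ?d) = real ?n" using n0 by (metis divide_cancel_left of_nat_mult zero_neq_one)
    hence "?k * ?d = ?n" by linarith
    thus False using n3x order_pos by linarith
  qed
  \<comment> \<open>For \<open>k = 1\<close> the formula becomes
    \<open>1 / (2 e) + 1 / (2 d) = 1 / n\<close>, although \<open>n\<close> is at least
    \<open>3 d\<close>. For \<open>k = 2\<close> it gives \<open>n = 2 e\<close>, that is, an orbit
    of length two.\<close>
  have k3: "?k \<ge> 3"
  proof (rule ccontr)
    assume "\<not> ?k \<ge> 3"
    hence "?k = 1 \<or> ?k = 2" using pos by linarith
    thus False
    proof
      assume k1: "?k = 1"
      have "real (3 * ?d) \<le> real ?n" using n3x k1 by simp
      hence "1 / real ?n \<le> 1 / (3 * real ?d)" using pos n0 by (intro divide_left_mono) auto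
      also have "\<dots> < 1 / (2 * real ?d)" using pos by (intro divide_strict_left_mono) auto
      finally have "1 / real ?n < 1 / (2 * real ?d)" .
      moreover have "1 / (2 * real ?d) + 1 / (2 * real ?d) = 1 / real ?d" by simp
      moreover have "1 / (2 * real ?e) > 0" using e2 by simp
      moreover have "1 / (2 * real ?e) + 1 / real ?d = 1 / real ?n + 1 / (2 * real ?d)" using f k1 by simp
      ultimately show False by linarith
    next
      assume "?k = 2"
      hence "1 / (2 * real ?e) = 1 / real ?n" using f by simp
      hence "real (2 * ?e) = real ?n" using n0 by (metis divide_cancel_left of_nat_mult of_nat_numeral zero_neq_one)
      thus False using n3y e2 by linarith
    qed
  qed
  have act: "subgroup_action G (stab w) (orbit G \<phi> x - Y) \<phi>"
    if w: "w \<in> E" and Y: "\<And>h v. h \<in> stab w \<Longrightarrow> v \<in> Y \<Longrightarrow> \<phi> h v \<in> Y" "Y \<subseteq> E" for w Y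
  proof (rule act_subgroup[OF subgroup_stab[OF w]])
    show "orbit G \<phi> x - Y \<subseteq> E" using orbit_subset[OF E(1)] by blast
    fix h v assume h: "h \<in> stab w" and v: "v \<in> orbit G \<phi> x - Y"
    hence hc: "h \<in> carrier G" and vE: "v \<in> E" using stab_carrier orbit_subset[OF E(1)] by auto
    have "\<phi> h v \<in> orbit G \<phi> x" using v act_mem_orbit[OF E(1) _ hc] by blast
    moreover have "\<phi> h v \<notin> Y"
    proof
      assume "\<phi> h v \<in> Y"
      hence "\<phi> (inv h) (\<phi> h v) \<in> Y" using Y(1) subgroup.m_inv_closed[OF subgroup_stab[OF w] h] by blast
      thus False using v hc vE by simp
    qed
    ultimately show "\<phi> h v \<in> orbit G \<phi> x - Y" by blast
  qed
  have "?e dvd card (orbit G \<phi> x - {})"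
  proof (rule subgroup_action.semiregular_dvd[OF act[OF E(2)]])
    fix h v assume h: "h \<in> stab y" "v \<in> orbit G \<phi> x - {}" "\<phi> h v = v"
    show "h = \<one>"
    proof (rule ccontr)
      assume "h \<noteq> \<one>"
      moreover have "v \<noteq> y" using h orbit_eqI[OF E(1), of y] N by auto
      ultimately have "partner v y" using h E orbit_subset[OF E(1)]
        by (intro partnerI[of h]) (auto simp: stab_iff)
      thus False using unl h orbit_refl[OF E(2)] by (auto simp: linked_def)
    qed
  qed auto
  hence dv: "?e dvd ?N" by simp
  \<comment> \<open>The orbit consists of \<open>x\<close>, its \<open>k\<close> partners, which
    belong to it because the two orbits are not linked, and regular orbits of \<open>stab x\<close>
    of length \<open>k d\<close>.\<close>
  have "\<exists>r. ?N = 1 + ?k + r * ?k * ?d"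
  proof (cases "\<exists>w. partner x w")
    case True
    then obtain w where w: "partner x w" by blast
    have wE: "w \<in> E" "x \<noteq> w" using w by (auto simp: partner_def)
    have wx: "w \<in> orbit G \<phi> x"
    proof -
      have "w \<in> nonregular_points" using w partner_sym[OF w] by (auto simp: partner_def nonregular_points_def)
      hence "orbit G \<phi> w \<in> {orbit G \<phi> x, orbit G \<phi> y}" using N nonregular_orbits_eq by blast
      moreover have "orbit G \<phi> w \<noteq> orbit G \<phi> y"
        using unl w orbit_refl[OF wE(1)] orbit_refl[OF E(1)] by (auto simp: linked_def)
      ultimately show ?thesis using orbit_refl[OF wE(1)] by auto
    qed
    let ?Y = "insert x (complement_orbit x w)"
    have Yx: "x \<notin> complement_orbit x w" "complement_orbit x w \<subseteq> E"
      using complement_orbit_subset[OF E(1) wE] by auto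
    have Yo: "?Y \<subseteq> orbit G \<phi> x"
    proof -
      have "\<phi> h w \<in> orbit G \<phi> x" if "h \<in> stab x" for h
        using act_mem_orbit[OF E(1) wx stab_carrier[OF that]] .
      thus ?thesis using orbit_refl[OF E(1)] by (auto simp: complement_orbit_def)
    qed
    have "card (stab x) dvd card (orbit G \<phi> x - ?Y)"
    proof (rule subgroup_action.semiregular_dvd[OF act[OF E(1)]])
      fix h v assume h: "h \<in> stab x" "v \<in> ?Y"
      show "\<phi> h v \<in> ?Y"
      proof (cases "v = x")
        case True thus ?thesis using h by (simp add: stab_iff)
      next
        case False
        then obtain g where g: "g \<in> stab x" "v = \<phi> g w" using h by (auto simp: complement_orbit_def)
        have "\<phi> (h \<otimes> g) w = \<phi> h v" using act_mult[OF stab_carrier[OF h(1)] stab_carrier[OF g(1)] wE(1)] g by simp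
        thus ?thesis using subgroup.m_closed[OF subgroup_stab[OF E(1)] h(1) g(1)]
          unfolding complement_orbit_def by (metis imageI insertI2)
      qed
    next
      fix h v assume h: "h \<in> stab x" "v \<in> orbit G \<phi> x - ?Y" "\<phi> h v = v"
      show "h = \<one>"
      proof (rule ccontr)
        assume "h \<noteq> \<one>"
        hence "partner x v" using h E orbit_subset[OF E(1)] by (intro partnerI[of h]) (auto simp: stab_iff)
        thus False using partner_orbit[OF w] h by auto
      qed
    qed (use Yx E in auto)
    then obtain r where r: "card (orbit G \<phi> x - ?Y) = ?k * ?d * r" using kd by (auto elim: dvdE)
    have "finite (complement_orbit x w)" by (simp add: complement_orbit_def)
    hence "card ?Y = 1 + ?k" using Yx kernel_order_partner[OF w] by simp
    moreover have "card (orbit G \<phi> x - ?Y) = ?N - card ?Y"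
      by (rule card_Diff_subset[OF finite_subset[OF Yo finite_orbit] Yo])
    moreover have "card ?Y \<le> ?N" by (rule card_mono[OF finite_orbit Yo])
    ultimately have "?N = 1 + ?k + r * ?k * ?d" using r by (simp add: ac_simps)
    thus ?thesis by blast
  next
    case False
    hence d1: "?d = 1" by (simp add: comp_order_def)
    have "card (stab x) dvd card (orbit G \<phi> x - {x})"
    proof (rule subgroup_action.semiregular_dvd[OF act[OF E(1)]])
      fix h v assume h: "h \<in> stab x" "v \<in> orbit G \<phi> x - {x}" "\<phi> h v = v"
      show "h = \<one>"
      proof (rule ccontr)
        assume "h \<noteq> \<one>"
        hence "partner x v" using h E orbit_subset[OF E(1)] by (intro partnerI[of h]) (auto simp: stab_iff)
        thus False using False by blast
      qed
    qed (use E in \<open>auto simp: stab_iff\<close>)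
    then obtain r where r: "?N - 1 = ?k * r"
      using kd d1 orbit_refl[OF E(1)] by (auto elim: dvdE simp: card_Diff_singleton)
    have "r \<noteq> 0"
    proof
      assume "r = 0"
      hence "?N - 1 = 0" using r by simp
      thus False using big_x by linarith
    qed
    \<comment> \<open>Without partners \<open>d = 1\<close>, and one of the regular orbits, now of
      length \<open>k\<close>, takes the place of the set of partners.\<close>
    then obtain r' where "r = Suc r'" by (cases r) auto
    hence "?N = 1 + ?k + r' * ?k * ?d" using r d1 big_x by (simp add: ac_simps)
    thus ?thesis by blast
  qed
  then obtain r where r: "?N = 1 + ?k + r * ?k * ?d" by blast
  have "?N * ?k * ?d = 2 * ?e + (?k - 2) * ?e * ?N"
  proof -
    have n: "real ?n = real ?N * real ?k * real ?d" using nx by (metis mult.assoc of_nat_mult)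
    have p: "real ?N > 0" "real ?k > 0" "real ?d > 0" "real ?e > 0" using big_x k3 pos e2 by auto
    have "real ?N * real ?k * real ?d = 2 * real ?e + (real ?k - 2) * real ?e * real ?N"
      using f unfolding n by (rule orbit_equation_clear[OF p])
    also have "real ?k - 2 = real (?k - 2)" using k3 by simp
    finally have "real (?N * ?k * ?d) = real (2 * ?e + (?k - 2) * ?e * ?N)"
      by (simp only: of_nat_mult of_nat_add of_nat_numeral)
    thus ?thesis by (simp only: of_nat_eq_iff)
  qed
  from pair_numerics[OF k3 pos(2) e2 r dv this]
  show "((\<exists>c. (c = 1 \<or> c = 2) \<and> c * ?d = ?k - 1 \<and> c * ?e = ?k + 1) \<and> ?k \<ge> 3 \<and> ?N = ?k + 1)
     \<or> (?k = 3 \<and> ?d = 2 \<and> ?N = 10 \<and> ?e = 5)"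
  proof
    assume h: "r = 0 \<and> (\<exists>c. (c = 1 \<or> c = 2) \<and> c * ?d = ?k - 1 \<and> c * ?e = ?k + 1)"
    hence "?N = ?k + 1" using r by simp
    thus ?thesis using h k3 by blast
  next
    assume h: "?k = 3 \<and> ?d = 2 \<and> r = 1 \<and> ?e = 5"
    hence "?N = 10" using r by simp
    thus ?thesis using h by blast
  qed
qed

text \<open>Two nontrivial kernels would give two terms of at least 1/2. The names are exchanged if
  necessary so that \<open>y\<close> is a point with trivial kernel.\<close>

lemma two_orbits:
  assumes big: "\<And>x. x \<in> E \<Longrightarrow> 3 \<le> card (orbit G \<phi> x)" and NR: "card (nonregular_orbits G E \<phi>) = 2"
  shows "\<exists>x y. x \<in> nonregular_points \<and> y \<in> nonregular_points \<and>
     nonregular_orbits G E \<phi> = {orbit G \<phi> x, orbit G \<phi> y} \<and> orbit G \<phi> x \<noteq> orbit G \<phi> y \<and>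
     kernel_order y = 1 \<and> \<not> linked x y \<and>
     (((\<exists>c. (c = 1 \<or> c = 2) \<and> c * comp_order x = kernel_order x - 1 \<and> c * card (stab y) = kernel_order x + 1)
        \<and> kernel_order x \<ge> 3 \<and> card (orbit G \<phi> x) = kernel_order x + 1)
     \<or> (kernel_order x = 3 \<and> comp_order x = 2 \<and> card (orbit G \<phi> x) = 10 \<and> card (stab y) = 5))"
proof -
  let ?N = "nonregular_orbits G E \<phi>" and ?r = "\<lambda>\<Gamma>. SOME x. x \<in> \<Gamma>"
  obtain A B where N: "?N = {A, B}" "A \<noteq> B" using NR by (auto simp: card_2_iff)
  define x y where "x = ?r A" and "y = ?r B"
  have o: "orbit G \<phi> x = A" "orbit G \<phi> y = B"
    and m: "x \<in> nonregular_points" "y \<in> nonregular_points"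
    using nonregular_rep N(1) unfolding x_def y_def by auto
  have "(\<Sum>\<Gamma>\<in>?N. orbit_term (?r \<Gamma>)) = 1 - 1 / real (order G)"
    using nonregular_rep(1) by (rule class_formula)
  hence sum: "orbit_term x + orbit_term y = 1 - 1 / real (order G)"
    using N by (simp add: x_def y_def)
  have n0: "1 / real (order G) > 0" using order_pos by simp
  have "kernel_order x = 1 \<or> kernel_order y = 1"
    using orbit_term_bounds(2)[OF m(1)] orbit_term_bounds(2)[OF m(2)] sum n0 by linarith
  thus ?thesis
  proof
    assume k: "kernel_order y = 1"
    have "?N = {orbit G \<phi> x, orbit G \<phi> y}" "orbit G \<phi> x \<noteq> orbit G \<phi> y" using N o by auto
    with two_orbits_ordered[OF big m sum this k] k m show ?thesis by blast
  next
    assume k: "kernel_order x = 1"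
    have "?N = {orbit G \<phi> y, orbit G \<phi> x}" "orbit G \<phi> y \<noteq> orbit G \<phi> x" using N o by auto
    moreover have "orbit_term y + orbit_term x = 1 - 1 / real (order G)" using sum by simp
    ultimately show ?thesis using two_orbits_ordered[OF big m(2,1) _ _ _ k] k m by blast
  qed
qed

text \<open>Terms of at least 1/4 with a sum below 1 leave at most three orbits. A single orbit
  would have the term \<open>1 - 1 / order G\<close>, which forces the stabilizer to be all of
  \<open>G\<close>; with none the formula makes \<open>G\<close> trivial. Both contradict the
  lengths of the orbits.\<close>

lemma card_nonregular_orbits:
  assumes E: "E \<noteq> {}" and big: "\<And>x. x \<in> E \<Longrightarrow> 3 \<le> card (orbit G \<phi> x)"
  shows "card (nonregular_orbits G E \<phi>) = 2 \<or> card (nonregular_orbits G E \<phi>) = 3"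
proof -
  let ?N = "nonregular_orbits G E \<phi>" and ?r = "\<lambda>\<Gamma>. SOME x. x \<in> \<Gamma>"
  have finN: "finite ?N" using finite_nonregular_points by (simp add: nonregular_orbits_eq)
  have sum: "(\<Sum>\<Gamma>\<in>?N. orbit_term (?r \<Gamma>)) = 1 - 1 / real (order G)"
    using nonregular_rep(1) by (rule class_formula)
  have "real (card ?N) * (1 / 4) \<le> (\<Sum>\<Gamma>\<in>?N. orbit_term (?r \<Gamma>))"
    using orbit_term_bounds(1)[OF nonregular_rep(3)] by (intro sum_bounded_below) auto
  moreover have n0: "1 / real (order G) > 0" using order_pos by simp
  ultimately have "real (card ?N) < 4" using sum by linarith
  hence "card ?N < 4" by linarith
  moreover have "card ?N \<noteq> 0"
  proof
    assume "card ?N = 0"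
    hence "?N = {}" using finN by simp
    hence "order G = 1" using sum order_pos by simp
    moreover obtain x where x: "x \<in> E" using E by blast
    ultimately have "card (orbit G \<phi> x) = 1" using card_orbit[OF x] by simp
    thus False using big[OF x] by simp
  qed
  moreover have "card ?N \<noteq> 1"
  proof
    assume "card ?N = 1"
    then obtain A where A: "?N = {A}" by (auto simp: card_1_singleton_iff)
    let ?x = "?r A"
    have xm: "?x \<in> nonregular_points" using nonregular_rep(3) A by simp
    hence xE: "?x \<in> E" by (simp add: nonregular_points_def)
    have "1 - 1 / real (order G) \<le> 1 - 1 / real (card (stab ?x))"
      using sum A orbit_term_bounds(4)[OF xm] by simp
    hence "1 / real (card (stab ?x)) \<le> 1 / real (order G)" by simp
    moreover have p: "card (stab ?x) > 0" using card_subgroup_pos[OF subgroup_stab[OF xE]] .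
    ultimately have "order G \<le> card (stab ?x)" using order_pos by (simp add: field_simps)
    moreover have "3 * card (stab ?x) \<le> order G" using card_orbit[OF xE] big[OF xE] mult_le_mono1 by metis
    ultimately show False using p by linarith
  qed
  ultimately show ?thesis by linarith
qed

end

section \<open>Zassenhaus actions and their field\<close>

text \<open>The situation on the orbit of length \<open>k + 1\<close>, with \<open>q\<close> for
  \<open>k\<close> and with \<open>pinf\<close> and \<open>p0\<close> as infinity and zero. The fact
  about interchanges enters as the assumption \<open>swap_square\<close>, because the fixed point
  used to prove it may lie outside this orbit.\<close>

locale zassenhaus_action = two_fixed_points +
  fixes q d c :: nat and pinf p0
  assumes finite_points: "finite E" and card_points: "card E = q + 1" and q3: "q \<ge> 3"
    and card_stab: "x \<in> E \<Longrightarrow> card (stab x) = q * d"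
    and card_stab2: "\<lbrakk>x \<in> E; y \<in> E; x \<noteq> y\<rbrakk> \<Longrightarrow> card (stab x \<inter> stab y) = d"
    and c: "c * d = q - 1" "c = 1 \<or> c = 2"
    and swap_square: "\<lbrakk>g \<in> carrier G; x \<in> E; y \<in> E; x \<noteq> y; \<phi> g x = y; \<phi> g y = x\<rbrakk> \<Longrightarrow> g \<otimes> g = \<one>"
    and base: "pinf \<in> E" "p0 \<in> E" "pinf \<noteq> p0"
begin

abbreviation K where "K \<equiv> kernel_set pinf"
abbreviation D where "D \<equiv> stab pinf \<inter> stab p0"

lemma d_pos: "d \<ge> 1"
  using card_stab2[OF base] card_subgroup_pos[OF subgroup_stab2[OF base(1,2)]] by simp

text \<open>The orbit of \<open>y\<close> under \<open>stab x\<close> has \<open>q d / d = q\<close>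
  points and so fills \<open>E - {x}\<close>.\<close>

lemma stab_transitive:
  assumes "x \<in> E" "y \<in> E" "z \<in> E" "x \<noteq> y" "x \<noteq> z"
  shows "\<exists>h\<in>stab x. \<phi> h y = z"
proof -
  have "card (complement_orbit x y) * d = q * d"
    using card_complement_orbit assms card_stab2 card_stab by metis
  hence "card (complement_orbit x y) = card (E - {x})"
    using d_pos assms card_points by simp
  moreover have "complement_orbit x y \<subseteq> E - {x}" using complement_orbit_subset assms by blast
  ultimately have "complement_orbit x y = E - {x}"
    using finite_points card_subset_eq[of "E - {x}"] by blast
  hence "z \<in> complement_orbit x y" using assms by blast
  thus ?thesis by (auto simp: complement_orbit_def)
qed

lemma card_K: "card K = q"
proof -
  have "comp_order pinf = d"
  proof (cases "\<exists>y. partner pinf y")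
    case True
    then obtain y where y: "partner pinf y" by blast
    thus ?thesis using comp_order_partner[OF y] card_stab2[of pinf y] by (simp add: partner_def)
  next
    case False
    hence "stab pinf \<inter> stab p0 = {\<one>}" using base by (auto simp: partner_def)
    thus ?thesis using False card_stab2[OF base] by (simp add: comp_order_def)
  qed
  thus ?thesis using card_kernel_set[OF base(1)] d_pos card_stab[OF base(1)] by (simp add: kernel_order_def)
qed

lemmas K_facts = kernel_set_subgroup[OF base card_K card_stab2[OF base] card_stab[OF base(1)] c]

lemma K_carrier [simp]: "u \<in> K \<Longrightarrow> u \<in> carrier G"
  by (rule kernel_set_carrier)

lemma K_closed [simp]: "u \<in> K \<Longrightarrow> v \<in> K \<Longrightarrow> u \<otimes> v \<in> K"
  by (rule subgroup.m_closed[OF K_facts(1)])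

lemma K_inv [simp]: "u \<in> K \<Longrightarrow> inv u \<in> K"
  by (rule subgroup.m_inv_closed[OF K_facts(1)])

lemma K_one [simp]: "\<one> \<in> K"
  by (rule one_kernel_set[OF base(1)])

lemma K_comm: "u \<in> K \<Longrightarrow> v \<in> K \<Longrightarrow> u \<otimes> v = v \<otimes> u"
  by (rule K_facts(2))

lemma K_finite [simp]: "finite K"
  using card_K q3 by (metis card.infinite not_numeral_le_zero)

lemma K_fix: "u \<in> K \<Longrightarrow> \<phi> u pinf = pinf"
  unfolding kernel_set_def stabilizer_def by blast

lemma K_free: "u \<in> K \<Longrightarrow> x \<in> E \<Longrightarrow> x \<noteq> pinf \<Longrightarrow> \<phi> u x = x \<Longrightarrow> u = \<one>"
  unfolding kernel_set_def by blast

text \<open>\<open>K\<close> acts freely on the points other than \<open>pinf\<close> and has as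
  many elements as there are such points. This makes it possible to label them by
  \<open>K\<close>.\<close>

lemma K_regular: "bij_betw (\<lambda>u. \<phi> u p0) K (E - {pinf})"
proof -
  have inj: "inj_on (\<lambda>u. \<phi> u p0) K"
  proof (rule inj_onI)
    fix u v assume uv: "u \<in> K" "v \<in> K" "\<phi> u p0 = \<phi> v p0"
    hence "\<phi> (inv v \<otimes> u) p0 = p0" using base by (simp add: act_mult)
    hence "inv v \<otimes> u = \<one>" using K_free[of "inv v \<otimes> u" p0] uv base by auto
    hence "v \<otimes> (inv v \<otimes> u) = v" using uv by simp
    thus "u = v" using uv by (simp add: m_assoc[symmetric])
  qed
  have sub: "(\<lambda>u. \<phi> u p0) ` K \<subseteq> E - {pinf}"
  proof
    fix x assume "x \<in> (\<lambda>u. \<phi> u p0) ` K"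
    then obtain u where u: "u \<in> K" "x = \<phi> u p0" by blast
    have "x \<noteq> pinf"
    proof
      assume "x = pinf"
      hence "\<phi> u pinf = \<phi> u p0" using K_fix[OF u(1)] u(2) by metis
      thus False using act_eq_iff[OF K_carrier[OF u(1)] base(1,2)] base(3) by blast
    qed
    thus "x \<in> E - {pinf}" using act_closed[OF K_carrier[OF u(1)] base(2)] u(2) by blast
  qed
  have "card ((\<lambda>u. \<phi> u p0) ` K) = card (E - {pinf})"
    using card_image[OF inj] card_K card_points base by simp
  hence "(\<lambda>u. \<phi> u p0) ` K = E - {pinf}" using sub finite_points by (intro card_subset_eq) auto
  thus ?thesis using inj by (simp add: bij_betw_def)
qed

lemma D_carrier: "g \<in> D \<Longrightarrow> g \<in> carrier G"
  by (auto dest: stab_carrier)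

lemma subgroup_D: "subgroup D G"
  by (rule subgroup_stab2[OF base(1,2)])

lemma conj_K [simp]: "g \<in> stab pinf \<Longrightarrow> u \<in> K \<Longrightarrow> conj_by g u \<in> K"
  using conj_kernel_set[OF base(1)] by blast

text \<open>A third point \<open>w\<close> supplies the group \<open>stab w\<close>, which is
  transitive on the other points and carries \<open>pinf\<close> to \<open>p0\<close>. An element of
  \<open>stab p0\<close> then returns the image of \<open>p0\<close> to \<open>pinf\<close>.\<close>

lemma swap_exists: "\<exists>t\<in>carrier G. \<phi> t pinf = p0 \<and> \<phi> t p0 = pinf"
proof -
  have "card {pinf, p0} < card E" using base card_points q3 by simp
  hence "\<not> E \<subseteq> {pinf, p0}" using card_mono[of "{pinf, p0}" E] by auto
  then obtain w where w: "w \<in> E" "w \<noteq> pinf" "w \<noteq> p0" by blast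
  obtain h where h: "h \<in> stab w" "\<phi> h pinf = p0" using stab_transitive[of w "pinf" "p0"] w base by metis
  have hc: "h \<in> carrier G" using h by (simp add: stab_iff)
  let ?v = "\<phi> h p0"
  have v: "?v \<in> E" "p0 \<noteq> ?v" using base h hc act_eq_iff[OF hc base(1,2)] by auto
  obtain k where k: "k \<in> stab p0" "\<phi> k ?v = pinf"
    using stab_transitive[of p0 ?v pinf] v base by metis
  have "\<phi> (k \<otimes> h) pinf = p0" "\<phi> (k \<otimes> h) p0 = pinf"
    using h k hc base by (auto simp: act_mult stab_iff)
  thus ?thesis using hc k by (intro bexI[of _ "k \<otimes> h"]) (auto simp: stab_iff)
qed

text \<open>With \<open>t\<close> also \<open>t \<otimes> g\<close> interchanges \<open>pinf\<close>
  and \<open>p0\<close>, so its square is trivial as well.\<close>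

lemma swap_inverts:
  assumes t: "t \<in> carrier G" "\<phi> t pinf = p0" "\<phi> t p0 = pinf"
  shows "t \<otimes> t = \<one>" "g \<in> D \<Longrightarrow> t \<otimes> g \<otimes> t = inv g"
proof -
  show tt: "t \<otimes> t = \<one>" using swap_square[of t "pinf" "p0"] t base by blast
  show "t \<otimes> g \<otimes> t = inv g" if g: "g \<in> D"
  proof -
    have gc: "g \<in> carrier G" using g by (rule D_carrier)
    have "\<phi> (t \<otimes> g) pinf = p0" "\<phi> (t \<otimes> g) p0 = pinf"
      using t g base by (auto simp: act_mult stab_iff)
    hence "(t \<otimes> g) \<otimes> (t \<otimes> g) = \<one>" using swap_square[of "t \<otimes> g" "pinf" "p0"] t gc base by blast
    hence "(t \<otimes> g \<otimes> t) \<otimes> g = \<one>" using t gc by (simp add: m_assoc)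
    thus ?thesis using inv_equality[of "t \<otimes> g \<otimes> t" g] t gc by simp
  qed
qed

lemma D_comm:
  assumes "a \<in> D" "b \<in> D" shows "a \<otimes> b = b \<otimes> a"
proof -
  obtain t where t: "t \<in> carrier G" "\<phi> t pinf = p0" "\<phi> t p0 = pinf" using swap_exists by blast
  have ab: "a \<in> carrier G" "b \<in> carrier G" "a \<otimes> b \<in> D" using assms D_carrier subgroup.m_closed[OF subgroup_D] by blast+
  have "inv (a \<otimes> b) = t \<otimes> (a \<otimes> b) \<otimes> t" using swap_inverts(2)[OF t ab(3)] by simp
  also have "\<dots> = t \<otimes> a \<otimes> ((t \<otimes> t) \<otimes> b) \<otimes> t" using t ab swap_inverts(1)[OF t] by (simp add: m_assoc)
  also have "\<dots> = (t \<otimes> a \<otimes> t) \<otimes> (t \<otimes> b \<otimes> t)" using t ab by (simp add: m_assoc)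
  also have "\<dots> = inv (b \<otimes> a)" using swap_inverts(2)[OF t] assms ab by (simp add: inv_mult_group)
  finally show ?thesis using ab by (metis inv_inv m_closed)
qed

lemma D_conj_free:
  assumes "g \<in> D" "u \<in> K" "u \<noteq> \<one>" "conj_by g u = u" shows "g = \<one>"
proof -
  have "g \<in> K" using commute_kernel_set[OF base(1) assms(2,3), of g] assms conj_fix_iff[of g u] D_carrier[OF assms(1)] by auto
  thus ?thesis using K_free[of g p0] assms(1) base unfolding stabilizer_def by blast
qed

text \<open>\<open>D\<close> acts freely on the nonidentity elements of \<open>V\<close>, so
  \<open>card V\<close> is at least \<open>d + 1\<close>, whereas \<open>q = c d + 1\<close> is at
  most \<open>2 d + 1\<close>. A divisor of \<open>q\<close> larger than \<open>q / 2\<close> is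
  \<open>q\<close>.\<close>

lemma D_irreducible:
  assumes V: "subgroup V G" "V \<subseteq> K" "V \<noteq> {\<one>}" and inv: "\<And>g u. g \<in> D \<Longrightarrow> u \<in> V \<Longrightarrow> conj_by g u \<in> V"
  shows "V = K"
proof -
  have Vc: "u \<in> carrier G" if "u \<in> V" for u using V that by auto
  have fV: "finite V" using V K_finite finite_subset by blast
  have oV: "\<one> \<in> V" using V subgroup.one_closed by blast
  interpret A: subgroup_action G D "V - {\<one>}" conj_by
  proof (rule subgroup_actionI[OF subgroup_D])
    fix g u assume g: "g \<in> D" and u: "u \<in> V - {\<one>}"
    thus "conj_by g u \<in> V - {\<one>}" using inv conj_eq_iff[of g u \<one>] Vc D_carrier[OF g] by auto
  qed (auto simp: conj_mult Vc dest: stab_carrier)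
  have "card D dvd card (V - {\<one>})"
    by (rule A.semiregular_dvd) (use fV D_conj_free V in blast)+
  hence "d dvd card V - 1" using card_stab2[OF base] oV by (simp add: card_Diff_singleton)
  moreover have V2: "card V \<ge> 2" using card_subgroup_ge2 V by blast
  ultimately have dV: "d \<le> card V - 1" by (intro dvd_imp_le) auto
  interpret B: subgroup_action G V K "\<lambda>v u. v \<otimes> u"
  proof (rule subgroup_actionI[OF V(1)])
    show "v \<otimes> u \<in> K" if "v \<in> V" "u \<in> K" for v u using that V(2) K_closed by blast
    show "v \<otimes> w \<otimes> u = v \<otimes> (w \<otimes> u)" if "v \<in> V" "w \<in> V" "u \<in> K" for v w u
      using m_assoc[OF Vc[OF that(1)] Vc[OF that(2)] K_carrier[OF that(3)]] .
    show "\<one> \<otimes> u = u" if "u \<in> K" for u using that by simp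
  qed
  have "card V dvd card K"
  proof (rule B.semiregular_dvd)
    fix v u assume "v \<in> V" "u \<in> K" "v \<otimes> u = u"
    thus "v = \<one>" using Vc[of v] K_carrier[of u] right_cancel[of u v \<one>] by simp
  qed simp
  then obtain j where j: "q = card V * j" using card_K by (auto elim: dvdE)
  have "c * d \<le> 2 * d" using c by auto
  hence lt: "q < 2 * card V" using c dV V2 q3 by linarith
  have "j < 2" using lt j by (metis mult.commute mult_less_cancel2)
  moreover have "j \<noteq> 0" using j q3 by (metis mult_0_right not_numeral_le_zero)
  ultimately have "card V = q" using j by (cases j) auto
  thus ?thesis using V(2) card_K K_finite card_subset_eq by metis
qed

text \<open>The field is the centre of the ring of endomorphisms of \<open>K\<close> that commute with \<open>D\<close>; since \<open>K\<close> is
  irreducible under \<open>D\<close>, evaluation at a nonidentity element identifies it with \<open>K\<close>.\<close>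

definition D_endo where
  "D_endo f \<longleftrightarrow> (\<forall>a\<in>K. f a \<in> K) \<and> (\<forall>a\<in>K. \<forall>b\<in>K. f (a \<otimes> b) = f a \<otimes> f b) \<and>
     (\<forall>g\<in>D. \<forall>a\<in>K. f (conj_by g a) = conj_by g (f a))"

definition central_endo where
  "central_endo f \<longleftrightarrow> D_endo f \<and> (\<forall>f'. D_endo f' \<longrightarrow> (\<forall>a\<in>K. f (f' a) = f' (f a)))"

lemma D_endoD:
  assumes "D_endo f"
  shows "a \<in> K \<Longrightarrow> f a \<in> K" "a \<in> K \<Longrightarrow> b \<in> K \<Longrightarrow> f (a \<otimes> b) = f a \<otimes> f b"
    "g \<in> D \<Longrightarrow> a \<in> K \<Longrightarrow> f (conj_by g a) = conj_by g (f a)"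
  using assms unfolding D_endo_def by blast+

lemma D_endo_one: "D_endo f \<Longrightarrow> f \<one> = \<one>"
  using D_endoD(1)[of f \<one>] D_endoD(2)[of f \<one> \<one>] by simp

lemma D_endo_inv: "D_endo f \<Longrightarrow> a \<in> K \<Longrightarrow> f (inv a) = inv (f a)"
  using D_endoD(2)[of f "inv a" a] D_endo_one[of f] D_endoD(1)[of f] inv_equality[of "f (inv a)" "f a"] by simp

text \<open>The equalizer of \<open>f\<close> and \<open>f'\<close> is a subgroup of
  \<open>K\<close> invariant under \<open>D\<close>, and it contains \<open>e\<close>. Thus
  evaluation at \<open>e\<close> is injective.\<close>

lemma D_endo_unique:
  assumes f: "D_endo f" "D_endo f'" and e: "e \<in> K" "e \<noteq> \<one>" "f e = f' e" and a: "a \<in> K"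
  shows "f a = f' a"
proof -
  let ?V = "{a \<in> K. f a = f' a}"
  have "?V = K"
  proof (rule D_irreducible)
    show "subgroup ?V G"
    proof (rule subgroupI)
      show "?V \<subseteq> carrier G" using K_carrier by blast
      show "?V \<noteq> {}" using e by blast
      show "inv u \<in> ?V" if "u \<in> ?V" for u
        using that D_endo_inv[OF f(1), of u] D_endo_inv[OF f(2), of u] K_inv[of u] by auto
      show "u \<otimes> v \<in> ?V" if "u \<in> ?V" "v \<in> ?V" for u v
        using that D_endoD(2)[OF f(1), of u v] D_endoD(2)[OF f(2), of u v] K_closed[of u v] by auto
    qed
    show "?V \<noteq> {\<one>}" using e by blast
    show "conj_by g u \<in> ?V" if "g \<in> D" "u \<in> ?V" for g u
      using that D_endoD(3)[OF f(1), of g u] D_endoD(3)[OF f(2), of g u] conj_K[of g u] by simp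
  qed blast
  thus ?thesis using a by blast
qed

lemma central_endoD: "central_endo f \<Longrightarrow> D_endo f"
    "central_endo f \<Longrightarrow> D_endo f' \<Longrightarrow> a \<in> K \<Longrightarrow> f (f' a) = f' (f a)"
  by (auto simp: central_endo_def)

text \<open>Conjugation by \<open>g\<close> commutes with \<open>D\<close> because \<open>D\<close>
  is abelian, and it commutes with every \<open>D_endo\<close> by the definition of the
  latter.\<close>

lemma conj_central:
  assumes g: "g \<in> D" shows "central_endo (conj_by g)"
proof -
  have gs: "g \<in> stab pinf" using g by blast
  have "D_endo (conj_by g)"
    unfolding D_endo_def
  proof (intro conjI ballI)
    fix h a assume h: "h \<in> D" and a: "a \<in> K"
    show "conj_by g (conj_by h a) = conj_by h (conj_by g a)"
      using conj_mult[of g h a] conj_mult[of h g a] D_comm[OF g h] D_carrier[OF g] D_carrier[OF h] a by simp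
  qed (use gs D_carrier[OF g] in \<open>auto simp: conj_hom\<close>)
  thus ?thesis unfolding central_endo_def using D_endoD(3) g by metis
qed

lemma central_comp:
  assumes "central_endo f" "central_endo f'" shows "central_endo (\<lambda>a. f (f' a))"
proof -
  note F = central_endoD(1)[OF assms(1)] and F' = central_endoD(1)[OF assms(2)]
  have "D_endo (\<lambda>a. f (f' a))"
    unfolding D_endo_def
  proof (intro conjI ballI)
    show "f (f' a) \<in> K" if "a \<in> K" for a using D_endoD(1)[OF F D_endoD(1)[OF F' that]] .
    show "f (f' (a \<otimes> b)) = f (f' a) \<otimes> f (f' b)" if ab: "a \<in> K" "b \<in> K" for a b
      using D_endoD(2)[OF F' ab] D_endoD(2)[OF F D_endoD(1)[OF F' ab(1)] D_endoD(1)[OF F' ab(2)]] by simp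
    show "f (f' (conj_by g a)) = conj_by g (f (f' a))" if ga: "g \<in> D" "a \<in> K" for g a
      using D_endoD(3)[OF F' ga] D_endoD(3)[OF F ga(1) D_endoD(1)[OF F' ga(2)]] by simp
  qed
  moreover have "f (f' (h a)) = h (f (f' a))" if ha: "D_endo h" "a \<in> K" for h a
    using central_endoD(2)[OF assms(2) ha] central_endoD(2)[OF assms(1) ha(1) D_endoD(1)[OF F' ha(2)]] by simp
  ultimately show ?thesis unfolding central_endo_def by blast
qed

lemma central_mult:
  assumes f: "central_endo f" "central_endo f'" shows "central_endo (\<lambda>a. f a \<otimes> f' a)"
proof -
  note F = central_endoD(1)[OF f(1)] and F' = central_endoD(1)[OF f(2)]
  have "D_endo (\<lambda>a. f a \<otimes> f' a)"
    unfolding D_endo_def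
  proof (intro conjI ballI)
    fix a b assume ab: "a \<in> K" "b \<in> K"
    have m: "f a \<in> K" "f b \<in> K" "f' a \<in> K" "f' b \<in> K" using D_endoD(1)[OF F] D_endoD(1)[OF F'] ab by auto
    have "f b \<otimes> (f' a \<otimes> f' b) = f' a \<otimes> (f b \<otimes> f' b)"
      using K_comm[of "f b" "f' a"] m by (metis K_carrier m_assoc)
    thus "f (a \<otimes> b) \<otimes> f' (a \<otimes> b) = f a \<otimes> f' a \<otimes> (f b \<otimes> f' b)"
      using D_endoD(2)[OF F ab] D_endoD(2)[OF F' ab] m by (simp add: m_assoc)
  next
    fix g a assume g: "g \<in> D" and a: "a \<in> K"
    show "f (conj_by g a) \<otimes> f' (conj_by g a) = conj_by g (f a \<otimes> f' a)"
      using D_endoD(3)[OF F g a] D_endoD(3)[OF F' g a] D_endoD(1)[OF F a] D_endoD(1)[OF F' a] D_carrier[OF g]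
      by (simp add: conj_hom)
  qed (use D_endoD(1)[OF F] D_endoD(1)[OF F'] in auto)
  moreover have "f (h a) \<otimes> f' (h a) = h (f a \<otimes> f' a)" if "D_endo h" "a \<in> K" for h a
    using central_endoD(2)[OF f(1) that] central_endoD(2)[OF f(2) that] D_endoD(2)[OF that(1)]
       D_endoD(1)[OF F that(2)] D_endoD(1)[OF F' that(2)] by simp
  ultimately show ?thesis by (simp add: central_endo_def)
qed

lemma central_inv:
  assumes f: "central_endo f" shows "central_endo (\<lambda>a. inv (f a))"
proof -
  note F = central_endoD(1)[OF f]
  have "D_endo (\<lambda>a. inv (f a))"
    unfolding D_endo_def
  proof (intro conjI ballI)
    fix a b assume ab: "a \<in> K" "b \<in> K"
    have m: "f a \<in> K" "f b \<in> K" using D_endoD(1)[OF F] ab by auto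
    show "inv (f (a \<otimes> b)) = inv (f a) \<otimes> inv (f b)"
      using D_endoD(2)[OF F ab] m K_comm[of "f a" "f b"] by (simp add: inv_mult_group)
  next
    fix g a assume g: "g \<in> D" and a: "a \<in> K"
    have fa: "f a \<in> carrier G" using D_endoD(1)[OF F a] by simp
    have "conj_by g (inv (f a)) \<otimes> conj_by g (f a) = \<one>"
      using conj_hom[of g "inv (f a)" "f a"] fa D_carrier[OF g] by simp
    hence "inv (conj_by g (f a)) = conj_by g (inv (f a))"
      using inv_equality[of "conj_by g (inv (f a))" "conj_by g (f a)"] fa D_carrier[OF g] by simp
    thus "inv (f (conj_by g a)) = conj_by g (inv (f a))" using D_endoD(3)[OF F g a] by simp
  qed (use D_endoD(1)[OF F] in auto)
  moreover have "inv (f (h a)) = h (inv (f a))" if "D_endo h" "a \<in> K" for h a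
    using central_endoD(2)[OF f that] D_endo_inv[OF that(1)] D_endoD(1)[OF F that(2)] by simp
  ultimately show ?thesis by (simp add: central_endo_def)
qed

text \<open>Evaluation at \<open>e\<close> is surjective: the values form a subgroup, which is
  invariant under \<open>D\<close> because the conjugations by elements of \<open>D\<close> are
  themselves central endomorphisms.\<close>

lemma central_endo_exists:
  assumes e: "e \<in> K" "e \<noteq> \<one>" and a: "a \<in> K"
  shows "\<exists>f. central_endo f \<and> f e = a"
proof -
  let ?V = "{f e |f. central_endo f}"
  have id: "central_endo (\<lambda>a. a)" by (simp add: central_endo_def D_endo_def)
  have "?V = K"
  proof (rule D_irreducible)
    show sub: "?V \<subseteq> K" using D_endoD(1) central_endoD(1) e by blast
    show "?V \<noteq> {\<one>}" using id e by auto
    show "conj_by g u \<in> ?V" if g: "g \<in> D" and u: "u \<in> ?V" for g u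
    proof -
      obtain f where f: "central_endo f" "u = f e" using u by blast
      show ?thesis using central_comp[OF conj_central[OF g] f(1)] f(2) by auto
    qed
    show "subgroup ?V G"
    proof (rule subgroupI)
      show "?V \<subseteq> carrier G" using sub K_carrier by blast
      show "?V \<noteq> {}" using id by blast
      show "inv u \<in> ?V" if u: "u \<in> ?V" for u
      proof -
        obtain f where f: "central_endo f" "u = f e" using u by blast
        show ?thesis using central_inv[OF f(1)] f(2) by auto
      qed
      show "u \<otimes> v \<in> ?V" if u: "u \<in> ?V" and v: "v \<in> ?V" for u v
      proof -
        obtain f where f: "central_endo f" "u = f e" using u by blast
        obtain f' where f': "central_endo f'" "v = f' e" using v by blast
        show ?thesis using central_mult[OF f(1) f'(1)] f(2) f'(2) by auto
      qed
    qed
  qed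
  with a have "a \<in> ?V" by (simp only:)
  thus ?thesis by blast
qed

text \<open>The product \<open>F a b\<close> applies to \<open>b\<close> the central endomorphism
  that sends the chosen unit \<open>e\<close> to \<open>a\<close>. The kernel of \<open>F a\<close>
  for nonzero \<open>a\<close> is an invariant subgroup without \<open>e\<close>, hence trivial, and
  finiteness of \<open>K\<close> turns injectivity into an inverse. An element \<open>g\<close> of
  \<open>D\<close> multiplies by \<open>conj_by g e\<close>.\<close>

lemma field_on_kernel:
  "\<exists>R :: 'a ring. field R \<and> carrier R = K \<and> (\<forall>x\<in>K. \<forall>y\<in>K. x \<oplus>\<^bsub>R\<^esub> y = x \<otimes> y) \<and>
     (\<forall>g\<in>D. \<exists>s\<in>K. \<forall>x\<in>K. s \<otimes>\<^bsub>R\<^esub> x = conj_by g x)"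
proof -
  have "K \<noteq> {\<one>}" using card_K q3 by auto
  then obtain e where e: "e \<in> K" "e \<noteq> \<one>" using K_one by blast
  define F where "F a = (SOME f. central_endo f \<and> f e = a)" for a
  have F: "central_endo (F a)" "F a e = a" if "a \<in> K" for a
    using someI_ex[OF central_endo_exists[OF e that]] unfolding F_def by auto
  note FD = F(1)[THEN central_endoD(1)]
  have Fc: "F a b \<in> K" if "a \<in> K" "b \<in> K" for a b using D_endoD(1)[OF FD[OF that(1)] that(2)] .
  have com: "F a b = F b a" if "a \<in> K" "b \<in> K" for a b
    using central_endoD(2)[OF F(1)[OF that(1)] FD[OF that(2)] e(1)] F(2)[OF that(1)] F(2)[OF that(2)] by simp
  have dis: "F a (b \<otimes> b') = F a b \<otimes> F a b'" if "a \<in> K" "b \<in> K" "b' \<in> K" for a b b'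
    using D_endoD(2)[OF FD[OF that(1)] that(2,3)] .
  \<comment> \<open>Both sides are endomorphisms in \<open>x\<close>, and both take the value
    \<open>F a b\<close> at \<open>e\<close>.\<close>
  have ass: "F (F a b) x = F a (F b x)" if "a \<in> K" "b \<in> K" "x \<in> K" for a b x
    by (rule D_endo_unique[OF FD[OF Fc[OF that(1,2)]] central_endoD(1)[OF central_comp[OF F(1)[OF that(1)] F(1)[OF that(2)]]] e _ that(3)])
       (simp only: F(2)[OF Fc[OF that(1,2)]] F(2)[OF that(2)])
  have unit: "F e a = a" if "a \<in> K" for a using com[OF e(1) that] F(2)[OF that] by simp
  define R where "R = \<lparr>carrier = K, monoid.mult = F, one = e, zero = \<one>, add = monoid.mult G\<rparr>"
  have "abelian_group R"
  proof (rule abelian_groupI)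
    show "\<exists>y\<in>carrier R. y \<oplus>\<^bsub>R\<^esub> x = \<zero>\<^bsub>R\<^esub>" if "x \<in> carrier R" for x
      using that by (intro bexI[of _ "inv x"]) (auto simp: R_def)
    show "x \<oplus>\<^bsub>R\<^esub> y = y \<oplus>\<^bsub>R\<^esub> x" if "x \<in> carrier R" "y \<in> carrier R" for x y
      using K_comm that by (simp add: R_def)
  qed (auto simp: R_def m_assoc)
  moreover have "comm_monoid R"
    by (rule comm_monoidI) (use e Fc ass unit com in \<open>auto simp: R_def\<close>)
  moreover have "(x \<oplus>\<^bsub>R\<^esub> y) \<otimes>\<^bsub>R\<^esub> z = x \<otimes>\<^bsub>R\<^esub> z \<oplus>\<^bsub>R\<^esub> y \<otimes>\<^bsub>R\<^esub> z"
    if "x \<in> carrier R" "y \<in> carrier R" "z \<in> carrier R" for x y z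
  proof -
    have K: "x \<in> K" "y \<in> K" "z \<in> K" using that by (auto simp: R_def)
    show ?thesis
      using dis[OF K(3,1,2)] com[OF K(3,1)] com[OF K(3,2)] com[OF K_closed[OF K(1,2)] K(3)] by (simp add: R_def)
  qed
  ultimately have "cring R" by (intro cringI)
  moreover have "\<exists>b\<in>carrier R. a \<otimes>\<^bsub>R\<^esub> b = \<one>\<^bsub>R\<^esub>" if a: "a \<in> carrier R" "a \<noteq> \<zero>\<^bsub>R\<^esub>" for a
  proof -
    have a': "a \<in> K" "a \<noteq> \<one>" using a by (auto simp: R_def)
    let ?V = "{b \<in> K. F a b = \<one>}"
    have V: "?V = {\<one>}"
    proof (rule ccontr)
      assume n: "?V \<noteq> {\<one>}"
      have "?V = K"
      proof (rule D_irreducible[OF _ _ n])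
        show "subgroup ?V G"
        proof (rule subgroupI)
          show "?V \<subseteq> carrier G" using K_carrier by blast
          show "?V \<noteq> {}" using D_endo_one[OF FD[OF a'(1)]] K_one by blast
          show "inv u \<in> ?V" if "u \<in> ?V" for u
            using that D_endo_inv[OF FD[OF a'(1)], of u] K_inv[of u] by auto
          show "u \<otimes> v \<in> ?V" if "u \<in> ?V" "v \<in> ?V" for u v
            using that dis[OF a'(1), of u v] K_closed[of u v] by auto
        qed
        show "conj_by g u \<in> ?V" if "g \<in> D" "u \<in> ?V" for g u
          using that D_endoD(3)[OF FD[OF a'(1)], of g u] conj_K[of g u] D_carrier[OF that(1)] by simp
      qed blast
      hence "F a e = \<one>" using e by blast
      thus False using F(2) a' by simp
    qed
    have "inj_on (F a) K"
    proof (rule inj_onI)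
      fix x y assume xy: "x \<in> K" "y \<in> K" "F a x = F a y"
      hence "F a (inv y \<otimes> x) = \<one>"
        using dis[OF a'(1), of "inv y" x] D_endo_inv[OF FD[OF a'(1)], of y] Fc[OF a'(1)] by simp
      hence "inv y \<otimes> x \<in> ?V" using xy by simp
      hence "inv y \<otimes> x = \<one>" using V by blast
      hence "y \<otimes> (inv y \<otimes> x) = y" using xy by simp
      thus "x = y" using xy by (simp add: m_assoc[symmetric])
    qed
    hence "F a ` K = K" using Fc[OF a'(1)] by (intro endo_inj_surj) auto
    then obtain b where "b \<in> K" "F a b = e" using e by (metis imageE)
    thus ?thesis by (auto simp: R_def)
  qed
  ultimately have "field R" using e by (intro cring.cring_fieldI2) (auto simp: R_def)
  moreover have "\<exists>s\<in>K. \<forall>x\<in>K. F s x = conj_by g x" if g: "g \<in> D" for g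
  proof -
    have ge: "conj_by g e \<in> K" using g e by simp
    have "F (conj_by g e) x = conj_by g x" if "x \<in> K" for x
      using D_endo_unique[OF FD[OF ge] central_endoD(1)[OF conj_central[OF g]] e _ that] F(2)[OF ge] by simp
    thus ?thesis using ge by blast
  qed
  ultimately show ?thesis by (intro exI[of _ R]) (auto simp: R_def)
qed

text \<open>The field is moved along an injection of the finite set \<open>K\<close> into the
  natural numbers, because the final statement asks for a \<open>nat ring\<close>.\<close>

lemma coordinate_field:
  "\<exists>(R :: nat ring) \<psi>. field R \<and> bij_betw \<psi> (carrier R) K \<and>
     (\<forall>x\<in>carrier R. \<forall>y\<in>carrier R. \<psi> (x \<oplus>\<^bsub>R\<^esub> y) = \<psi> x \<otimes> \<psi> y) \<and>
     (\<forall>g\<in>D. \<exists>s\<in>carrier R. \<forall>x\<in>carrier R. \<psi> (s \<otimes>\<^bsub>R\<^esub> x) = conj_by g (\<psi> x))"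
proof -
  obtain R0 :: "'a ring" where R0: "field R0" "carrier R0 = K"
    and add: "\<And>x y. x \<in> K \<Longrightarrow> y \<in> K \<Longrightarrow> x \<oplus>\<^bsub>R0\<^esub> y = x \<otimes> y"
    and mul: "\<And>g. g \<in> D \<Longrightarrow> \<exists>s\<in>K. \<forall>x\<in>K. s \<otimes>\<^bsub>R0\<^esub> x = conj_by g x"
    using field_on_kernel by blast
  interpret R0: field R0 by fact
  obtain \<iota> :: "'a \<Rightarrow> nat" where i: "inj_on \<iota> K" using finite_imp_inj_to_nat_seg[OF K_finite] by blast
  let ?R = "image_ring \<iota> R0" and ?\<psi> = "inv_into K \<iota>"
  have i': "inj_on \<iota> (carrier R0)" using i R0 by simp
  have iso: "\<iota> \<in> ring_iso R0 ?R" by (rule inj_imp_image_ring_iso[OF i'])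
  have car: "carrier ?R = \<iota> ` K" by (simp add: image_ring_carrier R0)
  have "field ?R" by (rule R0.inj_imp_image_ring_is_field[OF i'])
  moreover have "bij_betw ?\<psi> (carrier ?R) K" unfolding car by (rule bij_betw_inv_into) (simp add: bij_betw_def i)
  moreover have psi: "?\<psi> (\<iota> x) = x" if "x \<in> K" for x using i that by simp
  moreover have "?\<psi> (x \<oplus>\<^bsub>?R\<^esub> y) = ?\<psi> x \<otimes> ?\<psi> y" if xy: "x \<in> carrier ?R" "y \<in> carrier ?R" for x y
  proof -
    obtain a b where ab: "a \<in> K" "x = \<iota> a" "b \<in> K" "y = \<iota> b" using xy car by auto
    have "x \<oplus>\<^bsub>?R\<^esub> y = \<iota> (a \<otimes> b)" using ring_iso_memE(3)[OF iso, of a b] ab R0 add by simp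
    thus ?thesis using ab psi by simp
  qed
  moreover have "\<exists>s\<in>carrier ?R. \<forall>x\<in>carrier ?R. ?\<psi> (s \<otimes>\<^bsub>?R\<^esub> x) = conj_by g (?\<psi> x)" if g: "g \<in> D" for g
  proof -
    obtain s where s: "s \<in> K" "\<forall>x\<in>K. s \<otimes>\<^bsub>R0\<^esub> x = conj_by g x" using mul[OF g] by blast
    have "?\<psi> (\<iota> s \<otimes>\<^bsub>?R\<^esub> x) = conj_by g (?\<psi> x)" if x: "x \<in> carrier ?R" for x
    proof -
      obtain a where a: "a \<in> K" "x = \<iota> a" using x car by auto
      have "\<iota> s \<otimes>\<^bsub>?R\<^esub> x = \<iota> (conj_by g a)" using ring_iso_memE(2)[OF iso, of s a] a s R0 by simp
      thus ?thesis using a psi conj_K[of g a] g by simp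
    qed
    thus ?thesis using s car by blast
  qed
  ultimately show ?thesis by blast
qed

end

section \<open>Linear fractional transformations with determinant in a subgroup\<close>

text \<open>\<open>S\<close> stands for the multipliers by which a two-point stabilizer acts; the
  cardinalities say that it has index \<open>c\<close> in the multiplicative group.\<close>

locale field_index_subgroup = field R for R (structure) +
  fixes S :: "'a set" and c d :: nat
  assumes finite_field: "finite (carrier R)"
    and S_sub: "S \<subseteq> carrier R - {\<zero>}" and S_one: "\<one> \<in> S"
    and S_mult: "x \<in> S \<Longrightarrow> y \<in> S \<Longrightarrow> x \<otimes> y \<in> S" and S_inv: "x \<in> S \<Longrightarrow> inv x \<in> S"
    and card_S: "card S = d" and card_R: "card (carrier R) = c * d + 1" and c12: "c = 1 \<or> c = 2"
begin

abbreviation nonzero where "nonzero \<equiv> carrier R - {\<zero>}"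

lemma inv_nonzero: "x \<in> nonzero \<Longrightarrow> inv x \<in> nonzero"
  using field_Units by (metis Units_inv_Units)

lemma inv_carrier [simp]: "x \<in> carrier R \<Longrightarrow> x \<noteq> \<zero> \<Longrightarrow> inv x \<in> carrier R"
  using inv_nonzero by blast

lemma inv_neq_zero [simp]: "x \<in> carrier R \<Longrightarrow> x \<noteq> \<zero> \<Longrightarrow> inv x \<noteq> \<zero>"
  using inv_nonzero by blast

lemma nonzero_inv [simp]: "x \<in> carrier R \<Longrightarrow> x \<noteq> \<zero> \<Longrightarrow> x \<otimes> inv x = \<one>"
    "x \<in> carrier R \<Longrightarrow> x \<noteq> \<zero> \<Longrightarrow> inv x \<otimes> x = \<one>"
  using field_Units by (auto intro!: Units_r_inv Units_l_inv)

lemma nonzero_mult_neq_zero [simp]: "\<lbrakk>x \<in> carrier R; x \<noteq> \<zero>; y \<in> carrier R; y \<noteq> \<zero>\<rbrakk> \<Longrightarrow> x \<otimes> y \<noteq> \<zero>"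
  using integral by auto

lemma nonzero_mult: "x \<in> nonzero \<Longrightarrow> y \<in> nonzero \<Longrightarrow> x \<otimes> y \<in> nonzero"
  by auto

lemma nonzero_cancel: "x \<in> nonzero \<Longrightarrow> y \<in> carrier R \<Longrightarrow> z \<in> carrier R \<Longrightarrow> x \<otimes> y = x \<otimes> z \<longleftrightarrow> y = z"
  using m_lcancel by auto

lemma S_nonzero: "x \<in> S \<Longrightarrow> x \<in> nonzero"
  using S_sub by blast

lemma S_carrier: "x \<in> S \<Longrightarrow> x \<in> carrier R"
  using S_sub by blast

lemma card_nonzero: "card nonzero = c * d"
  using card_R finite_field by simp

lemma finite_S: "finite S"
  using S_sub finite_field finite_subset by blast

lemma S_all: "c = 1 \<Longrightarrow> S = nonzero"
  using card_subset_eq[OF _ S_sub] card_nonzero card_S finite_field by simp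

lemma S_not_S:
  assumes "s \<in> S" "y \<in> nonzero" "y \<notin> S" shows "s \<otimes> y \<notin> S"
proof
  assume "s \<otimes> y \<in> S"
  hence "inv s \<otimes> (s \<otimes> y) \<in> S" using S_mult S_inv assms by blast
  moreover have "inv s \<otimes> (s \<otimes> y) = y"
    using assms S_nonzero[OF assms(1)] by (simp add: m_assoc[symmetric])
  ultimately show False using assms by simp
qed

text \<open>The index must be two, so the nonzero elements fall into \<open>S\<close> and the coset
  of \<open>inv x\<close>. Since \<open>y\<close> is outside \<open>S\<close> it lies in that
  coset.\<close>

lemma not_S_mult:
  assumes "x \<in> nonzero" "x \<notin> S" "y \<in> nonzero" "y \<notin> S" shows "x \<otimes> y \<in> S"
proof -
  have c2: "c = 2" using S_all assms c12 by blast
  have ix: "inv x \<in> nonzero" using inv_nonzero assms(1) .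
  have ixS: "inv x \<notin> S"
  proof
    assume "inv x \<in> S"
    hence "inv x \<otimes> x \<notin> S" using S_not_S assms by blast
    thus False using S_one assms by simp
  qed
  let ?C = "(\<lambda>s. inv x \<otimes> s) ` S"
  have "inj_on (\<lambda>s. inv x \<otimes> s) S"
    using nonzero_cancel[OF ix] S_carrier by (intro inj_onI) blast
  hence cC: "card ?C = d" using card_image card_S by metis
  have dis: "S \<inter> ?C = {}"
  proof (rule ccontr)
    assume "S \<inter> ?C \<noteq> {}"
    then obtain s where s: "s \<in> S" "inv x \<otimes> s \<in> S" by blast
    have "s \<otimes> inv x \<notin> S" using S_not_S[OF s(1) ix ixS] .
    thus False using s m_comm[of s "inv x"] S_carrier ix by auto
  qed
  have "card (S \<union> ?C) = card nonzero"
    using card_Un_disjoint[OF finite_S _ dis] finite_S cC card_S card_nonzero c2 by simp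
  moreover have "S \<union> ?C \<subseteq> nonzero" by (intro Un_least S_sub image_subsetI nonzero_mult ix S_nonzero)
  ultimately have "S \<union> ?C = nonzero" using finite_field card_subset_eq[of nonzero] by simp
  then obtain s where s: "s \<in> S" "y = inv x \<otimes> s" using assms by blast
  have "x \<otimes> y = s" using s assms ix S_carrier[of s] by (simp add: m_assoc[symmetric])
  thus ?thesis using s by simp
qed

lemma S_square: "x \<in> nonzero \<Longrightarrow> x \<otimes> x \<in> S"
  using S_mult not_S_mult by blast

lemma square_eq:
  assumes "e \<in> carrier R" "f \<in> carrier R" "e \<otimes> e = f \<otimes> f" shows "e = f \<or> e = \<ominus> f"
proof -
  have "(e \<ominus> f) \<otimes> (e \<oplus> f) = e \<otimes> e \<ominus> f \<otimes> f" using assms(1,2) by algebra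
  also have "\<dots> = \<zero>" using assms by (simp add: r_right_minus_eq)
  finally have "e \<ominus> f = \<zero> \<or> e \<oplus> f = \<zero>" by (rule integral) (use assms in auto)
  thus ?thesis using assms by (metis r_right_minus_eq minus_equality)
qed

text \<open>All squares lie in \<open>S\<close>, and as squaring is at most two-to-one on
  \<open>2 d\<close> elements, there are at least \<open>d\<close> of them.\<close>

lemma S_squares:
  assumes "c = 2" shows "S = {x \<in> nonzero. \<exists>e\<in>carrier R. x = e \<otimes> e}"
proof -
  let ?Q = "(\<lambda>e. e \<otimes> e) ` nonzero"
  have QS: "?Q \<subseteq> S" using S_square by blast
  have fQ: "finite ?Q" using finite_field by simp
  have "card nonzero = (\<Sum>y\<in>?Q. card {e \<in> nonzero. e \<otimes> e = y})"
    using sum.image_gen[of nonzero "\<lambda>_. 1::nat" "\<lambda>e. e \<otimes> e"] finite_field by simp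
  also have "\<dots> \<le> (\<Sum>y\<in>?Q. 2)"
  proof (rule sum_mono)
    fix y assume "y \<in> ?Q"
    then obtain f where f: "f \<in> nonzero" "y = f \<otimes> f" by blast
    have "{e \<in> nonzero. e \<otimes> e = y} \<subseteq> {f, \<ominus> f}" using f square_eq[of _ f] by blast
    hence "card {e \<in> nonzero. e \<otimes> e = y} \<le> card {f, \<ominus> f}" by (rule card_mono[rotated]) simp
    also have "\<dots> \<le> 2" by (simp add: card_insert_if)
    finally show "card {e \<in> nonzero. e \<otimes> e = y} \<le> 2" .
  qed
  finally have "d \<le> card ?Q" using card_nonzero assms by simp
  hence "card S \<le> card ?Q" using card_S by simp
  hence "?Q = S" using card_seteq[OF finite_S QS] by simp
  moreover have "?Q = {x \<in> nonzero. \<exists>e\<in>carrier R. x = e \<otimes> e}"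
  proof
    show "?Q \<subseteq> {x \<in> nonzero. \<exists>e\<in>carrier R. x = e \<otimes> e}" by auto
    show "{x \<in> nonzero. \<exists>e\<in>carrier R. x = e \<otimes> e} \<subseteq> ?Q"
    proof
      fix x assume x: "x \<in> {x \<in> nonzero. \<exists>e\<in>carrier R. x = e \<otimes> e}"
      then obtain e where e: "e \<in> carrier R" "x = e \<otimes> e" by blast
      hence "e \<noteq> \<zero>" using x by auto
      thus "x \<in> ?Q" using e by blast
    qed
  qed
  ultimately show ?thesis by simp
qed

text \<open>\<open>\<tau>\<close> is the interchanging element in coordinates. By \<open>T3\<close>
  the product \<open>x \<otimes> \<tau> x\<close> is constant on the cosets of \<open>S\<close>,
  with value \<open>m = \<tau> \<one>\<close> on \<open>S\<close>. Only the constant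
  \<open>e\<close> on the complement of \<open>S\<close> has to be identified with \<open>m\<close>;
  there \<open>T2\<close> settles the case of \<open>m\<close> outside \<open>S\<close>, and
  \<open>C\<close> together with a pigeonhole count settles the case of \<open>m\<close> in
  \<open>S\<close>.\<close>

lemma inversion_formula:
  assumes T1: "\<And>x. x \<in> nonzero \<Longrightarrow> \<tau> x \<in> nonzero" and T2: "\<And>x. x \<in> nonzero \<Longrightarrow> \<tau> (\<tau> x) = x"
    and T3: "\<And>s x. s \<in> S \<Longrightarrow> x \<in> nonzero \<Longrightarrow> s \<otimes> \<tau> (s \<otimes> x) = \<tau> x"
    and C: "\<And>s w. s \<in> S \<Longrightarrow> w \<in> nonzero \<Longrightarrow> w \<noteq> \<one> \<Longrightarrow> s \<otimes> (\<one> \<ominus> w) = \<tau> w \<ominus> \<tau> \<one> \<Longrightarrow> s \<otimes> w = \<tau> \<one>"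
    and x: "x \<in> nonzero"
  shows "x \<otimes> \<tau> x = \<tau> \<one>"
proof -
  let ?m = "\<tau> \<one>"
  have one: "\<one> \<in> nonzero" using S_one S_nonzero by blast
  have m: "?m \<in> nonzero" using T1[OF one] .
  have A: "s \<otimes> \<tau> s = ?m" if "s \<in> S" for s using T3[OF that one] S_carrier[OF that] by simp
  show ?thesis
  proof (cases "x \<in> S")
    case True thus ?thesis by (rule A)
  next
    case xS: False
    show ?thesis
    proof (cases "?m \<in> S")
      \<comment> \<open>The element \<open>y\<close> with \<open>y \<otimes> x = m\<close> is now in
        \<open>S\<close>, so the formula is known for it and says \<open>\<tau> y = x\<close>. As
        \<open>\<tau>\<close> is an involution, \<open>\<tau> x = y\<close>.\<close>
      case mS: False
      have ixS: "inv x \<notin> S"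
      proof
        assume "inv x \<in> S"
        hence "inv x \<otimes> x \<notin> S" using S_not_S x xS by blast
        thus False using S_one x by simp
      qed
      let ?y = "?m \<otimes> inv x"
      have y: "?y \<in> S" by (rule not_S_mult) (use m mS x ixS in auto)
      have yx: "?y \<otimes> x = ?m" using m x inv_nonzero[OF x] by (simp add: m_assoc)
      have "?y \<otimes> \<tau> ?y = ?y \<otimes> x" using A[OF y] yx by simp
      hence "\<tau> ?y = x" using nonzero_cancel[OF S_nonzero[OF y]] T1[OF S_nonzero[OF y]] x by blast
      hence "\<tau> x = ?y" using T2[OF S_nonzero[OF y]] by simp
      thus ?thesis using yx x S_carrier[OF y] by (simp add: m_comm)
    next
      case mS: True
      let ?e = "x \<otimes> \<tau> x"
      have tx: "\<tau> x \<in> nonzero" using T1[OF x] .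
      have e: "?e \<in> nonzero" using x tx by simp
      have ew: "w \<otimes> \<tau> w = ?e" if w: "w \<in> nonzero" "w \<notin> S" for w
      proof -
        have ixS: "inv x \<notin> S"
        proof
          assume "inv x \<in> S"
          hence "inv x \<otimes> x \<notin> S" using S_not_S x xS by blast
          thus False using S_one x by simp
        qed
        let ?s = "w \<otimes> inv x"
        have s: "?s \<in> S" by (rule not_S_mult) (use w x ixS in auto)
        have sx: "?s \<otimes> x = w" using w x inv_nonzero[OF x] by (simp add: m_assoc)
        have "?s \<otimes> \<tau> w = \<tau> x" using T3[OF s x] sx by simp
        hence "x \<otimes> (?s \<otimes> \<tau> w) = ?e" by simp
        moreover have "x \<otimes> (?s \<otimes> \<tau> w) = (?s \<otimes> x) \<otimes> \<tau> w"
          using x S_carrier[OF s] T1[OF w(1)] by (simp add: m_ac)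
        ultimately show ?thesis using sx by simp
      qed
      have eS: "?e \<in> S"
      proof -
        have "\<tau> x \<notin> S"
        proof
          assume t: "\<tau> x \<in> S"
          have "\<tau> x \<otimes> x = ?m" using A[OF t] T2[OF x] by simp
          thus False using S_not_S[OF t x xS] mS by simp
        qed
        thus ?thesis using not_S_mult x xS tx by blast
      qed
      show ?thesis
      proof (rule ccontr)
        assume ne: "?e \<noteq> ?m"
        \<comment> \<open>For \<open>w\<close> outside \<open>S\<close> let \<open>s\<close> be the
          solution of the equation in \<open>C\<close>; then \<open>v w = s \<otimes> w\<close>. It
          cannot be that \<open>s\<close> is in \<open>S\<close>, for then \<open>C\<close> would
          give \<open>s \<otimes> w = m\<close>, and hence \<open>v w\<close>, a product of two
          elements outside \<open>S\<close>, is in \<open>S\<close>. If \<open>e\<close> and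
          \<open>m\<close> differ, \<open>v\<close> is injective and avoids \<open>m\<close>, so it
          would embed \<open>d\<close> elements into \<open>d - 1\<close>.\<close>
        define v where "v w = (?e \<ominus> ?m \<otimes> w) \<otimes> inv (\<one> \<ominus> w)" for w
        have w1: "\<one> \<ominus> w \<in> nonzero" if "w \<in> nonzero" "w \<notin> S" for w
          using that S_one r_right_minus_eq[of \<one> w] by auto
        have vw: "v w \<otimes> (\<one> \<ominus> w) = ?e \<ominus> ?m \<otimes> w" if w: "w \<in> nonzero" "w \<notin> S" for w
          using w1[OF w] inv_nonzero[OF w1[OF w]] w m x tx by (simp add: v_def m_assoc)
        have vc: "v w \<in> carrier R" if w: "w \<in> nonzero" "w \<notin> S" for w
          using inv_nonzero[OF w1[OF w]] w m x tx by (simp add: v_def)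
        have vS: "v w \<in> S - {?m}" if w: "w \<in> nonzero" "w \<notin> S" for w
        proof -
          let ?s = "v w \<otimes> inv w"
          have iw: "inv w \<in> nonzero" using w by simp
          have sc: "?s \<in> carrier R" using vc[OF w] iw by simp
          have sw: "?s \<otimes> w = v w" using vc[OF w] iw w by (simp add: m_assoc)
          have tw: "\<tau> w \<in> nonzero" using T1 w by blast
          have "w \<otimes> (?s \<otimes> (\<one> \<ominus> w)) = v w \<otimes> (\<one> \<ominus> w)"
            using sw sc w w1[OF w] by (metis DiffD1 m_assoc m_comm)
          also have "\<dots> = w \<otimes> \<tau> w \<ominus> ?m \<otimes> w" using vw[OF w] ew[OF w] by simp
          also have "\<dots> = w \<otimes> (\<tau> w \<ominus> ?m)" using w tw m by (simp add: r_minus r_distr minus_eq m_comm)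
          finally have eq: "?s \<otimes> (\<one> \<ominus> w) = \<tau> w \<ominus> ?m"
            using nonzero_cancel[OF w(1)] sc w1[OF w] tw m by simp
          have sS: "?s \<notin> S"
          proof
            assume s: "?s \<in> S"
            have "?s \<otimes> w = ?m" using C[OF s w(1) _ eq] S_one w by blast
            thus False using S_not_S[OF s w] mS by simp
          qed
          have s0: "?s \<noteq> \<zero>"
          proof
            assume "?s = \<zero>"
            hence "v w = \<zero>" using sw w by simp
            hence "?e \<ominus> ?m \<otimes> w = \<zero>" using vw[OF w] w1[OF w] by simp
            hence "?e = ?m \<otimes> w" using w m e by (simp add: r_right_minus_eq)
            thus False using S_not_S[OF mS w] eS by simp
          qed
          have "v w \<in> S" using not_S_mult[of ?s w] s0 sc sS w sw by simp
          moreover have "v w \<noteq> ?m"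
          proof
            assume "v w = ?m"
            hence "?m \<otimes> (\<one> \<ominus> w) = ?e \<ominus> ?m \<otimes> w" using vw[OF w] by simp
            hence "?m \<ominus> ?m \<otimes> w = ?e \<ominus> ?m \<otimes> w" using w m by (simp add: r_minus r_distr minus_eq)
            thus False using ne w m e by (simp add: minus_eq)
          qed
          ultimately show ?thesis by blast
        qed
        have "inj_on v (nonzero - S)"
        proof (rule inj_onI)
          fix w u assume "w \<in> nonzero - S" "u \<in> nonzero - S" and eq: "v w = v u"
          hence w: "w \<in> nonzero" "w \<notin> S" and u: "u \<in> nonzero" "u \<notin> S" by auto
          have cc: "w \<in> carrier R" "u \<in> carrier R" "?m \<in> carrier R" "?e \<in> carrier R" using w u m e by auto
          have "(?e \<ominus> ?m \<otimes> w) \<otimes> (\<one> \<ominus> u) = v w \<otimes> (\<one> \<ominus> w) \<otimes> (\<one> \<ominus> u)" using vw[OF w] by simp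
          also have "\<dots> = v u \<otimes> (\<one> \<ominus> u) \<otimes> (\<one> \<ominus> w)" using eq vc[OF u] w1[OF w] w1[OF u] by (simp add: m_ac)
          also have "\<dots> = (?e \<ominus> ?m \<otimes> u) \<otimes> (\<one> \<ominus> w)" using vw[OF u] by simp
          finally have "(?e \<ominus> ?m \<otimes> w) \<otimes> (\<one> \<ominus> u) \<ominus> (?e \<ominus> ?m \<otimes> u) \<otimes> (\<one> \<ominus> w) = \<zero>"
            using cc by (simp add: r_right_minus_eq)
          moreover have "(e' \<ominus> m' \<otimes> w) \<otimes> (\<one> \<ominus> u) \<ominus> (e' \<ominus> m' \<otimes> u) \<otimes> (\<one> \<ominus> w) = (e' \<ominus> m') \<otimes> (w \<ominus> u)"
            if "e' \<in> carrier R" "m' \<in> carrier R" for e' m' using that cc(1,2) by algebra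
          ultimately have "(?e \<ominus> ?m) \<otimes> (w \<ominus> u) = \<zero>" using cc by simp
          hence "?e \<ominus> ?m = \<zero> \<or> w \<ominus> u = \<zero>" by (rule integral) (use cc in auto)
          thus "w = u" using ne cc by (simp add: r_right_minus_eq)
        qed
        moreover have "v ` (nonzero - S) \<subseteq> S - {?m}" using vS by (intro image_subsetI) (elim DiffE, blast)
        ultimately have "card (nonzero - S) \<le> card (S - {?m})"
          by (rule card_inj_on_le) (simp add: finite_S)
        moreover have "card (nonzero - S) = c * d - d"
          using card_Diff_subset[OF finite_S S_sub] card_nonzero card_S by simp
        moreover have "c = 2" using S_all x xS c12 by blast
        moreover have "card (S - {?m}) < d" using card_Diff1_less[OF finite_S mS] card_S by simp
        ultimately show False by simp
      qed
    qed
  qed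
qed

text \<open>A common form of \<open>PGL2\<close> and \<open>PSL2\<close>, so that both values of
  \<open>c\<close> can be treated together.\<close>

definition S_transformations where
  "S_transformations = {lin_frac R a b c d |a b c d. a \<in> carrier R \<and> b \<in> carrier R \<and> c \<in> carrier R \<and> d \<in> carrier R \<and>
     a \<otimes> d \<ominus> b \<otimes> c \<in> S}"

lemma S_transformations_PGL2: "S_transformations \<subseteq> carrier (PGL2 R)"
proof
  fix f assume "f \<in> S_transformations"
  hence "f \<in> {lin_frac R a b c d | a b c d. a \<in> carrier R \<and> b \<in> carrier R \<and> c \<in> carrier R \<and> d \<in> carrier R \<and>
      a \<otimes> d \<ominus> b \<otimes> c \<noteq> \<zero>}" using S_nonzero unfolding S_transformations_def by blast
  thus "f \<in> carrier (PGL2 R)" by (simp add: PGL2_def)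
qed

lemma S_transformations_eq:
  "c = 1 \<Longrightarrow> S_transformations = carrier (PGL2 R)" "c = 2 \<Longrightarrow> S_transformations = carrier (PSL2 R)"
proof -
  assume c: "c = 1"
  have "a \<otimes> d \<ominus> b \<otimes> e \<in> S \<longleftrightarrow> a \<otimes> d \<ominus> b \<otimes> e \<noteq> \<zero>"
    if "a \<in> carrier R" "b \<in> carrier R" "e \<in> carrier R" "d \<in> carrier R" for a b e d
    using S_all[OF c] that by blast
  thus "S_transformations = carrier (PGL2 R)" unfolding PGL2_def S_transformations_def
    by (simp, intro Collect_cong ex_cong1 conj_cong refl)
next
  assume c: "c = 2"
  have "a \<otimes> d \<ominus> b \<otimes> e \<in> S \<longleftrightarrow>
      a \<otimes> d \<ominus> b \<otimes> e \<noteq> \<zero> \<and> (\<exists>f\<in>carrier R. a \<otimes> d \<ominus> b \<otimes> e = f \<otimes> f)"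
    if "a \<in> carrier R" "b \<in> carrier R" "e \<in> carrier R" "d \<in> carrier R" for a b e d
  proof -
    have "a \<otimes> d \<ominus> b \<otimes> e \<in> carrier R" using that by simp
    thus ?thesis using S_squares[OF c] by blast
  qed
  thus "S_transformations = carrier (PSL2 R)" unfolding PSL2_def S_transformations_def
    by (simp, intro Collect_cong ex_cong1 conj_cong refl)
qed

lemma lin_frac_scale:
  assumes l: "l \<in> nonzero" and abcd: "a \<in> carrier R" "b \<in> carrier R" "e \<in> carrier R" "f \<in> carrier R"
  shows "lin_frac R (l \<otimes> a) (l \<otimes> b) (l \<otimes> e) (l \<otimes> f) = lin_frac R a b e f"
proof -
  have lc: "l \<in> carrier R" "l \<noteq> \<zero>" using l by auto
  have frac: "(l \<otimes> u) \<otimes> inv (l \<otimes> v) = u \<otimes> inv v" if u: "u \<in> carrier R" and v: "v \<in> carrier R" "v \<noteq> \<zero>" for u v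
  proof -
    have lv: "l \<otimes> v \<in> carrier R" "l \<otimes> v \<noteq> \<zero>" using lc v by auto
    have "(l \<otimes> v) \<otimes> (u \<otimes> inv v) = (l \<otimes> u) \<otimes> (v \<otimes> inv v)" using lc u v inv_carrier[OF v] by (simp only: m_ac m_closed)
    also have "\<dots> = l \<otimes> u" using lc u v by simp
    also have "\<dots> = (l \<otimes> u) \<otimes> ((l \<otimes> v) \<otimes> inv (l \<otimes> v))" using nonzero_inv(1)[OF lv] lc u by simp
    also have "\<dots> = (l \<otimes> v) \<otimes> ((l \<otimes> u) \<otimes> inv (l \<otimes> v))"
      using lc u v inv_carrier[OF lv] by (simp only: m_ac m_closed)
    finally have "(l \<otimes> v) \<otimes> (u \<otimes> inv v) = (l \<otimes> v) \<otimes> ((l \<otimes> u) \<otimes> inv (l \<otimes> v))" .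
    thus ?thesis using nonzero_cancel[of "l \<otimes> v" "u \<otimes> inv v" "(l \<otimes> u) \<otimes> inv (l \<otimes> v)"] lv lc u v inv_carrier[OF lv] by simp
  qed
  have lz: "l \<otimes> v = \<zero> \<longleftrightarrow> v = \<zero>" if "v \<in> carrier R" for v using lc that integral[of l v] by auto
  show ?thesis
    unfolding lin_frac_def
  proof (rule restrict_ext)
    fix z assume z: "z \<in> proj_line R"
    show "(case z of None \<Rightarrow> if l \<otimes> b = \<zero> then None else Some (l \<otimes> a \<otimes> inv (l \<otimes> b))
         | Some x \<Rightarrow> if l \<otimes> b \<otimes> x \<oplus> l \<otimes> f = \<zero> then None
             else Some ((l \<otimes> a \<otimes> x \<oplus> l \<otimes> e) \<otimes> inv (l \<otimes> b \<otimes> x \<oplus> l \<otimes> f))) =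
      (case z of None \<Rightarrow> if b = \<zero> then None else Some (a \<otimes> inv b)
         | Some x \<Rightarrow> if b \<otimes> x \<oplus> f = \<zero> then None else Some ((a \<otimes> x \<oplus> e) \<otimes> inv (b \<otimes> x \<oplus> f)))"
    proof (cases z)
      case None
      thus ?thesis using lz[of b] frac[of a b] abcd by simp
    next
      case (Some x)
      hence x: "x \<in> carrier R" using z by (auto simp: proj_line_def)
      have 1: "l \<otimes> b \<otimes> x \<oplus> l \<otimes> f = l \<otimes> (b \<otimes> x \<oplus> f)" "l \<otimes> a \<otimes> x \<oplus> l \<otimes> e = l \<otimes> (a \<otimes> x \<oplus> e)"
        using lc abcd x by (simp_all add: r_distr m_assoc)
      show ?thesis using Some lz[of "b \<otimes> x \<oplus> f"] frac[of "a \<otimes> x \<oplus> e" "b \<otimes> x \<oplus> f"] abcd x by (simp add: 1)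
    qed
  qed
qed

definition affine_map where "affine_map s e = lin_frac R s \<zero> e \<one>"

text \<open>\<open>mobius_map m b s a\<close> is the map \<open>x \<mapsto> b + m / (s x + a)\<close>.\<close>

definition mobius_map where "mobius_map m b s a = lin_frac R (b \<otimes> s) s (m \<oplus> b \<otimes> a) a"

lemma affine_map_apply:
  assumes "s \<in> carrier R" "e \<in> carrier R"
  shows "affine_map s e None = None" "x \<in> carrier R \<Longrightarrow> affine_map s e (Some x) = Some (s \<otimes> x \<oplus> e)"
  using assms by (auto simp: affine_map_def lin_frac_def proj_line_def)

lemma mobius_map_apply:
  assumes "m \<in> carrier R" "b \<in> carrier R" "s \<in> nonzero" "a \<in> carrier R"
  shows "mobius_map m b s a None = Some b"
    "x \<in> carrier R \<Longrightarrow> s \<otimes> x \<oplus> a = \<zero> \<Longrightarrow> mobius_map m b s a (Some x) = None"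
    "x \<in> carrier R \<Longrightarrow> s \<otimes> x \<oplus> a \<noteq> \<zero> \<Longrightarrow> mobius_map m b s a (Some x) = Some (b \<oplus> m \<otimes> inv (s \<otimes> x \<oplus> a))"
proof -
  show "mobius_map m b s a None = Some b"
    using assms by (simp add: mobius_map_def lin_frac_def proj_line_def m_assoc)
  show "x \<in> carrier R \<Longrightarrow> s \<otimes> x \<oplus> a = \<zero> \<Longrightarrow> mobius_map m b s a (Some x) = None"
    by (simp add: mobius_map_def lin_frac_def proj_line_def)
  show "mobius_map m b s a (Some x) = Some (b \<oplus> m \<otimes> inv (s \<otimes> x \<oplus> a))"
    if x: "x \<in> carrier R" and ne: "s \<otimes> x \<oplus> a \<noteq> \<zero>"
  proof -
    let ?v = "s \<otimes> x \<oplus> a"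
    have v: "?v \<in> carrier R" using assms x by auto
    have "b \<otimes> s \<otimes> x \<oplus> (m \<oplus> b \<otimes> a) = b \<otimes> ?v \<oplus> m" using assms x by (simp add: r_distr m_assoc a_ac)
    hence "(b \<otimes> s \<otimes> x \<oplus> (m \<oplus> b \<otimes> a)) \<otimes> inv ?v = b \<oplus> m \<otimes> inv ?v"
      using assms v inv_carrier[OF v ne] nonzero_inv(1)[OF v ne] by (simp add: l_distr m_assoc)
    thus ?thesis using x ne by (simp add: mobius_map_def lin_frac_def proj_line_def)
  qed
qed

lemma affine_map_mem: "s \<in> S \<Longrightarrow> e \<in> carrier R \<Longrightarrow> affine_map s e \<in> S_transformations"
  unfolding S_transformations_def affine_map_def
  by (rule CollectI, intro exI[of _ s] exI[of _ \<zero>] exI[of _ e] exI[of _ \<one>]) (auto simp: S_carrier minus_eq)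

text \<open>The determinant is \<open>s \<otimes> (\<ominus> m)\<close>, which explains the
  hypothesis on \<open>\<ominus> m\<close>.\<close>

lemma mobius_map_mem:
  assumes "\<ominus> m \<in> S" "m \<in> carrier R" "s \<in> S" "b \<in> carrier R" "a \<in> carrier R"
  shows "mobius_map m b s a \<in> S_transformations"
proof -
  have s: "s \<in> carrier R" using assms S_carrier by blast
  have "b \<otimes> s \<otimes> a \<ominus> s \<otimes> (m \<oplus> b \<otimes> a) = s \<otimes> (\<ominus> m)" using assms s by algebra
  also have "\<dots> \<in> S" using S_mult assms by blast
  finally show ?thesis
    unfolding S_transformations_def mobius_map_def
    by (intro CollectI exI[of _ "b \<otimes> s"] exI[of _ s] exI[of _ "m \<oplus> b \<otimes> a"] exI[of _ a]) (use assms s in auto)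
qed

text \<open>The Bruhat decomposition: a transformation either fixes infinity and is affine, or it is
  an affine map followed by \<open>x \<mapsto> m / x\<close> and a translation. A scalar factor
  brings the matrix into one of the two normal forms and changes the determinant only by a square,
  which lies in \<open>S\<close>.\<close>

lemma S_transformations_cases:
  assumes f: "f \<in> S_transformations" and m: "\<ominus> m \<in> S" "m \<in> carrier R"
  shows "(\<exists>s\<in>S. \<exists>e\<in>carrier R. f = affine_map s e) \<or>
    (\<exists>b\<in>carrier R. \<exists>s\<in>S. \<exists>a\<in>carrier R. f = mobius_map m b s a)"
proof -
  obtain x y z w where f: "f = lin_frac R x y z w" and
    X: "x \<in> carrier R" "y \<in> carrier R" "z \<in> carrier R" "w \<in> carrier R" and det: "x \<otimes> w \<ominus> y \<otimes> z \<in> S"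
    using f unfolding S_transformations_def by blast
  show ?thesis
  proof (cases "y = \<zero>")
    case True
    hence xw: "x \<otimes> w \<in> S" using det X by (simp add: minus_eq)
    hence "x \<otimes> w \<noteq> \<zero>" using S_nonzero by blast
    hence w: "w \<noteq> \<zero>" using X by auto
    let ?l = "inv w"
    have l: "?l \<in> nonzero" using inv_nonzero w X by blast
    have "f = lin_frac R (?l \<otimes> x) (?l \<otimes> y) (?l \<otimes> z) (?l \<otimes> w)" using lin_frac_scale[OF l X] f by simp
    also have "\<dots> = affine_map (?l \<otimes> x) (?l \<otimes> z)" using True w X l by (simp add: affine_map_def)
    finally have *: "f = affine_map (?l \<otimes> x) (?l \<otimes> z)" .
    have "?l \<otimes> x = (?l \<otimes> ?l) \<otimes> (x \<otimes> w)"
    proof -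
      have "(?l \<otimes> ?l) \<otimes> (x \<otimes> w) = ?l \<otimes> x \<otimes> (?l \<otimes> w)" using X l by (simp only: m_ac m_closed DiffD1)
      thus ?thesis using X w l by simp
    qed
    hence "?l \<otimes> x \<in> S" using S_mult[OF S_square[OF l] xw] by simp
    thus ?thesis using * X l by auto
  next
    case False
    let ?D = "x \<otimes> w \<ominus> y \<otimes> z"
    have D: "?D \<in> nonzero" using det S_nonzero by blast
    have iD: "inv ?D \<in> carrier R" "inv ?D \<noteq> \<zero>" using inv_nonzero[OF D] by auto
    have iy: "inv y \<in> carrier R" "inv y \<noteq> \<zero>" using False X by auto
    have n: "\<ominus> m \<in> nonzero" using m S_nonzero by blast
    \<comment> \<open>The factor is chosen so that the new determinant
      \<open>l \<otimes> l \<otimes> D\<close> equals \<open>s \<otimes> (\<ominus> m)\<close> with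
      \<open>s = l \<otimes> y\<close>, as the normal form requires.\<close>
    let ?l = "(\<ominus> m) \<otimes> y \<otimes> inv ?D" and ?b = "x \<otimes> inv y"
    have l: "?l \<in> nonzero" using n iD False X by simp
    have lc: "?l \<in> carrier R" using l by simp
    let ?s = "?l \<otimes> y" and ?a = "?l \<otimes> w"
    have "?s = (\<ominus> m) \<otimes> ((y \<otimes> y) \<otimes> inv ?D)" using X n iD by (simp only: m_ac m_closed DiffD1)
    moreover have "(y \<otimes> y) \<otimes> inv ?D \<in> S" using S_mult[OF S_square S_inv[OF det]] X False by blast
    ultimately have sS: "?s \<in> S" using S_mult[OF m(1)] by simp
    have 1: "?l \<otimes> x = ?b \<otimes> ?s"
    proof -
      have "?b \<otimes> ?s = ?l \<otimes> x \<otimes> (y \<otimes> inv y)" using X lc iy by (simp only: m_ac m_closed)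
      thus ?thesis using X lc False by simp
    qed
    have 2: "?l \<otimes> z = m \<oplus> ?b \<otimes> ?a"
    proof -
      have e: "?l \<otimes> ?D = (\<ominus> m) \<otimes> y"
        using X n iD(1) D nonzero_inv(2)[of ?D] by (simp only: m_assoc DiffD1 m_closed r_one) simp
      have "y \<otimes> (m \<oplus> ?b \<otimes> ?a) = y \<otimes> m \<oplus> (y \<otimes> inv y) \<otimes> (x \<otimes> (?l \<otimes> w))"
        using X lc iy m by (simp only: r_distr m_ac m_closed)
      also have "\<dots> = y \<otimes> m \<oplus> ?l \<otimes> (x \<otimes> w)"
      proof -
        have "y \<otimes> inv y = \<one>" using X False by simp
        moreover have "x \<otimes> (?l \<otimes> w) = ?l \<otimes> (x \<otimes> w)" using X lc by (simp only: m_lcomm)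
        ultimately show ?thesis using X lc by (simp only: l_one m_closed)
      qed
      also have "\<dots> = y \<otimes> m \<oplus> (?l \<otimes> ?D \<oplus> ?l \<otimes> (y \<otimes> z))"
      proof -
        have "l \<otimes> (x \<otimes> w) = l \<otimes> ?D \<oplus> l \<otimes> (y \<otimes> z)" if "l \<in> carrier R" for l using that X by algebra
        thus ?thesis using lc by metis
      qed
      also have "\<dots> = y \<otimes> m \<oplus> ((\<ominus> m) \<otimes> y \<oplus> ?l \<otimes> (y \<otimes> z))" by (simp only: e)
      also have "\<dots> = y \<otimes> (?l \<otimes> z)"
      proof -
        have "y \<otimes> m \<oplus> ((\<ominus> m) \<otimes> y \<oplus> l \<otimes> (y \<otimes> z)) = y \<otimes> (l \<otimes> z)" if "l \<in> carrier R" for l using that X m by algebra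
        thus ?thesis using lc by metis
      qed
      finally show ?thesis using nonzero_cancel[of y "m \<oplus> ?b \<otimes> ?a" "?l \<otimes> z"] X False lc iy m by simp
    qed
    have "f = lin_frac R (?l \<otimes> x) (?l \<otimes> y) (?l \<otimes> z) (?l \<otimes> w)" using lin_frac_scale[OF l X] f by simp
    also have "\<dots> = mobius_map m ?b ?s ?a" unfolding mobius_map_def 1 2 ..
    finally have "f = mobius_map m ?b ?s ?a" .
    moreover have "?b \<in> carrier R" "?a \<in> carrier R" using X lc iy by auto
    ultimately show ?thesis using sS by blast
  qed
qed

end

section \<open>Coordinates on the projective line\<close>

text \<open>\<open>\<psi>\<close> identifies the additive group of the field with \<open>K\<close>.
  In the coordinates \<open>pt\<close> the element \<open>\<psi> b\<close> becomes translation by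
  \<open>b\<close>, the elements of \<open>D\<close> become multiplications, and \<open>t\<close>
  interchanges zero and infinity.\<close>

locale zassenhaus_coordinates = zassenhaus_action G E \<phi> q d c pinf p0 + F: field F
  for G (structure) and E and \<phi> and q d c and pinf p0 and F :: "nat ring" +
  fixes \<psi> and t
  assumes psi_bij: "bij_betw \<psi> (carrier F) K"
    and psi_add: "x \<in> carrier F \<Longrightarrow> y \<in> carrier F \<Longrightarrow> \<psi> (x \<oplus>\<^bsub>F\<^esub> y) = \<psi> x \<otimes> \<psi> y"
    and D_mult: "g \<in> D \<Longrightarrow> \<exists>s\<in>carrier F. \<forall>x\<in>carrier F. \<psi> (s \<otimes>\<^bsub>F\<^esub> x) = conj_by g (\<psi> x)"
    and t: "t \<in> carrier G" "\<phi> t pinf = p0" "\<phi> t p0 = pinf"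
begin

definition pt where "pt x = \<phi> (\<psi> x) p0"

lemma psi_K: "x \<in> carrier F \<Longrightarrow> \<psi> x \<in> K"
  using bij_betwE[OF psi_bij] by blast

lemma psi_carrier: "x \<in> carrier F \<Longrightarrow> \<psi> x \<in> carrier G"
  using psi_K K_carrier by blast

lemma psi_zero: "\<psi> \<zero>\<^bsub>F\<^esub> = \<one>"
  using psi_add[of "\<zero>\<^bsub>F\<^esub>" "\<zero>\<^bsub>F\<^esub>"] psi_carrier[of "\<zero>\<^bsub>F\<^esub>"] by simp

lemma pt_bij: "bij_betw pt (carrier F) (E - {pinf})"
  using bij_betw_trans[OF psi_bij K_regular] by (simp add: comp_def pt_def[abs_def])

lemma pt_eq_iff: "x \<in> carrier F \<Longrightarrow> y \<in> carrier F \<Longrightarrow> pt x = pt y \<longleftrightarrow> x = y"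
  using bij_betw_imp_inj_on[OF pt_bij] by (auto dest: inj_onD)

lemma pt_E: "x \<in> carrier F \<Longrightarrow> pt x \<in> E" "x \<in> carrier F \<Longrightarrow> pt x \<noteq> pinf"
  using bij_betwE[OF pt_bij] by auto

lemma pt_surj: "y \<in> E \<Longrightarrow> y \<noteq> pinf \<Longrightarrow> \<exists>x\<in>carrier F. y = pt x"
  using bij_betw_imp_surj_on[OF pt_bij] by blast

lemma pt_zero: "pt \<zero>\<^bsub>F\<^esub> = p0"
  using base by (simp add: pt_def psi_zero)

lemma psi_act:
  assumes "b \<in> carrier F" "x \<in> carrier F" shows "\<phi> (\<psi> b) (pt x) = pt (b \<oplus>\<^bsub>F\<^esub> x)"
  using act_mult[OF psi_carrier[OF assms(1)] psi_carrier[OF assms(2)] base(2)] psi_add[OF assms] by (simp add: pt_def)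

lemma psi_pinf: "b \<in> carrier F \<Longrightarrow> \<phi> (\<psi> b) pinf = pinf"
  using K_fix psi_K by blast

lemma D_act:
  assumes g: "g \<in> D" shows "\<exists>s\<in>carrier F. \<forall>x\<in>carrier F. \<phi> g (pt x) = pt (s \<otimes>\<^bsub>F\<^esub> x)"
proof -
  obtain s where s: "s \<in> carrier F" "\<And>x. x \<in> carrier F \<Longrightarrow> \<psi> (s \<otimes>\<^bsub>F\<^esub> x) = conj_by g (\<psi> x)"
    using D_mult[OF g] by blast
  have gc: "g \<in> carrier G" using D_carrier[OF g] .
  have g0: "\<phi> g p0 = p0" using g by (simp add: stab_iff)
  have "\<phi> g (pt x) = pt (s \<otimes>\<^bsub>F\<^esub> x)" if x: "x \<in> carrier F" for x
  proof -
    have u: "\<psi> x \<in> carrier G" using psi_carrier[OF x] .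
    have "conj_by g (\<psi> x) \<otimes> g = g \<otimes> \<psi> x" using gc u by (simp add: conj_by_def m_assoc)
    hence "\<phi> g (pt x) = \<phi> (conj_by g (\<psi> x)) (\<phi> g p0)"
      using act_mult[OF gc u base(2)] act_mult[OF conj_closed[OF gc u] gc base(2)] by (simp add: pt_def)
    thus ?thesis using s(2)[OF x] g0 by (simp add: pt_def)
  qed
  thus ?thesis using s(1) by blast
qed

definition multiplies where "multiplies g s \<longleftrightarrow> (\<forall>x\<in>carrier F. \<phi> g (pt x) = pt (s \<otimes>\<^bsub>F\<^esub> x))"

definition S where "S = {s \<in> carrier F. \<exists>g\<in>D. multiplies g s}"

lemma multipliesD: "multiplies g s \<Longrightarrow> x \<in> carrier F \<Longrightarrow> \<phi> g (pt x) = pt (s \<otimes>\<^bsub>F\<^esub> x)"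
  by (simp add: multiplies_def)

lemma fixes_three:
  assumes "g \<in> D" "\<phi> g (pt \<one>\<^bsub>F\<^esub>) = pt \<one>\<^bsub>F\<^esub>" shows "g = \<one>"
proof (rule ccontr)
  assume "g \<noteq> \<one>"
  moreover have "pt \<one>\<^bsub>F\<^esub> \<noteq> p0" using pt_eq_iff[of "\<one>\<^bsub>F\<^esub>" "\<zero>\<^bsub>F\<^esub>"] pt_zero by simp
  moreover have "g \<in> stab (pt \<one>\<^bsub>F\<^esub>)" using assms D_carrier[OF assms(1)] by (simp add: stab_iff)
  ultimately show False
    using third_fixed_point[of g pinf p0 "pt \<one>\<^bsub>F\<^esub>"] assms(1) base pt_E[of "\<one>\<^bsub>F\<^esub>"] by auto
qed

lemma S_field: "field_index_subgroup F S c d"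
proof
  have cardF: "card (carrier F) = q" using bij_betw_same_card[OF psi_bij] card_K by simp
  thus finF: "finite (carrier F)" using q3 by (metis card.infinite not_numeral_le_zero)
  show "card (carrier F) = c * d + 1" using cardF c q3 by simp
  show "c = 1 \<or> c = 2" by (rule c)
  show S0: "S \<subseteq> carrier F - {\<zero>\<^bsub>F\<^esub>}"
  proof
    fix s assume "s \<in> S"
    then obtain g where s: "s \<in> carrier F" and g: "g \<in> D" "multiplies g s" by (auto simp: S_def)
    have "s \<noteq> \<zero>\<^bsub>F\<^esub>"
    proof
      assume "s = \<zero>\<^bsub>F\<^esub>"
      hence "\<phi> g (pt \<one>\<^bsub>F\<^esub>) = \<phi> g (pt \<zero>\<^bsub>F\<^esub>)" using multipliesD[OF g(2)] by simp
      hence "pt \<one>\<^bsub>F\<^esub> = pt \<zero>\<^bsub>F\<^esub>" using act_eq_iff[OF D_carrier[OF g(1)]] pt_E by simp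
      thus False using pt_eq_iff by simp
    qed
    thus "s \<in> carrier F - {\<zero>\<^bsub>F\<^esub>}" using s by blast
  qed
  have "multiplies \<one> \<one>\<^bsub>F\<^esub>" by (simp add: multiplies_def pt_E)
  thus "\<one>\<^bsub>F\<^esub> \<in> S" using subgroup.one_closed[OF subgroup_D] by (auto simp: S_def)
  show "x \<otimes>\<^bsub>F\<^esub> y \<in> S" if xy: "x \<in> S" "y \<in> S" for x y
  proof -
    obtain g h where g: "x \<in> carrier F" "g \<in> D" "multiplies g x" and h: "y \<in> carrier F" "h \<in> D" "multiplies h y"
      using xy by (auto simp: S_def)
    have "multiplies (g \<otimes> h) (x \<otimes>\<^bsub>F\<^esub> y)"
      using g h D_carrier pt_E by (simp add: multiplies_def act_mult F.m_assoc)
    moreover have "g \<otimes> h \<in> D" using subgroup.m_closed[OF subgroup_D g(2) h(2)] .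
    ultimately show ?thesis unfolding S_def using g h by blast
  qed
  show "inv\<^bsub>F\<^esub> x \<in> S" if xS: "x \<in> S" for x
  proof -
    obtain g where g: "x \<in> carrier F" "g \<in> D" "multiplies g x" using xS by (auto simp: S_def)
    have xu: "x \<in> Units F" using S0 xS F.field_Units by blast
    have gc: "g \<in> carrier G" using D_carrier[OF g(2)] .
    have "multiplies (inv g) (inv\<^bsub>F\<^esub> x)"
      unfolding multiplies_def
    proof
      fix y assume y: "y \<in> carrier F"
      let ?z = "inv\<^bsub>F\<^esub> x \<otimes>\<^bsub>F\<^esub> y"
      have z: "?z \<in> carrier F" using xu y by simp
      have "x \<otimes>\<^bsub>F\<^esub> ?z = y"
        using g(1) F.Units_inv_closed[OF xu] F.Units_r_inv[OF xu] y by (simp add: F.m_assoc[symmetric])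
      hence "\<phi> g (pt ?z) = pt y" using multipliesD[OF g(3) z] by simp
      thus "\<phi> (inv g) (pt y) = pt ?z" using act_inv[OF gc pt_E(1)[OF z]] by simp
    qed
    moreover have "inv g \<in> D" using subgroup.m_inv_closed[OF subgroup_D g(2)] .
    ultimately show ?thesis unfolding S_def using xu by blast
  qed
  define f where "f g = (SOME s. s \<in> carrier F \<and> multiplies g s)" for g
  have f: "f g \<in> carrier F" "multiplies g (f g)" if g: "g \<in> D" for g
  proof -
    have "\<exists>s. s \<in> carrier F \<and> multiplies g s" using D_act[OF g] by (auto simp: multiplies_def)
    from someI_ex[OF this] show "f g \<in> carrier F" "multiplies g (f g)" by (auto simp: f_def)
  qed
  have "inj_on f D"
  proof (rule inj_onI)
    fix g h assume g: "g \<in> D" and h: "h \<in> D" and eq: "f g = f h"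
    have gc: "g \<in> carrier G" "h \<in> carrier G" using D_carrier g h by auto
    have 1: "\<phi> g (pt \<one>\<^bsub>F\<^esub>) = \<phi> h (pt \<one>\<^bsub>F\<^esub>)"
      using multipliesD[OF f(2)[OF g]] multipliesD[OF f(2)[OF h]] eq by simp
    have "\<phi> (inv h \<otimes> g) (pt \<one>\<^bsub>F\<^esub>) = pt \<one>\<^bsub>F\<^esub>"
      using act_mult[of "inv h" g "pt \<one>\<^bsub>F\<^esub>"] 1 gc pt_E by simp
    moreover have "inv h \<otimes> g \<in> D"
      by (rule subgroup.m_closed[OF subgroup_D subgroup.m_inv_closed[OF subgroup_D h] g])
    ultimately have "inv h \<otimes> g = \<one>" using fixes_three by blast
    hence "h \<otimes> (inv h \<otimes> g) = h" using gc by simp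
    thus "g = h" using gc by (simp add: m_assoc[symmetric])
  qed
  moreover have "f ` D = S"
  proof
    show "f ` D \<subseteq> S" using f by (auto simp: S_def)
    show "S \<subseteq> f ` D"
    proof
      fix s assume "s \<in> S"
      then obtain g where s: "s \<in> carrier F" and g: "g \<in> D" "multiplies g s" by (auto simp: S_def)
      have "pt (f g \<otimes>\<^bsub>F\<^esub> \<one>\<^bsub>F\<^esub>) = pt (s \<otimes>\<^bsub>F\<^esub> \<one>\<^bsub>F\<^esub>)"
        using multipliesD[OF f(2)[OF g(1)], of "\<one>\<^bsub>F\<^esub>"] multipliesD[OF g(2), of "\<one>\<^bsub>F\<^esub>"] by simp
      hence "f g = s" using pt_eq_iff s f(1)[OF g(1)] by simp
      thus "s \<in> f ` D" using g by blast
    qed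
  qed
  ultimately show "card S = d" using card_image card_stab2[OF base] by metis
qed

sublocale I: field_index_subgroup F S c d
  by (rule S_field)

lemma S_elt: "s \<in> S \<Longrightarrow> \<exists>g\<in>D. multiplies g s"
  by (simp add: S_def)

definition tau where "tau x = (SOME y. y \<in> carrier F \<and> pt y = \<phi> t (pt x))"

lemma tau:
  assumes x: "x \<in> I.nonzero" shows "tau x \<in> I.nonzero" "\<phi> t (pt x) = pt (tau x)"
proof -
  have xc: "x \<in> carrier F" "x \<noteq> \<zero>\<^bsub>F\<^esub>" using x by auto
  have ne: "pt x \<noteq> p0" using pt_eq_iff[of x "\<zero>\<^bsub>F\<^esub>"] pt_zero xc by simp
  have E: "pt x \<in> E" "pt x \<noteq> pinf" using pt_E xc by auto
  have 1: "\<phi> t (pt x) \<in> E" using t E by simp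
  have 2: "\<phi> t (pt x) \<noteq> pinf"
  proof
    assume "\<phi> t (pt x) = pinf"
    hence "\<phi> t (pt x) = \<phi> t p0" using t by simp
    thus False using act_eq_iff[OF t(1) E(1) base(2)] ne by blast
  qed
  have 3: "\<phi> t (pt x) \<noteq> p0"
  proof
    assume "\<phi> t (pt x) = p0"
    hence "\<phi> t (pt x) = \<phi> t pinf" using t by simp
    thus False using act_eq_iff[OF t(1) E(1) base(1)] E by blast
  qed
  have "\<exists>y. y \<in> carrier F \<and> pt y = \<phi> t (pt x)" using pt_surj[OF 1 2] by metis
  from someI_ex[OF this] have y: "tau x \<in> carrier F" "pt (tau x) = \<phi> t (pt x)" by (auto simp: tau_def)
  show "\<phi> t (pt x) = pt (tau x)" using y by simp
  show "tau x \<in> I.nonzero" using y 3 pt_zero by auto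
qed

lemma tau_tau: assumes x: "x \<in> I.nonzero" shows "tau (tau x) = x"
proof -
  have E: "pt x \<in> E" using pt_E x by auto
  have "pt (tau (tau x)) = \<phi> t (\<phi> t (pt x))" using tau[OF x] tau[OF tau(1)[OF x]] by simp
  also have "\<dots> = \<phi> (t \<otimes> t) (pt x)" using act_mult[OF t(1) t(1) E] by simp
  also have "\<dots> = pt x" using swap_inverts(1)[OF t] E by simp
  finally show ?thesis using pt_eq_iff tau(1)[OF tau(1)[OF x]] x by auto
qed

text \<open>The identity \<open>g \<otimes> (t \<otimes> g) = t\<close>, a form of the inversion of
  \<open>g\<close> by \<open>t\<close>, read in coordinates.\<close>

lemma tau_mult:
  assumes s: "s \<in> S" and x: "x \<in> I.nonzero" shows "s \<otimes>\<^bsub>F\<^esub> tau (s \<otimes>\<^bsub>F\<^esub> x) = tau x"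
proof -
  obtain g where g: "g \<in> D" "multiplies g s" using S_elt[OF s] by blast
  have gc: "g \<in> carrier G" using D_carrier[OF g(1)] .
  have xc: "x \<in> carrier F" using x by auto
  have E: "pt x \<in> E" using pt_E xc by auto
  have sx: "s \<otimes>\<^bsub>F\<^esub> x \<in> I.nonzero" using I.nonzero_mult[OF I.S_nonzero[OF s] x] .
  have "g \<otimes> (t \<otimes> g) = t"
  proof -
    have "t \<otimes> g = inv g \<otimes> t"
    proof -
      have "t \<otimes> g \<otimes> t \<otimes> t = inv g \<otimes> t" using swap_inverts(2)[OF t g(1)] by simp
      thus ?thesis using swap_inverts(1)[OF t] t gc by (simp add: m_assoc)
    qed
    thus ?thesis using t gc by (simp add: m_assoc[symmetric])
  qed
  hence "\<phi> t (pt x) = \<phi> (g \<otimes> (t \<otimes> g)) (pt x)" by simp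
  also have "\<dots> = \<phi> g (\<phi> t (\<phi> g (pt x)))"
    using act_mult[OF gc m_closed[OF t(1) gc] E] act_mult[OF t(1) gc E] by simp
  also have "\<dots> = pt (s \<otimes>\<^bsub>F\<^esub> tau (s \<otimes>\<^bsub>F\<^esub> x))"
    using multipliesD[OF g(2) xc] tau[OF sx] multipliesD[OF g(2), of "tau (s \<otimes>\<^bsub>F\<^esub> x)"] by simp
  finally have "pt (tau x) = pt (s \<otimes>\<^bsub>F\<^esub> tau (s \<otimes>\<^bsub>F\<^esub> x))" using tau(2)[OF x] by simp
  thus ?thesis using pt_eq_iff[of "tau x" "s \<otimes>\<^bsub>F\<^esub> tau (s \<otimes>\<^bsub>F\<^esub> x)"] tau(1)[OF x] tau(1)[OF sx] I.S_carrier[OF s] by simp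
qed

text \<open>The element \<open>x \<mapsto> tau x / s + a\<close> with \<open>a = w - tau 1 / s\<close> interchanges \<open>1\<close> and \<open>w\<close>, so it is an
  involution and must have its pole at its value at infinity.\<close>

lemma tau_swap:
  assumes s: "s \<in> S" and w: "w \<in> I.nonzero" "w \<noteq> \<one>\<^bsub>F\<^esub>"
    and eq: "s \<otimes>\<^bsub>F\<^esub> (\<one>\<^bsub>F\<^esub> \<ominus>\<^bsub>F\<^esub> w) = tau w \<ominus>\<^bsub>F\<^esub> tau \<one>\<^bsub>F\<^esub>"
  shows "s \<otimes>\<^bsub>F\<^esub> w = tau \<one>\<^bsub>F\<^esub>"
proof -
  let ?r = "inv\<^bsub>F\<^esub> s" and ?m = "tau \<one>\<^bsub>F\<^esub>"
  let ?a = "w \<ominus>\<^bsub>F\<^esub> ?r \<otimes>\<^bsub>F\<^esub> ?m"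
  have r: "?r \<in> S" using I.S_inv[OF s] .
  obtain g where g: "g \<in> D" "multiplies g ?r" using S_elt[OF r] by blast
  have gc: "g \<in> carrier G" using D_carrier[OF g(1)] .
  have one: "\<one>\<^bsub>F\<^esub> \<in> I.nonzero" by simp
  have m: "?m \<in> carrier F" and tw: "tau w \<in> carrier F" and wc: "w \<in> carrier F"
    using tau(1)[OF one] tau(1)[OF w(1)] w by auto
  have rc: "?r \<in> carrier F" "s \<in> carrier F" "s \<noteq> \<zero>\<^bsub>F\<^esub>" using I.S_carrier[OF r] I.S_nonzero[OF s] by auto
  have ac: "?a \<in> carrier F" using wc rc m by simp
  let ?h = "\<psi> ?a \<otimes> (g \<otimes> t)"
  have pc: "\<psi> ?a \<in> carrier G" using psi_carrier[OF ac] .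
  have hc: "?h \<in> carrier G" using pc gc t by simp
  have h: "\<phi> ?h y = \<phi> (\<psi> ?a) (\<phi> g (\<phi> t y))" if "y \<in> E" for y
    using act_mult[OF pc m_closed[OF gc t(1)] that] act_mult[OF gc t(1) that] by simp
  have hpt: "\<phi> ?h (pt x) = pt (?a \<oplus>\<^bsub>F\<^esub> ?r \<otimes>\<^bsub>F\<^esub> tau x)" if x: "x \<in> I.nonzero" for x
  proof -
    have tx: "tau x \<in> carrier F" "x \<in> carrier F" using tau(1)[OF x] x by auto
    show ?thesis using h[OF pt_E(1)[OF tx(2)]] tau(2)[OF x] multipliesD[OF g(2) tx(1)] psi_act[OF ac] rc tx by simp
  qed
  have E1: "\<phi> ?h (pt \<one>\<^bsub>F\<^esub>) = pt w"
  proof -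
    have "(w \<ominus>\<^bsub>F\<^esub> u) \<oplus>\<^bsub>F\<^esub> u = w" if "u \<in> carrier F" for u using that wc by algebra
    thus ?thesis using hpt[OF one] rc m by simp
  qed
  have E2: "\<phi> ?h (pt w) = pt \<one>\<^bsub>F\<^esub>"
  proof -
    have "?r \<otimes>\<^bsub>F\<^esub> (s \<otimes>\<^bsub>F\<^esub> (\<one>\<^bsub>F\<^esub> \<ominus>\<^bsub>F\<^esub> w)) = ?r \<otimes>\<^bsub>F\<^esub> (tau w \<ominus>\<^bsub>F\<^esub> ?m)" using eq by simp
    moreover have "?r \<otimes>\<^bsub>F\<^esub> (s \<otimes>\<^bsub>F\<^esub> (\<one>\<^bsub>F\<^esub> \<ominus>\<^bsub>F\<^esub> w)) = \<one>\<^bsub>F\<^esub> \<ominus>\<^bsub>F\<^esub> w"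
      using rc wc by (simp add: F.m_assoc[symmetric])
    ultimately have *: "\<one>\<^bsub>F\<^esub> \<ominus>\<^bsub>F\<^esub> w = ?r \<otimes>\<^bsub>F\<^esub> (tau w \<ominus>\<^bsub>F\<^esub> ?m)" by simp
    have "(w \<ominus>\<^bsub>F\<^esub> r \<otimes>\<^bsub>F\<^esub> ?m) \<oplus>\<^bsub>F\<^esub> r \<otimes>\<^bsub>F\<^esub> tau w = w \<oplus>\<^bsub>F\<^esub> r \<otimes>\<^bsub>F\<^esub> (tau w \<ominus>\<^bsub>F\<^esub> ?m)" if "r \<in> carrier F" for r
      using that wc m tw by algebra
    hence "?a \<oplus>\<^bsub>F\<^esub> ?r \<otimes>\<^bsub>F\<^esub> tau w = w \<oplus>\<^bsub>F\<^esub> (\<one>\<^bsub>F\<^esub> \<ominus>\<^bsub>F\<^esub> w)" using rc * by simp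
    also have "\<dots> = \<one>\<^bsub>F\<^esub>" using wc F.one_closed by algebra
    finally show ?thesis using hpt[OF w(1)] by simp
  qed
  have ne: "pt \<one>\<^bsub>F\<^esub> \<noteq> pt w" using pt_eq_iff[of "\<one>\<^bsub>F\<^esub>" w] w wc by auto
  have hh: "?h \<otimes> ?h = \<one>"
    by (rule swap_square[OF hc _ _ ne E1 E2]) (use pt_E wc in auto)
  have "\<phi> ?h pinf = pt ?a"
  proof -
    have "\<phi> g p0 = p0" using g by (simp add: stab_iff)
    hence "\<phi> ?h pinf = \<phi> (\<psi> ?a) (pt \<zero>\<^bsub>F\<^esub>)" using h[OF base(1)] t pt_zero by simp
    thus ?thesis using psi_act[OF ac F.zero_closed] ac by simp
  qed
  hence hpa: "\<phi> ?h (pt ?a) = pinf" using act_mult[OF hc hc base(1)] hh base by simp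
  have "?a = \<zero>\<^bsub>F\<^esub>"
  proof (rule ccontr)
    assume "?a \<noteq> \<zero>\<^bsub>F\<^esub>"
    hence a: "?a \<in> I.nonzero" using ac by blast
    have "?a \<oplus>\<^bsub>F\<^esub> ?r \<otimes>\<^bsub>F\<^esub> tau ?a \<in> carrier F" using ac rc tau(1)[OF a] by simp
    moreover have "pt (?a \<oplus>\<^bsub>F\<^esub> ?r \<otimes>\<^bsub>F\<^esub> tau ?a) = pinf" using hpt[OF a] hpa by (simp only:)
    ultimately show False using pt_E(2) by blast
  qed
  hence "w = ?r \<otimes>\<^bsub>F\<^esub> ?m" using F.r_right_minus_eq[of w "?r \<otimes>\<^bsub>F\<^esub> ?m"] wc rc m by simp
  thus ?thesis using rc m by (simp add: F.m_assoc[symmetric])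
qed

abbreviation m where "m \<equiv> tau \<one>\<^bsub>F\<^esub>"

lemma tau_formula: "x \<in> I.nonzero \<Longrightarrow> x \<otimes>\<^bsub>F\<^esub> tau x = m"
  using I.inversion_formula[of tau x] tau(1) tau_tau tau_mult tau_swap by blast

lemma m_nonzero: "m \<in> I.nonzero"
  by (rule tau) simp

text \<open>Undoing the translation that agrees with \<open>h\<close> at zero leaves an element that
  fixes both base points.\<close>

lemma stab_pinf_form:
  assumes h: "h \<in> carrier G" "\<phi> h pinf = pinf"
  shows "\<exists>s\<in>S. \<exists>e\<in>carrier F. \<exists>g\<in>D. multiplies g s \<and> h = \<psi> e \<otimes> g"
proof -
  have "\<phi> h p0 \<in> E" "\<phi> h p0 \<noteq> pinf" using h base act_eq_iff[OF h(1) base(2,1)] by auto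
  then obtain e where e: "e \<in> carrier F" "\<phi> h p0 = pt e" using pt_surj by blast
  have ec: "\<psi> e \<in> carrier G" using psi_carrier[OF e(1)] .
  let ?g = "inv (\<psi> e) \<otimes> h"
  have ei: "\<phi> (inv (\<psi> e)) pinf = pinf" using act_inv[OF ec base(1)] psi_pinf[OF e(1)] by simp
  have "\<phi> (inv (\<psi> e)) (pt e) = p0" using act_inv[OF ec base(2)] by (simp add: pt_def)
  hence g: "?g \<in> D" using act_mult[OF inv_closed[OF ec] h(1)] h base e ei ec by (simp add: stab_iff)
  then obtain s where "s \<in> carrier F" "multiplies ?g s" using D_act by (auto simp: multiplies_def)
  moreover have "h = \<psi> e \<otimes> ?g" using ec h by (simp add: m_assoc[symmetric])
  ultimately show ?thesis using e g unfolding S_def by blast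
qed

text \<open>This says that \<open>x \<mapsto> m / x\<close> has determinant in \<open>S\<close>. The
  product of three factors \<open>t\<close>, separated by the translations by \<open>1\<close> and
  by \<open>-m\<close>, fixes infinity and is therefore \<open>x \<mapsto> s x + e\<close> with
  \<open>s\<close> in \<open>S\<close>. It sends 0 to -1 and \<open>-m\<close> to 0, whence
  \<open>e = -1\<close> and \<open>s (-m) = 1\<close>.\<close>

lemma minus_m_S: "\<ominus>\<^bsub>F\<^esub> m \<in> S"
proof -
  let ?o = "\<one>\<^bsub>F\<^esub>" and ?n = "\<ominus>\<^bsub>F\<^esub> m"
  have mc: "m \<in> carrier F" "m \<noteq> \<zero>\<^bsub>F\<^esub>" using m_nonzero by auto
  have nc: "?n \<in> carrier F" "?n \<noteq> \<zero>\<^bsub>F\<^esub>" using mc F.minus_minus[OF mc(1)] by auto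
  have tn: "tau ?n = \<ominus>\<^bsub>F\<^esub> ?o"
  proof -
    have tc: "tau ?n \<in> carrier F" using tau(1)[of ?n] nc by auto
    have "?n \<otimes>\<^bsub>F\<^esub> tau ?n = m" using tau_formula[of ?n] nc by blast
    also have "m = ?n \<otimes>\<^bsub>F\<^esub> (\<ominus>\<^bsub>F\<^esub> ?o)" using mc F.one_closed by algebra
    finally show ?thesis using I.nonzero_cancel[of ?n "tau ?n" "\<ominus>\<^bsub>F\<^esub> ?o"] nc tc by simp
  qed
  let ?h = "t \<otimes> (\<psi> ?n \<otimes> (t \<otimes> (\<psi> ?o \<otimes> t)))"
  have pc: "\<psi> ?n \<in> carrier G" "\<psi> ?o \<in> carrier G" using psi_carrier nc by auto
  have hc: "?h \<in> carrier G" using pc t by simp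
  have h: "\<phi> ?h y = \<phi> t (\<phi> (\<psi> ?n) (\<phi> t (\<phi> (\<psi> ?o) (\<phi> t y))))" if "y \<in> E" for y
    using pc t that by (simp add: act_mult)
  have one: "?o \<in> I.nonzero" by simp
  have nn: "?n \<in> I.nonzero" using nc by blast
  have "\<phi> ?h pinf = \<phi> t (\<phi> (\<psi> ?n) (\<phi> t (pt ?o)))"
    using h[OF base(1)] t pt_zero psi_act[of ?o "\<zero>\<^bsub>F\<^esub>"] by simp
  also have "\<dots> = \<phi> t (pt (?n \<oplus>\<^bsub>F\<^esub> m))" using tau(2)[OF one] psi_act[OF nc(1) mc(1)] by simp
  also have "\<dots> = pinf" using mc t pt_zero by (simp add: F.l_neg)
  finally have hinf: "\<phi> ?h pinf = pinf" .
  have "\<phi> ?h (pt ?n) = \<phi> t (\<phi> (\<psi> ?n) (\<phi> t (pt (?o \<oplus>\<^bsub>F\<^esub> (\<ominus>\<^bsub>F\<^esub> ?o)))))"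
    using h[OF pt_E(1)[OF nc(1)]] tau(2)[OF nn] tn psi_act[of ?o "\<ominus>\<^bsub>F\<^esub> ?o"] by simp
  also have "\<dots> = p0" using pt_zero t psi_pinf[OF nc(1)] by (simp add: F.r_neg)
  finally have hn: "\<phi> ?h (pt ?n) = pt \<zero>\<^bsub>F\<^esub>" using pt_zero by simp
  have h0: "\<phi> ?h (pt \<zero>\<^bsub>F\<^esub>) = pt (\<ominus>\<^bsub>F\<^esub> ?o)"
  proof -
    have "\<phi> ?h (pt \<zero>\<^bsub>F\<^esub>) = \<phi> t (\<phi> (\<psi> ?n) (\<phi> t pinf))"
      using h[OF base(2)] t pt_zero psi_pinf[of ?o] by simp
    also have "\<dots> = \<phi> t (pt ?n)" using t pt_zero psi_act[OF nc(1) F.zero_closed] nc by simp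
    finally show ?thesis using tau(2)[OF nn] tn by simp
  qed
  obtain s e g where s: "s \<in> S" "e \<in> carrier F" "g \<in> D" "multiplies g s" "?h = \<psi> e \<otimes> g"
    using stab_pinf_form[OF hc hinf] by blast
  have sc: "s \<in> carrier F" using I.S_carrier[OF s(1)] .
  have hx: "\<phi> ?h (pt x) = pt (e \<oplus>\<^bsub>F\<^esub> s \<otimes>\<^bsub>F\<^esub> x)" if "x \<in> carrier F" for x
    unfolding s(5) using act_mult[OF psi_carrier[OF s(2)] D_carrier[OF s(3)] pt_E(1)[OF that]]
      multipliesD[OF s(4) that] psi_act[OF s(2), of "s \<otimes>\<^bsub>F\<^esub> x"] sc that by simp
  have "pt e = pt (\<ominus>\<^bsub>F\<^esub> ?o)" using hx[of "\<zero>\<^bsub>F\<^esub>"] h0 s(2) sc by simp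
  hence e: "e = \<ominus>\<^bsub>F\<^esub> ?o" using pt_eq_iff s(2) by simp
  have "pt (e \<oplus>\<^bsub>F\<^esub> s \<otimes>\<^bsub>F\<^esub> ?n) = pt \<zero>\<^bsub>F\<^esub>" using hx[OF nc(1)] hn by simp
  hence "e \<oplus>\<^bsub>F\<^esub> s \<otimes>\<^bsub>F\<^esub> ?n = \<zero>\<^bsub>F\<^esub>" using pt_eq_iff s(2) sc nc by simp
  hence "\<ominus>\<^bsub>F\<^esub> (s \<otimes>\<^bsub>F\<^esub> ?n) = e" using F.minus_equality[of e "s \<otimes>\<^bsub>F\<^esub> ?n"] s(2) sc nc by simp
  hence sn: "s \<otimes>\<^bsub>F\<^esub> ?n = ?o" using e F.minus_minus[of "s \<otimes>\<^bsub>F\<^esub> ?n"] sc nc by simp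
  have "?n = inv\<^bsub>F\<^esub> s"
  proof -
    have "inv\<^bsub>F\<^esub> s \<otimes>\<^bsub>F\<^esub> (s \<otimes>\<^bsub>F\<^esub> ?n) = ?n"
      using sc nc I.S_nonzero[OF s(1)] I.S_carrier[OF I.S_inv[OF s(1)]] by (simp add: F.m_assoc[symmetric])
    thus ?thesis using sn I.S_carrier[OF I.S_inv[OF s(1)]] by simp
  qed
  thus ?thesis using I.S_inv[OF s(1)] by simp
qed

definition coord where "coord y = (if y = pinf then None else Some (inv_into (carrier F) pt y))"

lemma coord_simps [simp]: "coord pinf = None" "x \<in> carrier F \<Longrightarrow> coord (pt x) = Some x"
  using bij_betw_imp_inj_on[OF pt_bij] by (auto simp: coord_def pt_E)

lemma coord_bij: "bij_betw coord E (proj_line F)"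
proof -
  have E: "E = insert pinf (pt ` carrier F)" using bij_betw_imp_surj_on[OF pt_bij] base by auto
  have "inj_on coord E" unfolding E by (rule inj_onI) auto
  moreover have "coord ` E = proj_line F" unfolding E proj_line_def by (simp add: image_image)
  ultimately show ?thesis by (simp add: bij_betw_def)
qed

abbreviation T where "T g \<equiv> transport coord E (proj_line F) (\<phi> g)"

lemma T_None: "T g None = coord (\<phi> g pinf)"
  using inv_into_f_f[OF bij_betw_imp_inj_on[OF coord_bij] base(1)] by (simp add: transport_def proj_line_def)

lemma T_Some: "x \<in> carrier F \<Longrightarrow> T g (Some x) = coord (\<phi> g (pt x))"
  using inv_into_f_f[OF bij_betw_imp_inj_on[OF coord_bij] pt_E(1)[of x]] by (simp add: transport_def proj_line_def)

lemma T_eqI: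
  assumes "T g None = lin_frac F x y z w None" "\<And>u. u \<in> carrier F \<Longrightarrow> T g (Some u) = lin_frac F x y z w (Some u)"
  shows "T g = lin_frac F x y z w"
proof (rule extensionalityI)
  show "T g \<in> extensional (proj_line F)" by (simp add: transport_def)
  show "lin_frac F x y z w \<in> extensional (proj_line F)" by (simp add: lin_frac_def)
  fix u assume "u \<in> proj_line F"
  thus "T g u = lin_frac F x y z w u" using assms by (auto simp: proj_line_def)
qed

lemma T_affine:
  assumes s: "s \<in> S" and e: "e \<in> carrier F" and g: "g \<in> D" "multiplies g s"
  shows "T (\<psi> e \<otimes> g) = I.affine_map s e"
proof -
  have sc: "s \<in> carrier F" using I.S_carrier[OF s] .
  have gi: "\<phi> g pinf = pinf" using g(1) by (simp add: stab_iff)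
  have a: "\<phi> (\<psi> e \<otimes> g) y = \<phi> (\<psi> e) (\<phi> g y)" if "y \<in> E" for y
    by (rule act_mult[OF psi_carrier[OF e] D_carrier[OF g(1)] that])
  show ?thesis
    unfolding I.affine_map_def
  proof (rule T_eqI, fold I.affine_map_def)
    show "T (\<psi> e \<otimes> g) None = I.affine_map s e None"
      using I.affine_map_apply(1)[OF sc e] a[OF base(1)] gi psi_pinf[OF e] by (simp add: T_None)
    fix u assume u: "u \<in> carrier F"
    show "T (\<psi> e \<otimes> g) (Some u) = I.affine_map s e (Some u)"
      using I.affine_map_apply(2)[OF sc e u] a[OF pt_E(1)[OF u]] multipliesD[OF g(2) u] psi_act[OF e, of "s \<otimes>\<^bsub>F\<^esub> u"] sc u e
      by (simp add: T_Some F.a_comm)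
  qed
qed

lemma T_mobius:
  assumes s: "s \<in> S" and b: "b \<in> carrier F" and a: "a \<in> carrier F" and g: "g \<in> D" "multiplies g s"
  shows "T (\<psi> b \<otimes> (t \<otimes> (\<psi> a \<otimes> g))) = I.mobius_map m b s a"
proof -
  have sc: "s \<in> carrier F" "s \<in> I.nonzero" using I.S_carrier[OF s] I.S_nonzero[OF s] by auto
  have mc: "m \<in> carrier F" using m_nonzero by simp
  have gi: "\<phi> g pinf = pinf" using g(1) by (simp add: stab_iff)
  let ?h = "\<psi> b \<otimes> (t \<otimes> (\<psi> a \<otimes> g))"
  have act: "\<phi> ?h y = \<phi> (\<psi> b) (\<phi> t (\<phi> (\<psi> a) (\<phi> g y)))" if "y \<in> E" for y
    using psi_carrier[OF b] psi_carrier[OF a] D_carrier[OF g(1)] t that by (simp add: act_mult)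
  show ?thesis
    unfolding I.mobius_map_def
  proof (rule T_eqI, fold I.mobius_map_def)
    show "T ?h None = I.mobius_map m b s a None"
      using I.mobius_map_apply(1)[OF mc b sc(2) a] act[OF base(1)] gi psi_pinf[OF a] t pt_zero psi_act[OF b F.zero_closed] b
      by (simp add: T_None)
    fix u assume u: "u \<in> carrier F"
    let ?v = "s \<otimes>\<^bsub>F\<^esub> u \<oplus>\<^bsub>F\<^esub> a"
    have v: "?v \<in> carrier F" using sc u a by simp
    have h: "\<phi> ?h (pt u) = \<phi> (\<psi> b) (\<phi> t (pt ?v))"
      using act[OF pt_E(1)[OF u]] multipliesD[OF g(2) u] psi_act[OF a, of "s \<otimes>\<^bsub>F\<^esub> u"] sc u a by (simp add: F.a_comm)
    show "T ?h (Some u) = I.mobius_map m b s a (Some u)"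
    proof (cases "?v = \<zero>\<^bsub>F\<^esub>")
      case True
      have "\<phi> ?h (pt u) = pinf" using h psi_pinf[OF b] pt_zero t unfolding True by simp
      thus ?thesis using I.mobius_map_apply(2)[OF mc b sc(2) a u True] T_Some[OF u] by simp
    next
      case False
      hence vn: "?v \<in> I.nonzero" using v by blast
      have iv: "inv\<^bsub>F\<^esub> ?v \<in> carrier F" using I.inv_nonzero[OF vn] by blast
      have tc: "tau ?v \<in> carrier F" using tau(1)[OF vn] by blast
      have "?v \<otimes>\<^bsub>F\<^esub> tau ?v = ?v \<otimes>\<^bsub>F\<^esub> (m \<otimes>\<^bsub>F\<^esub> inv\<^bsub>F\<^esub> ?v)"
      proof -
        have "?v \<otimes>\<^bsub>F\<^esub> (m \<otimes>\<^bsub>F\<^esub> inv\<^bsub>F\<^esub> ?v) = m \<otimes>\<^bsub>F\<^esub> (?v \<otimes>\<^bsub>F\<^esub> inv\<^bsub>F\<^esub> ?v)" using v mc iv by (simp only: F.m_lcomm)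
        thus ?thesis using I.nonzero_inv(1)[OF v False] tau_formula[OF vn] mc by simp
      qed
      hence "tau ?v = m \<otimes>\<^bsub>F\<^esub> inv\<^bsub>F\<^esub> ?v" using I.nonzero_cancel[OF vn tc] mc iv by simp
      hence "\<phi> ?h (pt u) = pt (b \<oplus>\<^bsub>F\<^esub> m \<otimes>\<^bsub>F\<^esub> inv\<^bsub>F\<^esub> ?v)" using h tau(2)[OF vn] psi_act[OF b tc] by simp
      thus ?thesis using I.mobius_map_apply(3)[OF mc b sc(2) a u False] T_Some[OF u] b mc iv by simp
    qed
  qed
qed

text \<open>An element moving infinity to \<open>pt b\<close> becomes one fixing infinity after the
  translation by \<open>-b\<close> and \<open>t\<close>, which gives it the form
  \<open>\<psi> b \<otimes> (t \<otimes> (\<psi> a \<otimes> k))\<close>. Thus both groups have the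
  same Bruhat normal forms.\<close>

lemma T_image: "T ` carrier G = I.S_transformations"
proof
  show "T ` carrier G \<subseteq> I.S_transformations"
  proof
    fix f assume "f \<in> T ` carrier G"
    then obtain g where g: "g \<in> carrier G" "f = T g" by blast
    show "f \<in> I.S_transformations"
    proof (cases "\<phi> g pinf = pinf")
      case True
      thus ?thesis using stab_pinf_form[OF g(1)] T_affine I.affine_map_mem g(2) by metis
    next
      case False
      then obtain b where b: "b \<in> carrier F" "\<phi> g pinf = pt b" using pt_surj g base by (metis act_closed)
      have bc: "\<psi> b \<in> carrier G" using psi_carrier[OF b(1)] .
      let ?h = "t \<otimes> (inv (\<psi> b) \<otimes> g)"
      have hc: "?h \<in> carrier G" using bc t g by simp
      have "\<phi> (inv (\<psi> b)) (pt b) = p0" using act_inv[OF bc base(2)] by (simp add: pt_def)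
      hence "\<phi> ?h pinf = pinf" using bc t g base b by (simp add: act_mult)
      then obtain s a k where s: "s \<in> S" "a \<in> carrier F" "k \<in> D" "multiplies k s" "?h = \<psi> a \<otimes> k"
        using stab_pinf_form[OF hc] by blast
      have "t \<otimes> ?h = inv (\<psi> b) \<otimes> g"
        using swap_inverts(1)[OF t] t bc g by (simp add: m_assoc[symmetric])
      hence "g = \<psi> b \<otimes> (t \<otimes> (\<psi> a \<otimes> k))" using s(5) bc g by (simp add: m_assoc[symmetric])
      hence "f = I.mobius_map m b s a" using T_mobius[OF s(1) b(1) s(2-4)] g(2) by simp
      thus ?thesis using I.mobius_map_mem[OF minus_m_S _ s(1) b(1) s(2)] m_nonzero by simp
    qed
  qed
  show "I.S_transformations \<subseteq> T ` carrier G"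
  proof
    fix f assume f: "f \<in> I.S_transformations"
    have mc: "m \<in> carrier F" using m_nonzero by simp
    from I.S_transformations_cases[OF f minus_m_S mc] show "f \<in> T ` carrier G"
    proof
      assume "\<exists>s\<in>S. \<exists>e\<in>carrier F. f = I.affine_map s e"
      then obtain s e where s: "s \<in> S" "e \<in> carrier F" "f = I.affine_map s e" by blast
      obtain g where g: "g \<in> D" "multiplies g s" using S_elt[OF s(1)] by blast
      have "\<psi> e \<otimes> g \<in> carrier G" using psi_carrier[OF s(2)] D_carrier[OF g(1)] by simp
      thus ?thesis unfolding s(3) T_affine[OF s(1,2) g, symmetric] by (rule imageI)
    next
      assume "\<exists>b\<in>carrier F. \<exists>s\<in>S. \<exists>a\<in>carrier F. f = I.mobius_map m b s a"
      then obtain b s a where s: "s \<in> S" "b \<in> carrier F" "a \<in> carrier F" "f = I.mobius_map m b s a" by blast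
      obtain g where g: "g \<in> D" "multiplies g s" using S_elt[OF s(1)] by blast
      have "\<psi> b \<otimes> (t \<otimes> (\<psi> a \<otimes> g)) \<in> carrier G"
        using psi_carrier[OF s(2)] psi_carrier[OF s(3)] D_carrier[OF g(1)] t by simp
      thus ?thesis unfolding s(4) T_mobius[OF s(1-3) g, symmetric] by (rule imageI)
    qed
  qed
qed

end

section \<open>The isomorphism onto \<open>PSL2\<close> or \<open>PGL2\<close>\<close>

context zassenhaus_coordinates
begin

lemma T_Bij: "g \<in> carrier G \<Longrightarrow> T g \<in> Bij (proj_line F)"
proof -
  assume g: "g \<in> carrier G"
  have gE: "bij_betw (\<phi> g) E E" using bij_prop0[OF g] by (simp add: Bij_def)
  have "bij_betw (\<lambda>y. coord (\<phi> g (inv_into E coord y))) (proj_line F) (proj_line F)"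
    using bij_betw_trans[OF bij_betw_trans[OF bij_betw_inv_into[OF coord_bij] gE] coord_bij] by (simp add: comp_def)
  hence "bij_betw (T g) (proj_line F) (proj_line F)"
    by (rule iffD1[OF bij_betw_cong, rotated]) (simp add: transport_def)
  thus ?thesis by (simp add: Bij_def transport_def)
qed

lemma T_mult:
  assumes g: "g \<in> carrier G" and h: "h \<in> carrier G" shows "T (g \<otimes> h) = compose (proj_line F) (T g) (T h)"
proof (rule extensionalityI)
  show "T (g \<otimes> h) \<in> extensional (proj_line F)" by (simp add: transport_def)
  show "compose (proj_line F) (T g) (T h) \<in> extensional (proj_line F)" by (simp add: compose_def)
  fix y assume y: "y \<in> proj_line F"
  let ?x = "inv_into E coord y"
  have x: "?x \<in> E" using bij_betwE[OF bij_betw_inv_into[OF coord_bij]] y by blast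
  have hx: "\<phi> h ?x \<in> E" using h x by simp
  have c: "coord (\<phi> h ?x) \<in> proj_line F" using bij_betwE[OF coord_bij] hx by blast
  have "inv_into E coord (coord (\<phi> h ?x)) = \<phi> h ?x"
    using inv_into_f_f[OF bij_betw_imp_inj_on[OF coord_bij] hx] .
  thus "T (g \<otimes> h) y = compose (proj_line F) (T g) (T h) y"
    using y c act_mult[OF g h x] by (simp add: transport_def compose_def)
qed

lemma T_inj: "inj_on T (carrier G)"
proof (rule inj_onI)
  fix g h assume g: "g \<in> carrier G" and h: "h \<in> carrier G" and eq: "T g = T h"
  have eqE: "\<phi> g y = \<phi> h y" if y: "y \<in> E" for y
  proof -
    have "coord y \<in> proj_line F" using bij_betwE[OF coord_bij] y by blast
    moreover have "inv_into E coord (coord y) = y" using inv_into_f_f[OF bij_betw_imp_inj_on[OF coord_bij] y] .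
    ultimately have "coord (\<phi> g y) = coord (\<phi> h y)" using fun_cong[OF eq, of "coord y"] by (simp add: transport_def)
    thus ?thesis using inj_onD[OF bij_betw_imp_inj_on[OF coord_bij]] g h y by simp
  qed
  have fx: "\<phi> (inv h \<otimes> g) y = y" if "y \<in> E" for y using act_mult[of "inv h" g y] eqE[OF that] g h that by simp
  have "inv h \<otimes> g \<in> D" using fx base g h by (simp add: stab_iff)
  moreover have "\<phi> (inv h \<otimes> g) (pt \<one>\<^bsub>F\<^esub>) = pt \<one>\<^bsub>F\<^esub>" using fx pt_E by simp
  ultimately have "inv h \<otimes> g = \<one>" using fixes_three by blast
  hence "h \<otimes> (inv h \<otimes> g) = h" using h by simp
  thus "g = h" using g h by (simp add: m_assoc[symmetric])
qed

lemma T_iso: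
  assumes L: "L = BijGroup (proj_line F)\<lparr>carrier := T ` carrier G\<rparr>"
  shows "G \<cong> L"
proof -
  have "T \<in> iso G L"
  proof (rule isoI)
    show "T \<in> hom G L"
    proof (rule homI)
      show "T g \<in> carrier L" if "g \<in> carrier G" for g using that by (simp add: L)
      show "T (g \<otimes> h) = T g \<otimes>\<^bsub>L\<^esub> T h" if "g \<in> carrier G" "h \<in> carrier G" for g h
        using T_mult[OF that] T_Bij[OF that(1)] T_Bij[OF that(2)] by (simp add: L BijGroup_def)
    qed
    show "bij_betw T (carrier G) (carrier L)" using T_inj by (simp add: L bij_betw_def)
  qed
  thus ?thesis by (auto simp: is_iso_def)
qed

lemma recognition:
  "\<exists>L\<in>{PSL2 F, PGL2 F}. G \<cong> L \<and> T ` carrier G = carrier L"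
proof -
  from c(2) show ?thesis
  proof
    assume "c = 1"
    hence e: "T ` carrier G = carrier (PGL2 F)" using T_image I.S_transformations_eq(1) by metis
    have "PGL2 F = BijGroup (proj_line F)\<lparr>carrier := T ` carrier G\<rparr>" unfolding e by (simp add: PGL2_def)
    thus ?thesis using T_iso e by blast
  next
    assume "c = 2"
    hence e: "T ` carrier G = carrier (PSL2 F)" using T_image I.S_transformations_eq(2) by metis
    have "PSL2 F = BijGroup (proj_line F)\<lparr>carrier := T ` carrier G\<rparr>" unfolding e by (simp add: PSL2_def)
    thus ?thesis using T_iso e by blast
  qed
qed

end

theorem (in zassenhaus_action) zassenhaus_recognition:
  "\<exists>F :: nat ring. field F \<and> finite (carrier F) \<and> card (carrier F) = q \<and>
     (\<exists>L\<in>{PSL2 F, PGL2 F}. G \<cong> L \<and>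
       (\<exists>\<beta>. bij_betw \<beta> E (proj_line F) \<and>
         (\<forall>g\<in>carrier G. transport \<beta> E (proj_line F) (\<phi> g) \<in> carrier (PGL2 F)) \<and>
         (\<lambda>g. transport \<beta> E (proj_line F) (\<phi> g)) ` carrier G = carrier L))"
proof -
  obtain R :: "nat ring" and \<psi> where R: "field R" "bij_betw \<psi> (carrier R) K"
    "\<And>x y. x \<in> carrier R \<Longrightarrow> y \<in> carrier R \<Longrightarrow> \<psi> (x \<oplus>\<^bsub>R\<^esub> y) = \<psi> x \<otimes> \<psi> y"
    "\<And>g. g \<in> D \<Longrightarrow> \<exists>s\<in>carrier R. \<forall>x\<in>carrier R. \<psi> (s \<otimes>\<^bsub>R\<^esub> x) = conj_by g (\<psi> x)"
    using coordinate_field by blast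
  obtain t where t: "t \<in> carrier G" "\<phi> t pinf = p0" "\<phi> t p0 = pinf" using swap_exists by blast
  interpret C: zassenhaus_coordinates G E \<phi> q d c pinf p0 R \<psi> t
    by (intro zassenhaus_coordinates.intro zassenhaus_coordinates_axioms.intro zassenhaus_action_axioms R t)
  have "card (carrier R) = q" using bij_betw_same_card[OF R(2)] card_K by simp
  moreover have "finite (carrier R)" using C.I.finite_field .
  moreover obtain L where L: "L \<in> {PSL2 R, PGL2 R}" "G \<cong> L"
      "(\<lambda>g. transport C.coord E (proj_line R) (\<phi> g)) ` carrier G = carrier L"
    using C.recognition by blast
  moreover have "\<forall>g\<in>carrier G. transport C.coord E (proj_line R) (\<phi> g) \<in> carrier (PGL2 R)"
    using C.T_image C.I.S_transformations_PGL2 by blast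
  ultimately show ?thesis using R(1) C.coord_bij by blast
qed

section \<open>Restriction to the orbit of length \<open>k + 1\<close>\<close>

lemma (in group_action) restrict_action:
  assumes X: "X \<subseteq> E" "\<And>g x. g \<in> carrier G \<Longrightarrow> x \<in> X \<Longrightarrow> \<phi> g x \<in> X"
  shows "group_action G X (\<lambda>g. restrict (\<phi> g) X)"
proof -
  interpret group G using group_hom group_hom.axioms(1) by auto
  have xE: "x \<in> E" if "x \<in> X" for x using X that by blast
  have bij: "bij_betw (\<phi> g) X X" if g: "g \<in> carrier G" for g
  proof (rule bij_betwI[where g = "\<phi> (inv g)"])
    show "\<phi> (inv g) (\<phi> g x) = x" if "x \<in> X" for x using orbit_sym_aux[OF g xE[OF that]] by simp
    show "\<phi> g (\<phi> (inv g) x) = x" if "x \<in> X" for x using orbit_sym_aux[of "inv g", OF _ xE[OF that]] g by simp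
  qed (use X g in auto)
  have B: "restrict (\<phi> g) X \<in> Bij X" if "g \<in> carrier G" for g
    using bij[OF that] by (simp add: Bij_def)
  show ?thesis
  proof (intro group_action.intro group_hom.intro group_hom_axioms.intro is_group group_BijGroup homI)
    show "restrict (\<phi> g) X \<in> carrier (BijGroup X)" if "g \<in> carrier G" for g using B[OF that] by (simp add: BijGroup_def)
    show "restrict (\<phi> (g \<otimes> h)) X = restrict (\<phi> g) X \<otimes>\<^bsub>BijGroup X\<^esub> restrict (\<phi> h) X"
      if g: "g \<in> carrier G" and h: "h \<in> carrier G" for g h
    proof -
      have "restrict (\<phi> (g \<otimes> h)) X = compose X (restrict (\<phi> g) X) (restrict (\<phi> h) X)"
        using composition_rule[OF xE g h] X(2)[OF h] by (auto simp: compose_def fun_eq_iff restrict_def)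
      thus ?thesis using B[OF g] B[OF h] by (simp add: BijGroup_def)
    qed
  qed
qed

context one_or_two_fixed_points
begin

lemma swap_involution:
  assumes g: "g \<in> carrier G" and xy: "x \<in> E" "y \<in> E" "x \<noteq> y" "\<phi> g x = y" "\<phi> g y = x"
  shows "g \<otimes> g = \<one>"
proof (rule ccontr)
  assume n: "g \<otimes> g \<noteq> \<one>"
  hence "g \<noteq> \<one>" using g by auto
  then obtain w where w: "w \<in> E" "\<phi> g w = w" using fixed_point g by blast
  have "g \<otimes> g \<in> stab x" "g \<otimes> g \<in> stab y" "g \<otimes> g \<in> stab w" using g xy w by (auto simp: stab_iff act_mult)
  hence "w = x \<or> w = y" using third_fixed_point n xy w by blast
  thus False using w xy by auto
qed

text \<open>If \<open>y\<close> has a partner, its \<open>k\<close> partners lie in the orbit, which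
  offers just \<open>k\<close> points besides \<open>y\<close>; hence \<open>z\<close> is one of
  them. Otherwise both sides are 1.\<close>

lemma card_stab2_orbit:
  assumes x: "x \<in> E" and closed: "\<And>u v. u \<in> orbit G \<phi> x \<Longrightarrow> partner u v \<Longrightarrow> v \<in> orbit G \<phi> x"
    and o: "card (orbit G \<phi> x) = kernel_order x + 1"
    and yz: "y \<in> orbit G \<phi> x" "z \<in> orbit G \<phi> x" "y \<noteq> z"
  shows "card (stab y \<inter> stab z) = comp_order x"
proof -
  have E: "y \<in> E" "z \<in> E" using yz orbit_subset[OF x] by auto
  have cy: "comp_order y = comp_order x" "kernel_order y = kernel_order x" using orbit_orders[OF x yz(1)] by auto
  show ?thesis
  proof (cases "\<exists>w. partner y w")
    case True
    then obtain w where w: "partner y w" by blast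
    have wE: "w \<in> E" "y \<noteq> w" "w \<in> orbit G \<phi> x" using w closed[OF yz(1)] by (auto simp: partner_def)
    have "complement_orbit y w \<subseteq> orbit G \<phi> x - {y}"
      using complement_orbit_subset[OF E(1) wE(1,2)] act_mem_orbit[OF x wE(3)] stab_carrier
      unfolding complement_orbit_def by blast
    moreover have "card (complement_orbit y w) = card (orbit G \<phi> x - {y})"
      using kernel_order_partner[OF w] cy o yz by (simp add: card_Diff_singleton)
    ultimately have "complement_orbit y w = orbit G \<phi> x - {y}"
      using finite_orbit by (intro card_subset_eq) auto
    hence "z \<in> complement_orbit y w" using yz by blast
    thus ?thesis using card_stab2_complement_orbit[OF E(1) wE(1)] comp_order_partner[OF w] cy by simp
  next
    case False
    hence "comp_order y = 1" by (simp add: comp_order_def)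
    moreover have "stab y \<inter> stab z = {\<one>}" using False E yz by (auto simp: partner_def)
    ultimately show ?thesis using cy by simp
  qed
qed

lemma zassenhaus_case:
  assumes x: "x \<in> nonregular_points" and y: "y \<in> nonregular_points"
    and N: "nonregular_orbits G E \<phi> = {orbit G \<phi> x, orbit G \<phi> y}" "orbit G \<phi> x \<noteq> orbit G \<phi> y"
    and ul: "\<not> linked x y" and c: "c = 1 \<or> c = 2" "c * comp_order x = kernel_order x - 1"
    and cy: "c * card (stab y) = kernel_order x + 1"
    and k: "kernel_order x \<ge> 3" and o: "card (orbit G \<phi> x) = kernel_order x + 1"
  shows "\<exists>F :: nat ring. field F \<and> finite (carrier F) \<and>
       (\<exists>L \<in> {PSL2 F, PGL2 F}. G \<cong> L \<and>
         (\<exists>\<Gamma> \<in> nonregular_orbits G E \<phi>.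
           (\<exists>\<beta>. bij_betw \<beta> \<Gamma> (proj_line F) \<and>
              (\<forall>g \<in> carrier G. transport \<beta> \<Gamma> (proj_line F) (\<phi> g) \<in> carrier (PGL2 F)) \<and>
              faithful_action G \<Gamma> (\<lambda>g. restrict (\<phi> g) \<Gamma>) \<and>
              (\<lambda>g. transport \<beta> \<Gamma> (proj_line F) (\<phi> g)) ` carrier G = carrier L) \<and>
           (\<exists>\<Delta>. nonregular_orbits G E \<phi> - {\<Gamma>} = {\<Delta>} \<and>
              card \<Delta> = card (carrier F) * (card (carrier F) - 1))))"
proof -
  let ?\<Gamma> = "orbit G \<phi> x" and ?\<phi> = "\<lambda>g. restrict (\<phi> g) (orbit G \<phi> x)"
  have xE: "x \<in> E" and yE: "y \<in> E" using x y by (auto simp: nonregular_points_def)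
  have GE: "u \<in> E" if "u \<in> ?\<Gamma>" for u using orbit_subset[OF xE] that by blast
  have Gact: "\<phi> g u \<in> ?\<Gamma>" if "g \<in> carrier G" "u \<in> ?\<Gamma>" for g u using act_mem_orbit[OF xE that(2,1)] .
  have closed: "v \<in> ?\<Gamma>" if uv: "u \<in> ?\<Gamma>" "partner u v" for u v
  proof -
    have vE: "v \<in> E" using uv(2) by (simp add: partner_def)
    have "v \<in> nonregular_points" using partner_sym[OF uv(2)] by (auto simp: partner_def nonregular_points_def)
    hence "orbit G \<phi> v \<in> {?\<Gamma>, orbit G \<phi> y}" using N nonregular_orbits_eq by blast
    hence "orbit G \<phi> v = ?\<Gamma> \<or> orbit G \<phi> v = orbit G \<phi> y" by simp
    hence "v \<in> ?\<Gamma> \<or> v \<in> orbit G \<phi> y" using orbit_refl[OF vE] by metis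
    thus ?thesis using ul uv by (auto simp: linked_def)
  qed
  have s2: "card (stab u \<inter> stab v) = comp_order x" if "u \<in> ?\<Gamma>" "v \<in> ?\<Gamma>" "u \<noteq> v" for u v
    by (rule card_stab2_orbit[OF xE closed o that])
  have stab_eq: "stabilizer G ?\<phi> u = stab u" if "u \<in> ?\<Gamma>" for u
    by (simp only: stabilizer_def restrict_apply'[OF that])
  have act: "group_action G ?\<Gamma> ?\<phi>"
    by (rule restrict_action[OF orbit_subset[OF xE] Gact])
  obtain p where p: "p \<in> ?\<Gamma>" "p \<noteq> x"
  proof -
    have "\<not> ?\<Gamma> \<subseteq> {x}" using o k card_mono[of "{x}" ?\<Gamma>] by auto
    thus ?thesis using that by blast
  qed
  have xx: "x \<in> ?\<Gamma>" using orbit_refl[OF xE] .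
  interpret Z: zassenhaus_action G ?\<Gamma> ?\<phi> "kernel_order x" "comp_order x" c x p
  proof (intro zassenhaus_action.intro two_fixed_points.intro finite_action.intro act
      finite_action_axioms.intro two_fixed_points_axioms.intro zassenhaus_action_axioms.intro)
    show "finite (carrier G)" by (rule fin)
    show "u = v \<or> v = w \<or> u = w" if "g \<in> carrier G" "g \<noteq> \<one>" "u \<in> ?\<Gamma>" "v \<in> ?\<Gamma>" "w \<in> ?\<Gamma>"
        "?\<phi> g u = u" "?\<phi> g v = v" "?\<phi> g w = w" for g u v w
      using two[of g u v w] that GE by simp
    show "card (stabilizer G ?\<phi> u) = kernel_order x * comp_order x" if "u \<in> ?\<Gamma>" for u
      using orbit_orders(3)[OF xE that] kernel_comp_order[OF xE] stab_eq[OF that] by simp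
    show "card (stabilizer G ?\<phi> u \<inter> stabilizer G ?\<phi> v) = comp_order x" if "u \<in> ?\<Gamma>" "v \<in> ?\<Gamma>" "u \<noteq> v" for u v
      using s2[OF that] stab_eq that by simp
    show "g \<otimes> g = \<one>" if "g \<in> carrier G" "u \<in> ?\<Gamma>" "v \<in> ?\<Gamma>" "u \<noteq> v" "?\<phi> g u = v" "?\<phi> g v = u" for g u v
      using swap_involution[of g u v] that GE by simp
  qed (use o k c p xx in auto)
  obtain F :: "nat ring" and L \<beta> where F: "field F" "finite (carrier F)" "card (carrier F) = kernel_order x"
    and L: "L \<in> {PSL2 F, PGL2 F}" "G \<cong> L" and b: "bij_betw \<beta> ?\<Gamma> (proj_line F)"
    and t: "\<forall>g\<in>carrier G. transport \<beta> ?\<Gamma> (proj_line F) (?\<phi> g) \<in> carrier (PGL2 F)"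
      "(\<lambda>g. transport \<beta> ?\<Gamma> (proj_line F) (?\<phi> g)) ` carrier G = carrier L"
    using Z.zassenhaus_recognition by blast
  have tr: "transport \<beta> ?\<Gamma> (proj_line F) (?\<phi> g) = transport \<beta> ?\<Gamma> (proj_line F) (\<phi> g)" for g
    unfolding transport_def
  proof (rule restrict_ext)
    fix u assume "u \<in> proj_line F"
    hence "inv_into ?\<Gamma> \<beta> u \<in> ?\<Gamma>" using bij_betwE[OF bij_betw_inv_into[OF b]] by blast
    thus "\<beta> (?\<phi> g (inv_into ?\<Gamma> \<beta> u)) = \<beta> (\<phi> g (inv_into ?\<Gamma> \<beta> u))" by simp
  qed
  have faithful: "faithful_action G ?\<Gamma> ?\<phi>"
  proof (intro faithful_action.intro act faithful_action_axioms.intro inj_onI)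
    fix g h assume g: "g \<in> carrier G" and h: "h \<in> carrier G" and eq: "?\<phi> g = ?\<phi> h"
    have fx: "inv h \<otimes> g \<in> stab u" if u: "u \<in> ?\<Gamma>" for u
    proof -
      have "\<phi> g u = \<phi> h u" using fun_cong[OF eq, of u] u by simp
      thus ?thesis using g h GE[OF u] act_mult[of "inv h" g u] by (simp add: stab_iff)
    qed
    obtain w where w: "w \<in> ?\<Gamma>" "w \<noteq> x" "w \<noteq> p"
    proof -
      have "\<not> ?\<Gamma> \<subseteq> {x, p}" using o k card_mono[of "{x, p}" ?\<Gamma>] p by auto
      thus ?thesis using that by blast
    qed
    have "inv h \<otimes> g = \<one>"
      using third_fixed_point[OF fx[OF xx] fx[OF p(1)] fx[OF w(1)]] GE xx p w by metis
    hence "h \<otimes> (inv h \<otimes> g) = h" using h by simp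
    thus "g = h" using g h by (simp add: m_assoc[symmetric])
  qed
  have "card (orbit G \<phi> y) = kernel_order x * (kernel_order x - 1)"
  proof -
    let ?k = "kernel_order x" and ?d = "comp_order x"
    have "card (orbit G \<phi> y) * card (stab y) = (?k + 1) * (?k * ?d)"
      using card_orbit[OF yE] card_orbit[OF xE] kernel_comp_order[OF xE] o by simp
    \<comment> \<open>The factor \<open>c\<close> makes room for both hypotheses,
      \<open>c e = k + 1\<close> and \<open>c d = k - 1\<close>, after which \<open>k + 1\<close>
      cancels.\<close>
    hence "c * (card (orbit G \<phi> y) * card (stab y)) = c * ((?k + 1) * (?k * ?d))" by simp
    hence "card (orbit G \<phi> y) * (c * card (stab y)) = (?k + 1) * (?k * (c * ?d))" by (simp only: ac_simps)
    hence "(?k + 1) * card (orbit G \<phi> y) = (?k + 1) * (?k * (?k - 1))" unfolding cy c(2) by (simp only: ac_simps)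
    thus ?thesis by (metis add_is_0 mult_cancel1 one_neq_zero)
  qed
  moreover have "nonregular_orbits G E \<phi> - {?\<Gamma>} = {orbit G \<phi> y}" using N by auto
  ultimately have D: "\<exists>\<Delta>. nonregular_orbits G E \<phi> - {?\<Gamma>} = {\<Delta>} \<and> card \<Delta> = card (carrier F) * (card (carrier F) - 1)"
    using F(3) by simp
  have B: "\<exists>\<beta>. bij_betw \<beta> ?\<Gamma> (proj_line F) \<and>
              (\<forall>g \<in> carrier G. transport \<beta> ?\<Gamma> (proj_line F) (\<phi> g) \<in> carrier (PGL2 F)) \<and>
              faithful_action G ?\<Gamma> (\<lambda>g. restrict (\<phi> g) ?\<Gamma>) \<and>
              (\<lambda>g. transport \<beta> ?\<Gamma> (proj_line F) (\<phi> g)) ` carrier G = carrier L"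
    using b t faithful unfolding tr by blast
  have G: "?\<Gamma> \<in> nonregular_orbits G E \<phi>" using N by blast
  show ?thesis
    by (rule exI[of _ F], intro conjI F(1,2), rule bexI[OF _ L(1)], intro conjI L(2), rule bexI[OF _ G], intro conjI B D)
qed

end

section \<open>Recognition of symmetric and alternating groups\<close>

context group
begin

lemma subgroup_pow_card:
  assumes H: "subgroup H G" and fin: "finite H" and g: "g \<in> H"
  shows "g [^] card H = \<one>"
proof -
  interpret H: group "G\<lparr>carrier := H\<rparr>" using subgroup_imp_group[OF H] .
  have "g [^]\<^bsub>G\<lparr>carrier := H\<rparr>\<^esub> order (G\<lparr>carrier := H\<rparr>) = \<one>\<^bsub>G\<lparr>carrier := H\<rparr>\<^esub>"
    using H.pow_order_eq_1[of g] g by simp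
  thus ?thesis by (simp add: order_def nat_pow_consistent[symmetric])
qed

lemma odd_pow_square:
  assumes g: "g \<in> carrier G" and n: "g [^] (n::nat) = \<one>" "odd n"
  shows "\<exists>h\<in>carrier G. g = h \<otimes> h"
proof -
  obtain j where j: "n = 2 * j + 1" using n by (auto elim: oddE)
  have "g [^] (j + 1) \<otimes> g [^] (j + 1) = g [^] ((j + 1) + (j + 1))" by (simp only: nat_pow_mult[OF g])
  also have "(j + 1) + (j + 1) = n + 1" using j by simp
  also have "g [^] (n + 1) = g [^] n \<otimes> g" by simp
  also have "\<dots> = g" using g n by simp
  finally show ?thesis using g by (metis nat_pow_closed)
qed

text \<open>Works for sets of points as well as for points, since \<open>X\<close> and
  \<open>a\<close> are arbitrary. The points are numbered from 1 to \<open>m\<close>, and the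
  permutations are continued by the identity, because \<open>sym_group m\<close> consists of
  permutations of the naturals supported on these numbers.\<close>

lemma faithful_embedding:
  assumes fin: "finite X" and m: "card X = m"
    and cl: "\<And>g x. g \<in> carrier G \<Longrightarrow> x \<in> X \<Longrightarrow> a g x \<in> X"
    and mul: "\<And>g h x. g \<in> carrier G \<Longrightarrow> h \<in> carrier G \<Longrightarrow> x \<in> X \<Longrightarrow> a (g \<otimes> h) x = a g (a h x)"
    and one: "\<And>x. x \<in> X \<Longrightarrow> a \<one> x = x"
    and faith: "\<And>g. g \<in> carrier G \<Longrightarrow> (\<And>x. x \<in> X \<Longrightarrow> a g x = x) \<Longrightarrow> g = \<one>"
  shows "\<exists>f\<in>hom G (sym_group m). inj_on f (carrier G)"
proof -
  obtain b where b: "bij_betw b {1..m} X" using ex_bij_betw_nat_finite_1[OF fin] m by blast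
  let ?b' = "inv_into {1..m} b"
  have b': "bij_betw ?b' X {1..m}" by (rule bij_betw_inv_into[OF b])
  have bb: "b (?b' x) = x" if "x \<in> X" for x using bij_betw_inv_into_right[OF b that] .
  have bX: "b i \<in> X" if "i \<in> {1..m}" for i using bij_betwE[OF b] that by blast
  have b'm: "?b' x \<in> {1..m}" if "x \<in> X" for x using bij_betwE[OF b'] that by blast
  define f where "f g i = (if i \<in> {1..m} then ?b' (a g (b i)) else i)" for g i
  have f_in: "f g i = ?b' (a g (b i))" if "i \<in> {1..m}" for g i using that unfolding f_def by (rule if_P)
  have f_out: "f g i = i" if "i \<notin> {1..m}" for g i using that unfolding f_def by (rule if_not_P)
  have fm: "f g i \<in> {1..m}" if "g \<in> carrier G" "i \<in> {1..m}" for g i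
    unfolding f_in[OF that(2)] using b'm[OF cl[OF that(1) bX[OF that(2)]]] .
  have bf: "b (f g i) = a g (b i)" if "g \<in> carrier G" "i \<in> {1..m}" for g i
    unfolding f_in[OF that(2)] using bb[OF cl[OF that(1) bX[OF that(2)]]] .
  have f_mult: "f (g \<otimes> h) i = f g (f h i)" if "g \<in> carrier G" "h \<in> carrier G" for g h i
  proof (cases "i \<in> {1..m}")
    case True
    have "f g (f h i) = ?b' (a g (b (f h i)))" by (rule f_in[OF fm[OF that(2) True]])
    also have "\<dots> = ?b' (a (g \<otimes> h) (b i))" by (simp only: bf[OF that(2) True] mul[OF that bX[OF True]])
    also have "\<dots> = f (g \<otimes> h) i" by (rule f_in[OF True, symmetric])
    finally show ?thesis ..
  next
    case False thus ?thesis by (simp only: f_out not_False_eq_True)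
  qed
  have f_one: "f \<one> i = i" for i
  proof (cases "i \<in> {1..m}")
    case True
    thus ?thesis by (simp only: f_in[OF True] one[OF bX[OF True]] bij_betw_inv_into_left[OF b True])
  qed (rule f_out)
  have perm: "f g permutes {1..m}" if g: "g \<in> carrier G" for g
  proof (rule bij_imp_permutes)
    show "bij_betw (f g) {1..m} {1..m}"
    proof (rule bij_betwI[where g = "f (inv g)"])
      show "f (inv g) (f g i) = i" for i using f_mult[of "inv g" g i] f_one g by simp
      show "f g (f (inv g) i) = i" for i using f_mult[of g "inv g" i] f_one g by simp
    qed (use fm g in auto)
    show "f g i = i" if "i \<notin> {1..m}" for i by (rule f_out[OF that])
  qed
  have "f \<in> hom G (sym_group m)"
  proof (rule homI)
    show "f g \<in> carrier (sym_group m)" if "g \<in> carrier G" for g using perm[OF that] by (simp add: sym_group_carrier)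
    show "f (g \<otimes> h) = f g \<otimes>\<^bsub>sym_group m\<^esub> f h" if "g \<in> carrier G" "h \<in> carrier G" for g h
      using f_mult[OF that] by (auto simp: sym_group_mult)
  qed
  moreover have "inj_on f (carrier G)"
  proof (rule inj_onI)
    fix g h assume g: "g \<in> carrier G" and h: "h \<in> carrier G" and eq: "f g = f h"
    have "inv h \<otimes> g = \<one>"
    proof (rule faith)
      fix x assume x: "x \<in> X"
      have "a g (b (?b' x)) = a h (b (?b' x))"
        using bf[OF g b'm[OF x]] bf[OF h b'm[OF x]] eq by simp
      hence "a g x = a h x" using bb[OF x] by simp
      thus "a (inv h \<otimes> g) x = x" using mul[of "inv h" g x] mul[of "inv h" h x] one[OF x] g h x by simp
    qed (use g h in simp)
    hence "h \<otimes> (inv h \<otimes> g) = h" using h by simp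
    thus "g = h" using g h by (simp add: m_assoc[symmetric])
  qed
  ultimately show ?thesis by blast
qed

lemma iso_sym_group:
  assumes f: "f \<in> hom G (sym_group m)" "inj_on f (carrier G)" and o: "order G = fact m"
  shows "G \<cong> sym_group m"
proof -
  have "f ` carrier G = carrier (sym_group m)"
  proof (rule card_subset_eq)
    show "finite (carrier (sym_group m))" using sym_group_card_carrier[of m] by (metis card.infinite fact_nonzero)
    show "f ` carrier G \<subseteq> carrier (sym_group m)" using f(1) by (auto simp: hom_def)
    show "card (f ` carrier G) = card (carrier (sym_group m))"
      using card_image[OF f(2)] o sym_group_card_carrier by (simp add: order_def)
  qed
  hence "f \<in> iso G (sym_group m)" using f by (simp add: iso_def bij_betw_def)
  thus ?thesis by (auto simp: is_iso_def)
qed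

text \<open>The elements mapped to even permutations form a subgroup containing all squares, hence
  more than half of \<open>G\<close>, hence everything. Comparison of orders gives surjectivity onto
  the alternating group.\<close>

lemma iso_alt_group:
  assumes f: "f \<in> hom G (sym_group m)" "inj_on f (carrier G)" and o: "2 * order G = fact m" and m: "m \<ge> 2"
    and sq: "2 * card {g \<in> carrier G. \<exists>h\<in>carrier G. g = h \<otimes> h} > order G"
  shows "G \<cong> alt_group m"
proof -
  have o0: "order G > 0" using o by (metis fact_nonzero mult_0_right neq0_conv)
  hence fin: "finite (carrier G)" by (metis card.infinite less_irrefl order_def)
  let ?A = "{g \<in> carrier G. evenperm (f g)}"
  have perm: "permutation (f g)" if "g \<in> carrier G" for g
    using f(1) that sym_group_carrier' by (auto simp: hom_def)
  have fmul: "f (g \<otimes> h) = f g \<circ> f h" if "g \<in> carrier G" "h \<in> carrier G" for g h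
    using f(1) that by (simp add: hom_def sym_group_mult)
  have fone: "f \<one> = id"
  proof -
    interpret h: group_hom G "sym_group m" f
      by (intro group_hom.intro is_group sym_group_is_group group_hom_axioms.intro f(1))
    show ?thesis using h.hom_one by (simp add: sym_group_one)
  qed
  have ev: "evenperm (f (g \<otimes> h)) \<longleftrightarrow> (evenperm (f g) = evenperm (f h))" if "g \<in> carrier G" "h \<in> carrier G" for g h
    using fmul[OF that] evenperm_comp[OF perm[OF that(1)] perm[OF that(2)]] by simp
  have evone: "evenperm (f \<one>)" using fone by simp
  have A: "subgroup ?A G"
  proof (rule subgroupI)
    show "inv g \<in> ?A" if "g \<in> ?A" for g using ev[of "inv g" g] that evone by auto
    show "g \<otimes> h \<in> ?A" if "g \<in> ?A" "h \<in> ?A" for g h using ev[of g h] that by auto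
  qed (use evone in auto)
  have "{g \<in> carrier G. \<exists>h\<in>carrier G. g = h \<otimes> h} \<subseteq> ?A" using ev by auto
  hence "card {g \<in> carrier G. \<exists>h\<in>carrier G. g = h \<otimes> h} \<le> card ?A" using fin by (intro card_mono) auto
  hence "order G < 2 * card ?A" using sq by linarith
  moreover obtain j where "order G = card ?A * j" using lagrange[OF A] by (metis mult.commute)
  ultimately have "j = 1" using o0 by (cases j; cases "j - 1") auto
  hence "card ?A = card (carrier G)" using \<open>order G = card ?A * j\<close> by (simp add: order_def)
  hence A_eq: "?A = carrier G" using fin by (intro card_subset_eq) auto
  have "f ` carrier G = carrier (alt_group m)"
  proof (rule card_subset_eq)
    have c: "2 * card (carrier (alt_group m)) = fact m" using alt_group_card_carrier[OF m] .
    thus "finite (carrier (alt_group m))" by (metis card.infinite fact_nonzero mult_0_right)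
    show "f ` carrier G \<subseteq> carrier (alt_group m)"
    proof
      fix p assume "p \<in> f ` carrier G"
      then obtain g where g: "g \<in> carrier G" "p = f g" by blast
      have "p \<in> carrier (sym_group m)" using f(1) g by (auto simp: hom_def)
      moreover have "evenperm p" using A_eq g by blast
      ultimately show "p \<in> carrier (alt_group m)" by (simp only: alt_group_carrier sym_group_carrier)
    qed
    show "card (f ` carrier G) = card (carrier (alt_group m))"
      using card_image[OF f(2)] o c by (simp add: order_def)
  qed
  moreover have "f \<in> hom G (alt_group m)"
  proof (rule homI)
    show "f g \<in> carrier (alt_group m)" if "g \<in> carrier G" for g using that calculation by blast
    show "f (g \<otimes> h) = f g \<otimes>\<^bsub>alt_group m\<^esub> f h" if "g \<in> carrier G" "h \<in> carrier G" for g h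
      using fmul[OF that] by (simp add: alt_group_mult)
  qed
  ultimately have "f \<in> iso G (alt_group m)" using f by (simp add: iso_def bij_betw_def)
  thus ?thesis by (auto simp: is_iso_def)
qed

definition centralizer where "centralizer t = {g \<in> carrier G. g \<otimes> t = t \<otimes> g}"

lemma centralizer_subgroup: "t \<in> carrier G \<Longrightarrow> subgroup (centralizer t) G"
proof (rule subgroupI)
  assume t: "t \<in> carrier G"
  show "centralizer t \<subseteq> carrier G" by (auto simp: centralizer_def)
  show "centralizer t \<noteq> {}" using t by (auto simp: centralizer_def intro!: exI[of _ \<one>])
  show "inv g \<in> centralizer t" if "g \<in> centralizer t" for g
  proof -
    have g: "g \<in> carrier G" "g \<otimes> t = t \<otimes> g" using that by (auto simp: centralizer_def)
    have "inv g \<otimes> (t \<otimes> g) \<otimes> inv g = inv g \<otimes> (g \<otimes> t) \<otimes> inv g" using g by simp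
    hence "inv g \<otimes> t = t \<otimes> inv g" using g(1) t by (simp add: m_assoc)
    thus ?thesis using g by (simp add: centralizer_def)
  qed
  show "g \<otimes> h \<in> centralizer t" if "g \<in> centralizer t" "h \<in> centralizer t" for g h
  proof -
    have g: "g \<in> carrier G" "g \<otimes> t = t \<otimes> g" "h \<in> carrier G" "h \<otimes> t = t \<otimes> h"
      using that by (auto simp: centralizer_def)
    have "g \<otimes> h \<otimes> t = g \<otimes> (t \<otimes> h)" using g t by (simp add: m_assoc)
    also have "\<dots> = t \<otimes> g \<otimes> h" using g t by (simp add: m_assoc[symmetric])
    finally show ?thesis using g t by (simp add: centralizer_def m_assoc)
  qed
qed

text \<open>The centralizers of involutions are five Klein four-groups with trivial intersections,
  and the group acts faithfully on them by conjugation.\<close>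

lemma iso_alt_group_5:
  assumes o: "order G = 60"
    and ord: "\<And>g. g \<in> carrier G \<Longrightarrow> g [^] (2::nat) = \<one> \<or> g [^] (3::nat) = \<one> \<or> g [^] (5::nat) = \<one>"
    and cI: "card {t \<in> carrier G. t \<noteq> \<one> \<and> t [^] (2::nat) = \<one>} = 15"
    and cC: "\<And>t. t \<in> carrier G \<Longrightarrow> t \<noteq> \<one> \<Longrightarrow> t [^] (2::nat) = \<one> \<Longrightarrow> card (centralizer t) = 4"
  shows "G \<cong> alt_group 5"
proof -
  have fin: "finite (carrier G)" using o by (metis card.infinite order_def zero_neq_numeral)
  define I where "I = {t \<in> carrier G. t \<noteq> \<one> \<and> t [^] (2::nat) = \<one>}"
  have p2: "g [^] (2::nat) = g \<otimes> g" if "g \<in> carrier G" for g using that by (simp add: numeral_2_eq_2)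
  have p3: "g [^] (3::nat) = g \<otimes> g \<otimes> g" if "g \<in> carrier G" for g using that by (simp add: numeral_3_eq_3)
  have p4: "g [^] (4::nat) = g [^] (2::nat) \<otimes> g [^] (2::nat)" if "g \<in> carrier G" for g
    using that nat_pow_mult[of g 2 2] by simp
  have p5: "g [^] (5::nat) = g [^] (4::nat) \<otimes> g" if "g \<in> carrier G" for g
    using that nat_pow_mult[of g 4 1] by simp
  have p4': "g [^] (4::nat) = g [^] (3::nat) \<otimes> g" if "g \<in> carrier G" for g
    using that nat_pow_mult[of g 3 1] by simp
  have I: "t \<in> carrier G" "t \<noteq> \<one>" "t \<otimes> t = \<one>" if "t \<in> I" for t using that p2 by (auto simp: I_def)
  have Iinv: "inv t = t" if "t \<in> I" for t using I[OF that] inv_equality by blast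
  define W where "W t = centralizer t - {\<one>}" for t
  have C4: "card (centralizer t) = 4" if "t \<in> I" for t using that cC by (simp add: I_def)
  have Csub: "subgroup (centralizer t) G" if "t \<in> I" for t using centralizer_subgroup I(1)[OF that] .
  have Cc: "g \<in> carrier G" if "g \<in> centralizer t" for g t using that by (simp add: centralizer_def)
  \<comment> \<open>The exponent 4 is coprime to 3 and to 5, so \<open>ord\<close> leaves exponent
    two for the elements of a group of order four.\<close>
  have C2: "g \<otimes> g = \<one>" if t: "t \<in> I" and g: "g \<in> centralizer t" for t g
  proof -
    have gc: "g \<in> carrier G" using Cc[OF g] .
    have "finite (centralizer t)" using C4[OF t] by (metis card.infinite zero_neq_numeral)
    hence g4: "g [^] (4::nat) = \<one>" using subgroup_pow_card[OF Csub[OF t] _ g] C4[OF t] by simp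
    have "g [^] (3::nat) = \<one> \<Longrightarrow> g = \<one>" using g4 p4'[OF gc] gc by simp
    moreover have "g [^] (5::nat) = \<one> \<Longrightarrow> g = \<one>" using g4 p5[OF gc] gc by simp
    ultimately show ?thesis using ord[OF gc] p2[OF gc] by auto
  qed
  have comm: "g \<otimes> h = h \<otimes> g" if t: "t \<in> I" and gh: "g \<in> centralizer t" "h \<in> centralizer t" for t g h
  proof -
    have c: "g \<in> carrier G" "h \<in> carrier G" using Cc gh by auto
    have "g \<otimes> h \<in> centralizer t" using subgroup.m_closed[OF Csub[OF t] gh] .
    hence "inv (g \<otimes> h) = g \<otimes> h" using C2[OF t] c inv_equality by simp
    moreover have "inv g = g" "inv h = h" using C2[OF t] gh c inv_equality by auto
    ultimately show ?thesis using c inv_mult_group by simp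
  qed
  have WI: "W t \<subseteq> I" if "t \<in> I" for t using C2[OF that] Cc p2 by (auto simp: W_def I_def)
  have tW: "t \<in> W t" if "t \<in> I" for t using I[OF that] by (simp add: W_def centralizer_def)
  \<comment> \<open>\<open>centralizer t\<close> is abelian and is thus contained in the centralizer
    of each of its involutions, with equality by order. Consequently the sets \<open>W t\<close> are
    equal or disjoint, and the fifteen involutions form five triples.\<close>
  have Weq: "W u = W t" if t: "t \<in> I" and u: "u \<in> W t" for t u
  proof -
    have uI: "u \<in> I" and uC: "u \<in> centralizer t" using WI[OF t] u by (auto simp: W_def)
    have "centralizer t \<subseteq> centralizer u"
    proof
      fix g assume g: "g \<in> centralizer t"
      show "g \<in> centralizer u" using comm[OF t g uC] Cc[OF g] by (simp add: centralizer_def)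
    qed
    moreover have "finite (centralizer u)" using C4[OF uI] by (metis card.infinite zero_neq_numeral)
    ultimately have "centralizer t = centralizer u" using C4[OF uI] C4[OF t] by (simp add: card_subset_eq)
    thus ?thesis by (simp add: W_def)
  qed
  have cW: "card (W t) = 3" if "t \<in> I" for t
    using C4[OF that] subgroup.one_closed[OF Csub[OF that]] by (simp add: W_def card_Diff_singleton)
  have finI: "finite I" using fin by (simp add: I_def)
  have UW: "\<Union>(W ` I) = I" using WI tW by blast
  have "3 * card (W ` I) = card (\<Union>(W ` I))"
  proof (rule card_partition)
    show "finite (W ` I)" "finite (\<Union>(W ` I))" using finI UW by auto
    show "card c = 3" if "c \<in> W ` I" for c using that cW by blast
    show "c \<inter> c' = {}" if "c \<in> W ` I" "c' \<in> W ` I" "c \<noteq> c'" for c c'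
    proof (rule ccontr)
      assume "c \<inter> c' \<noteq> {}"
      then obtain u where "u \<in> c" "u \<in> c'" by blast
      thus False using that Weq by (metis imageE)
    qed
  qed
  hence c5: "card (W ` I) = 5" using UW cI by (simp add: I_def)
  have conjI: "conj_by g t \<in> I" if g: "g \<in> carrier G" and t: "t \<in> I" for g t
  proof -
    have "conj_by g t \<otimes> conj_by g t = \<one>" using conj_hom[OF g I(1)[OF t] I(1)[OF t]] I(3)[OF t] g by simp
    moreover have "conj_by g t \<noteq> \<one>" using conj_eq_iff[OF g I(1)[OF t] one_closed] I(2)[OF t] g by simp
    ultimately show ?thesis using g I(1)[OF t] p2 by (simp add: I_def)
  qed
  have conjC: "conj_by g h \<in> W (conj_by g t)" if g: "g \<in> carrier G" and t: "t \<in> I" and h: "h \<in> W t" for g t h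
  proof -
    have hI: "h \<in> I" using WI t h by blast
    have "h \<otimes> t = t \<otimes> h" using h by (simp add: W_def centralizer_def)
    hence "conj_by g h \<otimes> conj_by g t = conj_by g t \<otimes> conj_by g h"
      using conj_hom[OF g I(1)[OF hI] I(1)[OF t]] conj_hom[OF g I(1)[OF t] I(1)[OF hI]] by simp
    thus ?thesis using conjI[OF g hI] I by (simp add: W_def centralizer_def)
  qed
  have conjW: "conj_by g ` W t = W (conj_by g t)" if g: "g \<in> carrier G" and t: "t \<in> I" for g t
  proof (rule card_subset_eq)
    show "finite (W (conj_by g t))" using cW[OF conjI[OF g t]] by (metis card.infinite zero_neq_numeral)
    show "conj_by g ` W t \<subseteq> W (conj_by g t)" using conjC[OF g t] by blast
    have "inj_on (conj_by g) (W t)" by (rule inj_on_subset[OF inj_conj[OF g]]) (use WI[OF t] I in blast)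
    thus "card (conj_by g ` W t) = card (W (conj_by g t))" using cW[OF t] cW[OF conjI[OF g t]] card_image by metis
  qed
  define N where "N = {g \<in> carrier G. \<forall>t\<in>I. conj_by g t \<in> W t}"
  \<comment> \<open>\<open>N\<close> is the kernel of the conjugation action on the five triples. If
    an involution \<open>g\<close> were in \<open>N\<close>, then for any triple other than its own
    it would fix no member by conjugation; but the product of \<open>t\<close> and its conjugate by
    \<open>g\<close> is a member that is fixed.\<close>
  have NI: "g \<notin> N" if g: "g \<in> I" for g
  proof
    assume gN: "g \<in> N"
    have gc: "g \<in> carrier G" using I g by blast
    have "card (W ` I) \<noteq> card {W g}" using c5 by simp
    hence "W ` I \<noteq> {W g}" by metis
    then obtain t where t: "t \<in> I" "W t \<noteq> W g" using g by blast
    have gg: "conj_by g (conj_by g x) = x" if "x \<in> carrier G" for x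
      using conj_mult[OF gc gc that] I(3)[OF g] that by simp
    have nofix: "conj_by g x \<noteq> x" if x: "x \<in> W t" for x
    proof
      assume "conj_by g x = x"
      moreover have xI: "x \<in> I" using WI t x by blast
      ultimately have "g \<otimes> x = x \<otimes> g" using conj_fix_iff gc I(1) by blast
      hence "g \<in> W x" using gc I(2)[OF g] by (simp add: W_def centralizer_def)
      thus False using Weq[OF xI] Weq[OF t(1) x] t(2) by simp
    qed
    let ?u = "conj_by g t"
    have tc: "t \<in> carrier G" using I t by blast
    have u: "?u \<in> W t" using gN t by (auto simp: N_def)
    have uc: "?u \<in> carrier G" using gc tc by simp
    have tu: "t \<otimes> ?u = ?u \<otimes> t" using u by (simp add: W_def centralizer_def)
    have ut: "?u \<noteq> t" using nofix tW[OF t(1)] by blast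
    have "t \<otimes> ?u \<noteq> \<one>" using ut inv_equality[of t ?u] Iinv[OF conjI[OF gc t(1)]] tc uc by auto
    moreover have "t \<otimes> ?u \<in> centralizer t"
      using subgroup.m_closed[OF Csub[OF t(1)]] tW[OF t(1)] u by (simp add: W_def)
    ultimately have "t \<otimes> ?u \<in> W t" by (simp add: W_def)
    moreover have "conj_by g (t \<otimes> ?u) = t \<otimes> ?u" using conj_hom[OF gc tc uc] gg[OF tc] tu by simp
    ultimately show False using nofix by blast
  qed
  have Wc: "x \<in> carrier G" if "t \<in> I" "x \<in> W t" for t x using that WI I by blast
  have N_faithful: "g = \<one>" if g: "g \<in> N" for g
  proof (rule ccontr)
    assume g1: "g \<noteq> \<one>"
    have gc: "g \<in> carrier G" using g by (simp add: N_def)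
    have NM: "x \<otimes> y \<in> N" if "x \<in> N" "y \<in> N" for x y
    proof -
      have xy: "x \<in> carrier G" "y \<in> carrier G" using that by (auto simp: N_def)
      have "conj_by (x \<otimes> y) t \<in> W t" if t: "t \<in> I" for t
      proof -
        have 1: "conj_by y t \<in> W t" using \<open>y \<in> N\<close> t by (simp add: N_def)
        hence "conj_by y t \<in> I" using WI t by blast
        hence "conj_by x (conj_by y t) \<in> W (conj_by y t)" using \<open>x \<in> N\<close> by (simp add: N_def)
        thus ?thesis using Weq[OF t 1] conj_mult[OF xy I(1)[OF t]] by simp
      qed
      thus ?thesis using xy by (simp add: N_def)
    qed
    have Ninv: "inv x \<in> N" if x: "x \<in> N" for x
    proof -
      have xc: "x \<in> carrier G" using x by (simp add: N_def)
      have "conj_by (inv x) t \<in> W t" if t: "t \<in> I" for t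
      proof -
        have sI: "conj_by (inv x) t \<in> I" using conjI[OF _ t] xc by simp
        have "conj_by x (conj_by (inv x) t) \<in> W (conj_by (inv x) t)" using x sI by (auto simp: N_def)
        hence "t \<in> W (conj_by (inv x) t)" using xc I(1)[OF t] by simp
        hence "W t = W (conj_by (inv x) t)" using Weq[OF sI] by blast
        thus ?thesis using tW[OF sI] by simp
      qed
      thus ?thesis using xc by (simp add: N_def)
    qed
    have Nconj: "conj_by x g \<in> N" if x: "x \<in> carrier G" for x
    proof -
      have "conj_by (conj_by x g) t \<in> W t" if t: "t \<in> I" for t
      proof -
        let ?s = "conj_by (inv x) t"
        have sI: "?s \<in> I" using conjI[OF _ t] x by simp
        have "conj_by (conj_by x g) t = conj_by x (conj_by g ?s)"
          using conj_mult[of x g ?s] conj_mult[of "conj_by x g" x ?s] x gc I(1)[OF t]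
          by (simp add: conj_by_def[of x g] m_assoc)
        moreover have "conj_by g ?s \<in> W ?s" using g sI by (simp add: N_def)
        hence "conj_by x (conj_by g ?s) \<in> W (conj_by x ?s)" using conjC[OF x sI] by blast
        ultimately show ?thesis using x I(1)[OF t] by simp
      qed
      thus ?thesis using x gc by (simp add: N_def)
    qed
    \<comment> \<open>The commutator of \<open>t\<close> and \<open>g\<close> lies in
      \<open>N\<close> and in \<open>centralizer t\<close>, where squares are trivial; by
      \<open>NI\<close> it is the identity. So \<open>g\<close> centralizes involutions and, being
      different from the identity, would be an involution in \<open>N\<close> itself.\<close>
    have cen: "conj_by g t = t" if t: "t \<in> I" for t
    proof -
      have tc: "t \<in> carrier G" using I t by blast
      let ?k = "conj_by t g \<otimes> inv g"
      have kN: "?k \<in> N" using NM Nconj[OF tc] Ninv[OF g] by blast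
      have kc: "?k \<in> carrier G" using kN by (simp add: N_def)
      have k: "?k = t \<otimes> conj_by g t" using tc gc Iinv[OF t] by (simp add: conj_by_def m_assoc)
      have "conj_by g t \<in> W t" using g t by (simp add: N_def)
      hence "?k \<in> centralizer t" unfolding k
        using subgroup.m_closed[OF Csub[OF t]] tW[OF t] by (simp add: W_def)
      hence "?k = \<one>" using NI[of ?k] kN C2[OF t] kc p2 by (auto simp: I_def)
      hence "conj_by g t = inv t" using k tc gc inv_equality[of t "conj_by g t"] inv_comm[of t "conj_by g t"]
        by (metis conj_closed inv_equality inv_inv)
      thus ?thesis using Iinv[OF t] by simp
    qed
    have "card I = 15" using cI by (simp only: I_def)
    hence "I \<noteq> {}" by auto
    then obtain t where t: "t \<in> I" by blast
    have "g \<otimes> t = t \<otimes> g" using cen[OF t] conj_fix_iff gc I(1)[OF t] by blast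
    hence "g \<in> centralizer t" using gc by (simp add: centralizer_def)
    hence "g \<in> I" using C2[OF t] g1 gc p2 by (simp add: I_def)
    thus False using NI g by blast
  qed
  have "\<exists>f\<in>hom G (sym_group 5). inj_on f (carrier G)"
  proof (rule faithful_embedding[of "W ` I" 5 "\<lambda>g P. conj_by g ` P"])
    show "finite (W ` I)" using finI by simp
    show "card (W ` I) = 5" by fact
    show "conj_by g ` P \<in> W ` I" if "g \<in> carrier G" "P \<in> W ` I" for g P
      using that conjW conjI by auto
    show "conj_by (g \<otimes> h) ` P = conj_by g ` conj_by h ` P" if "g \<in> carrier G" "h \<in> carrier G" "P \<in> W ` I" for g h P
      using that Wc conj_mult by (force simp: image_image intro!: image_cong)
    show "conj_by \<one> ` P = P" if "P \<in> W ` I" for P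
    proof -
      have "conj_by \<one> x = x" if "x \<in> P" for x using that \<open>P \<in> W ` I\<close> Wc by auto
      thus ?thesis by simp
    qed
    show "g = \<one>" if g: "g \<in> carrier G" and fx: "\<And>P. P \<in> W ` I \<Longrightarrow> conj_by g ` P = P" for g
    proof (rule N_faithful)
      have "conj_by g t \<in> W t" if "t \<in> I" for t using fx[of "W t"] that tW by blast
      thus "g \<in> N" using g by (simp add: N_def)
    qed
  qed
  then obtain f where f: "f \<in> hom G (sym_group 5)" "inj_on f (carrier G)" by blast
  show ?thesis
  proof (rule iso_alt_group[OF f])
    show "2 * order G = fact 5" using o by (simp add: fact_numeral)
    \<comment> \<open>Everything outside \<open>I\<close> has order 1, 3 or 5 and is a square, which
      gives at least 45 squares among 60 elements.\<close>
    have "carrier G - I \<subseteq> {g \<in> carrier G. \<exists>h\<in>carrier G. g = h \<otimes> h}"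
    proof
      fix g assume g: "g \<in> carrier G - I"
      hence gc: "g \<in> carrier G" by blast
      have "g [^] (2::nat) = \<one> \<Longrightarrow> g = \<one>" using g by (auto simp: I_def)
      hence "g = \<one> \<or> g [^] (3::nat) = \<one> \<or> g [^] (5::nat) = \<one>" using ord[OF gc] by blast
      hence "g = \<one> \<or> (\<exists>h\<in>carrier G. g = h \<otimes> h)" using odd_pow_square[OF gc, of 3] odd_pow_square[OF gc, of 5] by auto
      thus "g \<in> {g \<in> carrier G. \<exists>h\<in>carrier G. g = h \<otimes> h}" using gc by force
    qed
    hence "card (carrier G - I) \<le> card {g \<in> carrier G. \<exists>h\<in>carrier G. g = h \<otimes> h}"
      using fin by (intro card_mono) auto
    moreover have "card (carrier G - I) = 45"
      using card_Diff_subset[OF finI, of "carrier G"] cI o by (auto simp: I_def order_def)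
    ultimately show "order G < 2 * card {g \<in> carrier G. \<exists>h\<in>carrier G. g = h \<otimes> h}" using o by simp
  qed simp
qed

end

section \<open>The nonregular orbits\<close>

lemma (in group) pow_coprime_one:
  assumes "g \<in> carrier G" "g [^] (m::nat) = \<one>" "g [^] (n::nat) = \<one>" "coprime m n"
  shows "g = \<one>"
proof -
  have "ord g dvd m" "ord g dvd n" using pow_eq_id[OF assms(1)] assms by auto
  hence "ord g = 1" using assms(4) coprime_common_divisor_nat by blast
  thus ?thesis using pow_ord_eq_1[OF assms(1)] assms(1) by simp
qed

context one_or_two_fixed_points
begin

lemma stab_pow: "x \<in> E \<Longrightarrow> g \<in> stab x \<Longrightarrow> g [^] card (stab x) = \<one>"
  by (rule subgroup_pow_card[OF subgroup_stab finite_stab])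

lemma partner_nonregular: "partner u v \<Longrightarrow> u \<in> nonregular_points \<and> v \<in> nonregular_points"
  by (auto simp: partner_def nonregular_points_def)

lemma partner_exists:
  assumes "x \<in> nonregular_points" "kernel_order x = 1" shows "\<exists>y. partner x y"
proof (rule ccontr)
  assume "\<nexists>y. partner x y"
  hence "comp_order x = 1" by (simp add: comp_order_def)
  hence "card (stab x) = 1" using kernel_comp_order[of x] assms by (simp add: nonregular_points_def)
  thus False using subgroup_card_1[OF subgroup_stab] assms by (auto simp: nonregular_points_def)
qed

lemma partner_unique:
  assumes "kernel_order x = 1" "partner x y" "partner x z" shows "y = z"
proof -
  have "card (complement_orbit x y) = 1" using kernel_order_partner[OF assms(2)] assms by simp
  moreover have "y \<in> complement_orbit x y" using partner_orbit[OF assms(2,2)] .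
  moreover have "z \<in> complement_orbit x y" using partner_orbit[OF assms(2,3)] .
  ultimately show ?thesis by (metis card_1_singletonE singletonD)
qed

lemma partner_stab_subset:
  assumes "kernel_order x = 1" "partner x y" shows "stab x \<subseteq> stab y"
proof -
  have "x \<in> E" using assms by (simp add: partner_def)
  hence "card (stab x \<inter> stab y) = card (stab x)"
    using comp_order_partner[OF assms(2)] kernel_comp_order[of x] assms by simp
  hence "stab x \<inter> stab y = stab x" by (intro card_subset_eq) auto
  thus ?thesis by blast
qed

lemma nonregular_cases:
  assumes N: "nonregular_orbits G E \<phi> = A" and x: "x \<in> nonregular_points"
  shows "\<exists>\<Gamma>\<in>A. x \<in> \<Gamma>"
  using orbit_refl[of x] x N by (auto simp: nonregular_orbits_eq nonregular_points_def)

lemma nonregular_fixed_point: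
  assumes g: "g \<in> carrier G" "g \<noteq> \<one>"
  shows "\<exists>w\<in>nonregular_points. g \<in> stab w"
proof -
  obtain w where w: "w \<in> E" "\<phi> g w = w" using fixed_point g by blast
  hence "g \<in> stab w" using g by (simp add: stab_iff)
  thus ?thesis using w g by (auto simp: nonregular_points_def)
qed

lemma fixes_three_points:
  assumes Y: "Y \<subseteq> E" "card Y \<ge> 3" and g: "g \<in> carrier G" "\<And>y. y \<in> Y \<Longrightarrow> \<phi> g y = y"
  shows "g = \<one>"
proof (rule ccontr)
  assume n: "g \<noteq> \<one>"
  obtain T where T: "T \<subseteq> Y" "card T = 3" using obtain_subset_with_card_n[OF Y(2)] by metis
  then obtain x y z where "T = {x, y, z}" "x \<noteq> y" "x \<noteq> z" "y \<noteq> z" by (auto simp: card_3_iff)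
  hence "x \<in> Y" "y \<in> Y" "z \<in> Y" and ne: "x \<noteq> y" "x \<noteq> z" "y \<noteq> z" using T by auto
  thus False using two[OF g(1) n, of x y z] g(2) Y(1) by blast
qed

lemma faithful:
  assumes "x \<in> E" "card (orbit G \<phi> x) \<ge> 3" shows "faithful_action G E \<phi>"
proof (intro faithful_action.intro group_action_axioms faithful_action_axioms.intro inj_onI)
  fix g h assume g: "g \<in> carrier G" and h: "h \<in> carrier G" and eq: "\<phi> g = \<phi> h"
  have "inv h \<otimes> g = \<one>"
  proof (rule fixes_three_points[OF orbit_subset[OF assms(1)] assms(2)])
    fix y assume "y \<in> orbit G \<phi> x"
    hence "y \<in> E" using orbit_subset[OF assms(1)] by blast
    thus "\<phi> (inv h \<otimes> g) y = y" using g h eq by (simp add: act_mult)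
  qed (use g h in simp)
  hence "h \<otimes> (inv h \<otimes> g) = h" using h by simp
  thus "g = h" using g h by (simp add: m_assoc[symmetric])
qed

text \<open>The left side counts pairs of a point of \<open>Y\<close> and a nonidentity element
  fixing it, and an element belongs to at most two such pairs.\<close>

lemma card_fixing_elements:
  assumes Y: "Y \<subseteq> E" "finite Y"
  shows "(\<Sum>y\<in>Y. card (stab y) - 1) \<le> 2 * card {g \<in> carrier G. g \<noteq> \<one> \<and> (\<exists>y\<in>Y. \<phi> g y = y)}"
proof -
  let ?C = "carrier G - {\<one>}" and ?B = "{g \<in> carrier G. g \<noteq> \<one> \<and> (\<exists>y\<in>Y. \<phi> g y = y)}"
  have fB: "finite ?B" using fin by simp
  have "(\<Sum>y\<in>Y. card (stab y) - 1) = (\<Sum>y\<in>Y. \<Sum>g | g \<in> ?B \<and> \<phi> g y = y. 1)"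
  proof (intro sum.cong refl)
    fix y assume y: "y \<in> Y"
    have "{g. g \<in> ?B \<and> \<phi> g y = y} = stab y - {\<one>}" using y unfolding stabilizer_def by blast
    moreover have "y \<in> E" using y Y by blast
    ultimately show "card (stab y) - 1 = (\<Sum>g | g \<in> ?B \<and> \<phi> g y = y. 1)"
      by (simp add: card_Diff_singleton)
  qed
  also have "\<dots> = (\<Sum>g\<in>?B. \<Sum>y | y \<in> Y \<and> \<phi> g y = y. 1)"
    by (rule sum.swap_restrict[OF Y(2) fB])
  also have "\<dots> \<le> (\<Sum>g\<in>?B. 2)"
  proof (rule sum_mono)
    fix g assume g: "g \<in> ?B"
    hence f: "finite (invariants E \<phi> g)" "card (invariants E \<phi> g) \<le> 2" using invariants_finite by auto
    have "{y. y \<in> Y \<and> \<phi> g y = y} \<subseteq> invariants E \<phi> g" using Y(1) unfolding invariants_def by blast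
    hence "card {y. y \<in> Y \<and> \<phi> g y = y} \<le> 2" using card_mono[OF f(1)] f(2) le_trans by blast
    thus "(\<Sum>y | y \<in> Y \<and> \<phi> g y = y. 1) \<le> (2::nat)" by simp
  qed
  finally show ?thesis by simp
qed

lemma nonregular_lengths_three:
  assumes "nonregular_orbits G E \<phi> = {A, B, C}" "A \<noteq> B" "A \<noteq> C" "B \<noteq> C"
  shows "nonregular_lengths G E \<phi> = {#card A, card B, card C#}"
  using assms by (simp add: nonregular_lengths_def)

text \<open>The action on an orbit of length four is faithful. Each of the eight points in the two
  short orbits is fixed by two elements of order three, and each such element is counted at most
  twice. With the identity this makes at least nine squares among twelve elements.\<close>

lemma iso_alt_group_4:
  assumes E: "y \<in> E" "z \<in> E" and s: "card (stab y) = 3" "card (stab z) = 3" and o: "order G = 12"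
    and ne: "orbit G \<phi> y \<noteq> orbit G \<phi> z"
  shows "G \<cong> alt_group 4"
proof -
  let ?Y = "orbit G \<phi> y" and ?Z = "orbit G \<phi> z"
  have c: "card ?Y = 4" "card ?Z = 4" using card_orbit[OF E(1)] card_orbit[OF E(2)] s o by auto
  have dis: "?Y \<inter> ?Z = {}" using disjoint_union[of ?Y ?Z] ne E by (auto simp: orbits_def)
  have "\<exists>f\<in>hom G (sym_group 4). inj_on f (carrier G)"
  proof (rule faithful_embedding[of ?Y 4 \<phi>])
    show "\<phi> g w \<in> ?Y" if "g \<in> carrier G" "w \<in> ?Y" for g w using act_mem_orbit[OF E(1) that(2,1)] .
    show "\<phi> (g \<otimes> h) w = \<phi> g (\<phi> h w)" if "g \<in> carrier G" "h \<in> carrier G" "w \<in> ?Y" for g h w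
      using act_mult that orbit_subset[OF E(1)] by blast
    show "\<phi> \<one> w = w" if "w \<in> ?Y" for w using act_one that orbit_subset[OF E(1)] by blast
    show "g = \<one>" if "g \<in> carrier G" "\<And>w. w \<in> ?Y \<Longrightarrow> \<phi> g w = w" for g
      by (rule fixes_three_points[OF orbit_subset[OF E(1)] _ that]) (simp add: c)
  qed (use c in auto)
  then obtain f where f: "f \<in> hom G (sym_group 4)" "inj_on f (carrier G)" by blast
  show ?thesis
  proof (rule iso_alt_group[OF f])
    show "2 * order G = fact 4" using o by (simp add: fact_numeral)
    let ?B = "{g \<in> carrier G. g \<noteq> \<one> \<and> (\<exists>w\<in>?Y \<union> ?Z. \<phi> g w = w)}"
    let ?S = "{g \<in> carrier G. \<exists>h\<in>carrier G. g = h \<otimes> h}"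
    have st: "card (stab w) = 3" "w \<in> E" if "w \<in> ?Y \<union> ?Z" for w
      using that orbit_orders(3)[OF E(1)] orbit_orders(3)[OF E(2)] s orbit_subset[OF E(1)] orbit_subset[OF E(2)] by auto
    have "(\<Sum>w\<in>?Y \<union> ?Z. card (stab w) - 1) \<le> 2 * card ?B"
      by (rule card_fixing_elements) (use st in auto)
    moreover have "(\<Sum>w\<in>?Y \<union> ?Z. card (stab w) - 1) = (\<Sum>w\<in>?Y \<union> ?Z. 2)" using st by (intro sum.cong) auto
    moreover have "(\<Sum>w\<in>?Y \<union> ?Z. 2) = (16::nat)" using card_Un_disjoint[OF _ _ dis] c by simp
    ultimately have "16 \<le> 2 * card ?B" by simp
    moreover have "insert \<one> ?B \<subseteq> ?S"
    proof
      fix g assume g: "g \<in> insert \<one> ?B"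
      show "g \<in> ?S"
      proof (cases "g = \<one>")
        case True thus ?thesis by force
      next
        case False
        then obtain w where w: "w \<in> ?Y \<union> ?Z" "\<phi> g w = w" "g \<in> carrier G" using g by blast
        hence "g \<in> stab w" by (simp add: stab_iff)
        hence "g [^] (3::nat) = \<one>" using stab_pow[OF st(2)[OF w(1)]] st(1)[OF w(1)] by simp
        thus ?thesis using odd_pow_square[OF w(3)] w(3) by simp
      qed
    qed
    hence "card (insert \<one> ?B) \<le> card ?S" using fin by (intro card_mono) auto
    moreover have "card (insert \<one> ?B) = Suc (card ?B)" using fin by simp
    ultimately show "order G < 2 * card ?S" using o by simp
  qed simp
qed

text \<open>The group acts on the four pairs of partners in the orbit of length eight. A nontrivial kernel would
  consist of one central involution, whose fixed points would form a union of orbits.\<close>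

lemma iso_sym_group_4:
  assumes big: "\<And>x. x \<in> E \<Longrightarrow> 3 \<le> card (orbit G \<phi> x)"
    and N: "nonregular_orbits G E \<phi> = {orbit G \<phi> x, orbit G \<phi> y, orbit G \<phi> z}"
    and m: "x \<in> nonregular_points" "y \<in> nonregular_points" "z \<in> nonregular_points"
    and k: "kernel_order y = 1"
    and s: "card (stab x) = 2" "card (stab y) = 3" "card (stab z) = 4" and o: "order G = 24"
  shows "G \<cong> sym_group 4"
proof -
  let ?Y = "orbit G \<phi> y"
  have E: "x \<in> E" "y \<in> E" "z \<in> E" using m by (auto simp: nonregular_points_def)
  have cY: "card ?Y = 8" using card_orbit[OF E(2)] s o by simp
  have YE: "u \<in> E" if "u \<in> ?Y" for u using orbit_subset[OF E(2)] that by blast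
  have Yact: "\<phi> g u \<in> ?Y" if "g \<in> carrier G" "u \<in> ?Y" for g u using act_mem_orbit[OF E(2) that(2,1)] .
  have Ym: "u \<in> nonregular_points" if "u \<in> ?Y" for u using orbit_nonregular_points[OF m(2)] that by blast
  have Yk: "kernel_order u = 1" "card (stab u) = 3" if "u \<in> ?Y" for u
    using orbit_orders[OF E(2) that] k s by auto
  define c where "c u = (THE v. partner u v)" for u
  have c: "partner u v \<longleftrightarrow> v = c u" if u: "u \<in> ?Y" for u v
  proof -
    obtain v0 where v0: "partner u v0" using partner_exists[OF Ym[OF u] Yk(1)[OF u]] by blast
    have "c u = v0" unfolding c_def by (rule the_equality) (use v0 partner_unique[OF Yk(1)[OF u]] in blast)+
    thus ?thesis using v0 partner_unique[OF Yk(1)[OF u]] by blast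
  qed
  have cp: "partner u (c u)" if "u \<in> ?Y" for u using c[OF that] by blast
  have cE: "c u \<in> E" "c u \<noteq> u" if "u \<in> ?Y" for u using cp[OF that] by (auto simp: partner_def)
  have cst: "stab u \<subseteq> stab (c u)" if "u \<in> ?Y" for u by (rule partner_stab_subset[OF Yk(1)[OF that] cp[OF that]])
  have cY': "c u \<in> ?Y" if u: "u \<in> ?Y" for u
  proof -
    have cm: "c u \<in> nonregular_points" using partner_nonregular[OF cp[OF u]] by blast
    \<comment> \<open>The stabilizer of the partner contains \<open>stab u\<close>, so its order is
      divisible by 3. Among the stabilizer orders 2, 3 and 4 this occurs only on the orbit of
      \<open>y\<close>.\<close>
    have "3 dvd card (stab (c u))"
    proof -
      interpret A: subgroup_action G "stab u" "stab (c u)" "\<lambda>g h. g \<otimes> h"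
      proof (rule subgroup_actionI[OF subgroup_stab[OF YE[OF u]]])
        show "g \<otimes> h \<in> stab (c u)" if "g \<in> stab u" "h \<in> stab (c u)" for g h
          using that cst[OF u] subgroup.m_closed[OF subgroup_stab[OF cE(1)[OF u]]] by blast
      qed (auto simp: m_assoc dest: stab_carrier)
      have "card (stab u) dvd card (stab (c u))"
      proof (rule A.semiregular_dvd)
        fix g h assume gh: "g \<in> stab u" "h \<in> stab (c u)" "g \<otimes> h = h"
        show "g = \<one>" using right_cancel[of h g \<one>] gh stab_carrier by auto
      qed simp
      thus ?thesis using Yk(2)[OF u] by simp
    qed
    moreover obtain \<Gamma> where "\<Gamma> \<in> {orbit G \<phi> x, ?Y, orbit G \<phi> z}" "c u \<in> \<Gamma>" using nonregular_cases[OF N cm] by blast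
    ultimately show ?thesis using orbit_orders(3)[OF E(1), of "c u"] orbit_orders(3)[OF E(3), of "c u"] s by auto
  qed
  have cc: "c (c u) = u" if "u \<in> ?Y" for u using c[OF cY'[OF that], of u] partner_sym[OF cp[OF that]] by simp
  have cact: "\<phi> g (c u) = c (\<phi> g u)" if "u \<in> ?Y" "g \<in> carrier G" for g u
    using c[OF Yact[OF that(2,1)]] partner_act[OF cp[OF that(1)] that(2)] by simp
  define pr where "pr u = {u, c u}" for u
  have pr_eq: "pr u = pr v" if "u \<in> ?Y" "v \<in> ?Y" "pr u \<inter> pr v \<noteq> {}" for u v
  proof -
    have "u = v \<or> c u = v \<or> u = c v \<or> c u = c v" using that(3) unfolding pr_def by blast
    hence "u = v \<or> c u = v" using cc[OF that(1)] cc[OF that(2)] by metis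
    thus ?thesis using cc[OF that(1)] by (metis insert_commute pr_def)
  qed
  have pr_act: "\<phi> g ` pr u = pr (\<phi> g u)" if "u \<in> ?Y" "g \<in> carrier G" for g u
    using cact[OF that] by (simp add: pr_def)
  let ?X = "pr ` ?Y"
  have UX: "\<Union>?X = ?Y" using cY' by (auto simp: pr_def)
  have "2 * card ?X = card (\<Union>?X)"
  proof (rule card_partition)
    show "card P = 2" if P: "P \<in> ?X" for P
    proof -
      obtain u where u: "u \<in> ?Y" "P = {u, c u}" using P by (auto simp: pr_def)
      show ?thesis using u(2) cE(2)[OF u(1)] by (simp add: card_insert_if)
    qed
    show "P \<inter> Q = {}" if "P \<in> ?X" "Q \<in> ?X" "P \<noteq> Q" for P Q using that pr_eq by blast
  qed (use UX in auto)
  hence cX: "card ?X = 4" using UX cY by simp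
  define N where "N = {g \<in> carrier G. \<forall>u\<in>?Y. \<phi> g u = u \<or> \<phi> g u = c u}"
  \<comment> \<open>\<open>N\<close> is the kernel of the action on the pairs of partners. A
    nonidentity element of \<open>N\<close> fixing \<open>w\<close> has only \<open>w\<close> and
    its partner as fixed points, so it interchanges every other pair; but its cube is
    trivial.\<close>
  have Nfree: "\<phi> g w = c w" if g: "g \<in> N" "g \<noteq> \<one>" and w: "w \<in> ?Y" for g w
  proof (rule ccontr)
    assume "\<phi> g w \<noteq> c w"
    hence gc: "g \<in> carrier G" and gw: "\<phi> g w = w" using g w unfolding N_def by blast+
    have gs: "g \<in> stab w" using gc gw by (simp add: stab_iff)
    have "\<not> ?Y \<subseteq> pr w"
    proof
      assume "?Y \<subseteq> pr w"
      hence "card ?Y \<le> card (pr w)" by (intro card_mono) (auto simp: pr_def)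
      also have "\<dots> \<le> 2" by (simp add: pr_def card_insert_if)
      finally show False using cY by simp
    qed
    then obtain u where u: "u \<in> ?Y" "u \<noteq> w" "u \<noteq> c w" unfolding pr_def by blast
    have uE: "u \<in> E" using YE u by blast
    have "\<phi> g u \<noteq> u"
    proof
      assume "\<phi> g u = u"
      hence "g \<in> stab u" using gc by (simp add: stab_iff)
      moreover have "g \<in> stab (c w)" using gs cst[OF w] by blast
      ultimately have "u = w \<or> u = c w"
        using third_fixed_point[OF gs _ _ g(2) YE[OF w] cE(1)[OF w] uE] cE(2)[OF w] by metis
      thus False using u by blast
    qed
    hence gu: "\<phi> g u = c u" using g u by (auto simp: N_def)
    have gcu: "\<phi> g (c u) = u" using cact[OF u(1) gc] gu cc[OF u(1)] by simp
    have "\<phi> (g \<otimes> (g \<otimes> g)) u = c u" using gc uE gu gcu by (simp add: act_mult)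
    moreover have "g \<otimes> (g \<otimes> g) = \<one>"
      using stab_pow[OF YE[OF w] gs] Yk(2)[OF w] gc by (simp add: numeral_3_eq_3 m_assoc)
    ultimately show False using uE cE[OF u(1)] by simp
  qed
  have Nuniq: "g = h" if g: "g \<in> N" "g \<noteq> \<one>" and h: "h \<in> N" "h \<noteq> \<one>" for g h
  proof -
    have gc: "g \<in> carrier G" and hc: "h \<in> carrier G" using g h by (auto simp: N_def)
    have "inv h \<otimes> g = \<one>"
    proof (rule fixes_three_points[OF orbit_subset[OF E(2)]])
      show "3 \<le> card ?Y" using cY by simp
      show "\<phi> (inv h \<otimes> g) u = u" if u: "u \<in> ?Y" for u
        using Nfree[OF g u] Nfree[OF h u] gc hc YE[OF u] by (metis act_inv act_mult inv_closed)
    qed (use gc hc in simp)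
    hence "h \<otimes> (inv h \<otimes> g) = h" using hc by simp
    thus ?thesis using gc hc by (simp add: m_assoc[symmetric])
  qed
  have Ntriv: "g = \<one>" if g: "g \<in> N" for g
  proof (rule ccontr)
    assume n: "g \<noteq> \<one>"
    have gc: "g \<in> carrier G" using g by (simp add: N_def)
    have comm: "conj_by u g = g" if u: "u \<in> carrier G" for u
    proof (rule Nuniq[OF _ _ g n])
      show "conj_by u g \<noteq> \<one>" using conj_eq_iff[OF u gc one_closed] n u by simp
      have "\<phi> (conj_by u g) w = w \<or> \<phi> (conj_by u g) w = c w" if w: "w \<in> ?Y" for w
      proof -
        let ?v = "\<phi> (inv u) w"
        have v: "?v \<in> ?Y" using Yact[OF _ w] u by simp
        have a: "\<phi> (conj_by u g) w = \<phi> u (\<phi> g ?v)" using u gc YE[OF w] by (simp add: conj_by_def act_mult)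
        have "\<phi> g ?v = c ?v" using Nfree[OF g n v] .
        thus ?thesis using a cact[OF v u] u YE[OF w] by simp
      qed
      thus "conj_by u g \<in> N" using u gc by (simp add: N_def)
    qed
    obtain w where w: "w \<in> E" "\<phi> g w = w" using fixed_point[OF gc n] by blast
    have "orbit G \<phi> w \<subseteq> invariants E \<phi> g"
    proof
      fix v assume v: "v \<in> orbit G \<phi> w"
      then obtain u where u: "u \<in> carrier G" "v = \<phi> u w" using mem_orbit_act[OF w(1)] by blast
      have "u \<otimes> g = g \<otimes> u" using comm[OF u(1)] conj_by_def[of u g] u gc by (metis inv_solve_right m_closed)
      hence "\<phi> g v = \<phi> u (\<phi> g w)" using u gc w act_mult by metis
      thus "v \<in> invariants E \<phi> g" using u w by (simp add: invariants_def)
    qed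
    hence "card (orbit G \<phi> w) \<le> 2" using invariants_finite[OF gc n] card_mono le_trans by blast
    thus False using big[OF w(1)] by simp
  qed
  have "\<exists>f\<in>hom G (sym_group 4). inj_on f (carrier G)"
  proof (rule faithful_embedding[of ?X 4 "\<lambda>g P. \<phi> g ` P"])
    show "\<phi> g ` P \<in> ?X" if "g \<in> carrier G" "P \<in> ?X" for g P using that pr_act Yact by auto
    have PE: "v \<in> E" if "P \<in> ?X" "v \<in> P" for v P using that UX YE by blast
    show "\<phi> (g \<otimes> h) ` P = \<phi> g ` \<phi> h ` P" if "g \<in> carrier G" "h \<in> carrier G" "P \<in> ?X" for g h P
      unfolding image_image using act_mult[OF that(1,2) PE[OF that(3)]] by (intro image_cong) auto
    show "\<phi> \<one> ` P = P" if "P \<in> ?X" for P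
    proof -
      have "\<phi> \<one> ` P = (\<lambda>v. v) ` P" using act_one[OF PE[OF that]] by (intro image_cong) auto
      thus ?thesis by simp
    qed
    show "g = \<one>" if g: "g \<in> carrier G" and fx: "\<And>P. P \<in> ?X \<Longrightarrow> \<phi> g ` P = P" for g
    proof (rule Ntriv)
      have "\<phi> g u = u \<or> \<phi> g u = c u" if u: "u \<in> ?Y" for u
      proof -
        have "\<phi> g u \<in> \<phi> g ` pr u" by (simp add: pr_def)
        hence "\<phi> g u \<in> pr u" using fx[of "pr u"] u by blast
        thus ?thesis by (simp add: pr_def)
      qed
      thus "g \<in> N" using g by (simp add: N_def)
    qed
  qed (use cX in auto)
  then obtain f where f: "f \<in> hom G (sym_group 4)" "inj_on f (carrier G)" by blast
  show ?thesis by (rule iso_sym_group[OF f]) (simp add: o fact_numeral)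
qed

text \<open>Common end of both cases with order 60. Each of the \<open>30 / k\<close> points of the
  orbit is fixed by \<open>k\<close> involutions, and each involution fixes two of these points, so
  there are fifteen involutions. All are conjugate, so their centralizers have order four.\<close>

lemma iso_alt_group_5_orbit:
  assumes x: "x \<in> nonregular_points" and d: "comp_order x = 2" and o: "order G = 60"
    and ord: "\<And>g. g \<in> carrier G \<Longrightarrow> g [^] (2::nat) = \<one> \<or> g [^] (3::nat) = \<one> \<or> g [^] (5::nat) = \<one>"
    and inv: "\<And>t. t \<in> carrier G \<Longrightarrow> t \<noteq> \<one> \<Longrightarrow> t [^] (2::nat) = \<one> \<Longrightarrow>
       \<exists>w\<in>orbit G \<phi> x. \<exists>v\<in>orbit G \<phi> x. partner w v \<and> t \<in> stab w \<and> t \<in> stab v"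
  shows "G \<cong> alt_group 5"
proof -
  let ?X = "orbit G \<phi> x"
  define I where "I = {t \<in> carrier G. t \<noteq> \<one> \<and> t [^] (2::nat) = \<one>}"
  have xE: "x \<in> E" using x by (simp add: nonregular_points_def)
  have XE: "u \<in> E" if "u \<in> ?X" for u using orbit_subset[OF xE] that by blast
  have Xd: "comp_order u = 2" "kernel_order u = kernel_order x" if "u \<in> ?X" for u
    using orbit_orders[OF xE that] d by auto
  have p2: "card (stab w \<inter> stab v) = 2" if "w \<in> ?X" "partner w v" for w v
    using comp_order_partner[OF that(2)] Xd(1)[OF that(1)] by simp
  have two_elts: "g = h" if wv: "w \<in> ?X" "partner w v" and g: "g \<in> stab w" "g \<in> stab v" "g \<noteq> \<one>"
    and h: "h \<in> stab w" "h \<in> stab v" "h \<noteq> \<one>" for g h w v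
  proof (rule ccontr)
    assume "g \<noteq> h"
    hence "card {\<one>, g, h} = 3" using g h by simp
    moreover have "{\<one>, g, h} \<subseteq> stab w \<inter> stab v" using g h wv by (auto simp: partner_def)
    hence "card {\<one>, g, h} \<le> card (stab w \<inter> stab v)" by (rule card_mono[rotated]) simp
    ultimately show False using p2[OF wv] by simp
  qed
  have pow2: "g [^] (2::nat) = \<one>" if wv: "w \<in> ?X" "partner w v" and g: "g \<in> stab w" "g \<in> stab v" for g w v
  proof -
    have E: "w \<in> E" "v \<in> E" using wv by (auto simp: partner_def)
    have "g [^] card (stab w \<inter> stab v) = \<one>"
      by (rule subgroup_pow_card[OF subgroup_stab2[OF E]]) (use g in auto)
    thus ?thesis using p2[OF wv] by simp
  qed
  have tp: "two_point_elements w = {g. g \<in> I \<and> \<phi> g w = w}" if w: "w \<in> ?X" for w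
  proof
    show "two_point_elements w \<subseteq> {g. g \<in> I \<and> \<phi> g w = w}"
    proof
      fix g assume "g \<in> two_point_elements w"
      then obtain v where v: "g \<in> stab w" "g \<noteq> \<one>" "v \<in> E" "v \<noteq> w" "\<phi> g v = v"
        unfolding two_point_elements_def by blast
      have gc: "g \<in> carrier G" "\<phi> g w = w" using v(1) by (auto simp: stab_iff)
      have gv: "g \<in> stab v" using gc v by (simp add: stab_iff)
      have "partner w v" using partnerI[OF v(1) gv v(2) XE[OF w] v(3)] v(4) by blast
      hence "g [^] (2::nat) = \<one>" using pow2[OF w] v(1) gv by blast
      thus "g \<in> {g. g \<in> I \<and> \<phi> g w = w}" using gc v by (simp add: I_def)
    qed
    show "{g. g \<in> I \<and> \<phi> g w = w} \<subseteq> two_point_elements w"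
    proof
      fix t assume "t \<in> {g. g \<in> I \<and> \<phi> g w = w}"
      hence t: "t \<in> carrier G" "t \<noteq> \<one>" "t [^] (2::nat) = \<one>" "t \<in> stab w" by (auto simp: I_def stab_iff)
      obtain a b where ab: "partner a b" "t \<in> stab a" "t \<in> stab b" using inv[OF t(1-3)] by blast
      have ab': "a \<in> E" "b \<in> E" "a \<noteq> b" using ab by (auto simp: partner_def)
      have "\<exists>v\<in>E. v \<noteq> w \<and> t \<in> stab v" using ab ab' by metis
      thus "t \<in> two_point_elements w" using t by (auto simp: two_point_elements_def stab_iff)
    qed
  qed
  have finI: "finite I" using fin by (simp add: I_def)
  have two_fix: "card {w. w \<in> ?X \<and> \<phi> t w = w} = 2" if t: "t \<in> I" for t
  proof -
    have t': "t \<in> carrier G" "t \<noteq> \<one>" "t [^] (2::nat) = \<one>" using t by (auto simp: I_def)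
    obtain a b where ab: "a \<in> ?X" "b \<in> ?X" "partner a b" "t \<in> stab a" "t \<in> stab b" using inv[OF t'] by blast
    have ab': "a \<in> E" "b \<in> E" "a \<noteq> b" "\<phi> t a = a" "\<phi> t b = b" using ab by (auto simp: partner_def stab_iff)
    have "{w. w \<in> ?X \<and> \<phi> t w = w} \<subseteq> {a, b}"
    proof
      fix w assume "w \<in> {w. w \<in> ?X \<and> \<phi> t w = w}"
      hence w: "w \<in> ?X" "\<phi> t w = w" by auto
      show "w \<in> {a, b}" using two[OF t'(1,2) ab'(1,2) XE[OF w(1)] ab'(4,5) w(2)] ab'(3) by blast
    qed
    moreover have "{a, b} \<subseteq> {w. w \<in> ?X \<and> \<phi> t w = w}" using ab ab' by blast
    ultimately have "{w. w \<in> ?X \<and> \<phi> t w = w} = {a, b}" by (rule equalityI)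
    thus ?thesis using ab' by simp
  qed
  have "(\<Sum>w\<in>?X. card (two_point_elements w)) = (\<Sum>w\<in>?X. \<Sum>t | t \<in> I \<and> \<phi> t w = w. 1)"
    by (intro sum.cong refl) (simp add: tp)
  also have "\<dots> = (\<Sum>t\<in>I. \<Sum>w | w \<in> ?X \<and> \<phi> t w = w. 1)"
    by (rule sum.swap_restrict[OF finite_orbit finI])
  also have "\<dots> = (\<Sum>t\<in>I. 2)" by (intro sum.cong refl) (simp add: two_fix)
  finally have "(\<Sum>w\<in>?X. card (two_point_elements w)) = 2 * card I" by simp
  moreover have "(\<Sum>w\<in>?X. card (two_point_elements w)) = (\<Sum>w\<in>?X. kernel_order x)"
    using card_two_point_elements[OF XE] Xd by (intro sum.cong) auto
  moreover have "card ?X * (kernel_order x * 2) = 60" using card_orbit[OF xE] kernel_comp_order[OF xE] d o by simp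
  ultimately have cI: "card I = 15" by simp
  have cC: "card (centralizer t) = 4" if t: "t \<in> carrier G" "t \<noteq> \<one>" "t [^] (2::nat) = \<one>" for t
  proof -
    obtain a b where ab: "a \<in> ?X" "b \<in> ?X" "partner a b" "t \<in> stab a" "t \<in> stab b" using inv[OF t] by blast
    have abE: "a \<in> E" "b \<in> E" using ab by (auto simp: partner_def)
    interpret A: subgroup_action G "carrier G" "carrier G" conj_by
      by (rule subgroup_actionI[OF subgroup_self]) (auto simp: conj_mult)
    have "(\<lambda>g. conj_by g t) ` carrier G = I"
    proof
      show "(\<lambda>g. conj_by g t) ` carrier G \<subseteq> I"
      proof
        fix u assume "u \<in> (\<lambda>g. conj_by g t) ` carrier G"
        then obtain g where g: "g \<in> carrier G" "u = conj_by g t" by blast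
        have "t \<otimes> t = \<one>" using t by (simp add: numeral_2_eq_2)
        hence "u \<otimes> u = \<one>" using conj_hom[OF g(1) t(1) t(1)] g by simp
        moreover have "u \<noteq> \<one>" using conj_eq_iff[OF g(1) t(1) one_closed] g t by simp
        ultimately show "u \<in> I" using g t by (simp add: I_def numeral_2_eq_2)
      qed
      show "I \<subseteq> (\<lambda>g. conj_by g t) ` carrier G"
      proof
        fix u assume "u \<in> I"
        hence u: "u \<in> carrier G" "u \<noteq> \<one>" "u [^] (2::nat) = \<one>" by (auto simp: I_def)
        obtain a' b' where ab': "a' \<in> ?X" "b' \<in> ?X" "partner a' b'" "u \<in> stab a'" "u \<in> stab b'" using inv[OF u] by blast
        \<comment> \<open>Conjugacy of \<open>t\<close> and \<open>u\<close>: some \<open>g\<close>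
          carries \<open>a\<close> to \<open>a'\<close>, and as \<open>\<phi> g b\<close> and
          \<open>b'\<close> are both partners of \<open>a'\<close>, an element \<open>h\<close> of
          \<open>stab a'\<close> carries the one to the other. The common stabilizer of
          \<open>a'\<close> and \<open>b'\<close> contains a single involution.\<close>
        have "a' \<in> orbit G \<phi> a" using ab'(1) orbit_eqI[OF xE ab(1)] by simp
        then obtain g where g: "g \<in> carrier G" "a' = \<phi> g a" using mem_orbit_act[OF abE(1)] by blast
        have "partner a' (\<phi> g b)" using partner_act[OF ab(3) g(1)] g(2) by simp
        hence "b' \<in> complement_orbit a' (\<phi> g b)" using partner_orbit ab'(3) by blast
        then obtain h where h: "h \<in> stab a'" "b' = \<phi> h (\<phi> g b)" by (auto simp: complement_orbit_def)
        have hc: "h \<in> carrier G" "\<phi> h a' = a'" using h by (auto simp: stab_iff)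
        have hg: "\<phi> (h \<otimes> g) a = a'" "\<phi> (h \<otimes> g) b = b'" using act_mult hc g h abE by auto
        have hgc: "h \<otimes> g \<in> carrier G" using hc g by simp
        have "conj_by (h \<otimes> g) t \<in> stab a'" "conj_by (h \<otimes> g) t \<in> stab b'"
          using conj_stab[OF hgc t(1) abE(1)] conj_stab[OF hgc t(1) abE(2)] hg ab by auto
        moreover have "conj_by (h \<otimes> g) t \<noteq> \<one>" using conj_eq_iff[OF hgc t(1) one_closed] hgc t by simp
        ultimately have "conj_by (h \<otimes> g) t = u" using two_elts[OF ab'(1,3)] ab'(4,5) u(2) by blast
        thus "u \<in> (\<lambda>g. conj_by g t) ` carrier G" using hgc by blast
      qed
    qed
    moreover have "{g \<in> carrier G. conj_by g t = t} = centralizer t"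
      using conj_fix_iff[OF _ t(1)] by (auto simp: centralizer_def)
    ultimately have "card I * card (centralizer t) = 60" using A.orbit_card[OF t(1)] o by (simp add: order_def)
    thus ?thesis using cI by simp
  qed
  show ?thesis
    by (rule iso_alt_group_5[OF o ord]) (use cI cC in \<open>auto simp: I_def\<close>)
qed

text \<open>An involution lies in no stabilizer of order 3 or 5, so its fixed points belong to the
  orbit of \<open>x\<close>. There the kernels are trivial, and the second fixed point is the
  partner of the first.\<close>

lemma iso_alt_group_5_three_orbits:
  assumes N: "nonregular_orbits G E \<phi> = {orbit G \<phi> x, orbit G \<phi> y, orbit G \<phi> z}"
    and m: "x \<in> nonregular_points" "y \<in> nonregular_points" "z \<in> nonregular_points"
    and k: "kernel_order x = 1"
    and s: "card (stab x) = 2" "card (stab y) = 3" "card (stab z) = 5" and o: "order G = 60"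
  shows "G \<cong> alt_group 5"
proof -
  have E: "x \<in> E" "y \<in> E" "z \<in> E" using m by (auto simp: nonregular_points_def)
  have cases: "w \<in> orbit G \<phi> x \<and> card (stab w) = 2 \<or> card (stab w) = 3 \<or> card (stab w) = 5"
    if w: "w \<in> nonregular_points" for w
    using nonregular_cases[OF N w] orbit_orders(3)[OF E(1), of w] orbit_orders(3)[OF E(2), of w]
      orbit_orders(3)[OF E(3), of w] s by auto
  show ?thesis
  proof (rule iso_alt_group_5_orbit[OF m(1) _ o])
    show "comp_order x = 2" using kernel_comp_order[OF E(1)] k s by simp
    show "g [^] (2::nat) = \<one> \<or> g [^] (3::nat) = \<one> \<or> g [^] (5::nat) = \<one>" if g: "g \<in> carrier G" for g
    proof (cases "g = \<one>")
      case False
      then obtain w where w: "w \<in> nonregular_points" "g \<in> stab w" using nonregular_fixed_point[OF g] by blast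
      thus ?thesis using cases[OF w(1)] stab_pow[of w g] by (auto simp: nonregular_points_def)
    qed simp
    show "\<exists>w\<in>orbit G \<phi> x. \<exists>v\<in>orbit G \<phi> x. partner w v \<and> t \<in> stab w \<and> t \<in> stab v"
      if t: "t \<in> carrier G" "t \<noteq> \<one>" "t [^] (2::nat) = \<one>" for t
    proof -
      have odd: "\<not> (card (stab w) = 3 \<or> card (stab w) = 5)" if "w \<in> E" "t \<in> stab w" for w
        using stab_pow[OF that] pow_coprime_one[OF t(1,3), of 3] pow_coprime_one[OF t(1,3), of 5] t(2) by auto
      obtain w where w: "w \<in> nonregular_points" "t \<in> stab w" using nonregular_fixed_point[OF t(1,2)] by blast
      have wE: "w \<in> E" using w by (simp add: nonregular_points_def)
      have wx: "w \<in> orbit G \<phi> x" using cases[OF w(1)] odd[OF wE w(2)] by blast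
      have kw: "kernel_order w = 1" using orbit_orders(1)[OF E(1) wx] k by simp
      obtain v where v: "partner w v" using partner_exists[OF w(1) kw] by blast
      have vm: "v \<in> nonregular_points" using partner_nonregular[OF v] by blast
      have vE: "v \<in> E" using v by (simp add: partner_def)
      have tv: "t \<in> stab v" using partner_stab_subset[OF kw v] w by blast
      have "v \<in> orbit G \<phi> x" using cases[OF vm] odd[OF vE tv] by blast
      thus ?thesis using wx v w tv by blast
    qed
  qed
qed

text \<open>A nonidentity element fixing a point of the orbit of \<open>x\<close> has order 3 or 2,
  according to whether it lies in the kernel set or fixes two points; all others lie in stabilizers
  of order 5. Hence involutions fix two points, both in the orbit of \<open>x\<close> as the orbits
  are not linked.\<close>

lemma iso_alt_group_5_two_orbits:
  assumes N: "nonregular_orbits G E \<phi> = {orbit G \<phi> x, orbit G \<phi> y}"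
    and m: "x \<in> nonregular_points" "y \<in> nonregular_points" and ul: "\<not> linked x y"
    and k: "kernel_order x = 3" "comp_order x = 2" "card (stab y) = 5" "card (orbit G \<phi> x) = 10"
  shows "G \<cong> alt_group 5" "order G = 60"
proof -
  have E: "x \<in> E" "y \<in> E" using m by (auto simp: nonregular_points_def)
  show o: "order G = 60" using card_orbit[OF E(1)] kernel_comp_order[OF E(1)] k by simp
  have K3: "g [^] (3::nat) = \<one>" if w: "w \<in> orbit G \<phi> x" and g: "g \<in> kernel_set w" for w g
  proof -
    have wE: "w \<in> E" using orbit_subset[OF E(1)] w by blast
    have kw: "kernel_order w = 3" "comp_order w = 2" using orbit_orders[OF E(1) w] k by auto
    obtain v where v: "partner w v"
    proof -
      have "\<exists>v. partner w v" using kw(2) by (rule contrapos_pp) (simp add: comp_order_def)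
      thus ?thesis using that by blast
    qed
    have v': "v \<in> E" "w \<noteq> v" using v by (auto simp: partner_def)
    have c: "card (kernel_set w) = 3" using card_kernel_set[OF wE] kw by simp
    \<comment> \<open>The numerical hypothesis is met by \<open>q = 3\<close>, \<open>d = 2\<close>
      and \<open>c = 1\<close>.\<close>
    have "subgroup (kernel_set w) G"
      by (rule kernel_set_subgroup(1)[OF wE v' c, of 2 1])
         (use comp_order_partner[OF v] kernel_comp_order[OF wE] kw in auto)
    moreover have "finite (kernel_set w)" using c by (metis card.infinite zero_neq_numeral)
    ultimately show ?thesis using subgroup_pow_card[OF _ _ g] c by simp
  qed
  have cases: "w \<in> orbit G \<phi> x \<or> w \<in> orbit G \<phi> y \<and> card (stab w) = 5" if w: "w \<in> nonregular_points" for w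
    using nonregular_cases[OF N w] orbit_orders(3)[OF E(2), of w] k by auto
  have two_pt: "\<exists>v\<in>orbit G \<phi> x. partner w v \<and> g \<in> stab v" if w: "w \<in> orbit G \<phi> x" and g: "g \<in> two_point_elements w" for w g
  proof -
    obtain v where v: "g \<in> stab w" "g \<noteq> \<one>" "v \<in> E" "v \<noteq> w" "\<phi> g v = v" using g unfolding two_point_elements_def by blast
    have wE: "w \<in> E" using orbit_subset[OF E(1)] w by blast
    have gv: "g \<in> stab v" using v by (auto simp: stab_iff)
    have p: "partner w v" using partnerI[OF v(1) gv v(2) wE v(3)] v(4) by blast
    hence "v \<in> nonregular_points" using partner_nonregular by blast
    hence "v \<in> orbit G \<phi> x" using cases ul p w by (auto simp: linked_def)
    thus ?thesis using p gv by blast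
  qed
  have split: "g \<in> kernel_set w \<or> g \<in> two_point_elements w" if "g \<in> stab w" for g w
    using that by (auto simp: kernel_set_eq)
  show "G \<cong> alt_group 5"
  proof (rule iso_alt_group_5_orbit[OF m(1) k(2) o])
    show "g [^] (2::nat) = \<one> \<or> g [^] (3::nat) = \<one> \<or> g [^] (5::nat) = \<one>" if g: "g \<in> carrier G" for g
    proof (cases "g = \<one>")
      case False
      then obtain w where w: "w \<in> nonregular_points" "g \<in> stab w" using nonregular_fixed_point[OF g] by blast
      have wE: "w \<in> E" using w by (simp add: nonregular_points_def)
      from cases[OF w(1)] show ?thesis
      proof
        assume wx: "w \<in> orbit G \<phi> x"
        from split[OF w(2)] show ?thesis
        proof
          assume "g \<in> kernel_set w" thus ?thesis using K3[OF wx] by blast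
        next
          assume "g \<in> two_point_elements w"
          then obtain v where v: "partner w v" "g \<in> stab v" using two_pt[OF wx] by blast
          have vE: "v \<in> E" using v by (simp add: partner_def)
          have "g [^] card (stab w \<inter> stab v) = \<one>"
            by (rule subgroup_pow_card[OF subgroup_stab2[OF wE vE]]) (use w v in auto)
          thus ?thesis using comp_order_partner[OF v(1)] orbit_orders(2)[OF E(1) wx] k by simp
        qed
      next
        assume "w \<in> orbit G \<phi> y \<and> card (stab w) = 5"
        thus ?thesis using stab_pow[OF wE w(2)] by simp
      qed
    qed simp
    show "\<exists>w\<in>orbit G \<phi> x. \<exists>v\<in>orbit G \<phi> x. partner w v \<and> t \<in> stab w \<and> t \<in> stab v"
      if t: "t \<in> carrier G" "t \<noteq> \<one>" "t [^] (2::nat) = \<one>" for t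
    proof -
      obtain w where w: "w \<in> nonregular_points" "t \<in> stab w" using nonregular_fixed_point[OF t(1,2)] by blast
      have wE: "w \<in> E" using w by (simp add: nonregular_points_def)
      have "card (stab w) \<noteq> 5" using stab_pow[OF wE w(2)] pow_coprime_one[OF t(1,3), of 5] t(2) by auto
      hence wx: "w \<in> orbit G \<phi> x" using cases[OF w(1)] by blast
      have "t \<notin> kernel_set w" using K3[OF wx] pow_coprime_one[OF t(1,3), of 3] t(2) by auto
      hence "t \<in> two_point_elements w" using split[OF w(2)] by blast
      thus ?thesis using two_pt[OF wx] wx w by blast
    qed
  qed
qed

lemma platonic_case:
  assumes big: "\<And>x. x \<in> E \<Longrightarrow> 3 \<le> card (orbit G \<phi> x)" and NR: "card (nonregular_orbits G E \<phi>) = 3"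
  shows "platonic_group G E \<phi>"
proof -
  obtain x y z where m: "x \<in> nonregular_points" "y \<in> nonregular_points" "z \<in> nonregular_points"
    and N: "nonregular_orbits G E \<phi> = {orbit G \<phi> x, orbit G \<phi> y, orbit G \<phi> z}"
     and ne: "orbit G \<phi> x \<noteq> orbit G \<phi> y" "orbit G \<phi> x \<noteq> orbit G \<phi> z" "orbit G \<phi> y \<noteq> orbit G \<phi> z"
     and k: "kernel_order x = 1" "kernel_order y = 1" "kernel_order z = 1"
     and s: "card (stab x) = 2" "card (stab y) = 3"
      "card (stab z) = 3 \<and> order G = 12 \<or> card (stab z) = 4 \<and> order G = 24 \<or> card (stab z) = 5 \<and> order G = 60"
    by (rule three_orbits[OF big NR, elim_format], assumption, elim exE conjE) (rule that; assumption)
  have E: "x \<in> E" "y \<in> E" "z \<in> E" using m by (auto simp: nonregular_points_def)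
  have l: "nonregular_lengths G E \<phi> = {#card (orbit G \<phi> x), card (orbit G \<phi> y), card (orbit G \<phi> z)#}"
    by (rule nonregular_lengths_three[OF N ne])
  note co = card_orbit[OF E(1)] card_orbit[OF E(2)] card_orbit[OF E(3)]
  have "G \<cong> alt_group 4 \<and> nonregular_lengths G E \<phi> = {#6, 4, 4#} \<or>
     G \<cong> sym_group 4 \<and> nonregular_lengths G E \<phi> = {#12, 8, 6#} \<or>
     G \<cong> alt_group 5 \<and> nonregular_lengths G E \<phi> = {#30, 20, 12#}"
    using s(3)
  proof (elim disjE conjE)
    assume h: "card (stab z) = 3" "order G = 12"
    have "G \<cong> alt_group 4" by (rule iso_alt_group_4[OF E(2,3) s(2) h ne(3)])
    moreover have "card (orbit G \<phi> x) = 6" "card (orbit G \<phi> y) = 4" "card (orbit G \<phi> z) = 4" using co s h by auto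
    ultimately show ?thesis using l by simp
  next
    assume h: "card (stab z) = 4" "order G = 24"
    have "G \<cong> sym_group 4" by (rule iso_sym_group_4[OF big N m k(2) s(1,2) h])
    moreover have "card (orbit G \<phi> x) = 12" "card (orbit G \<phi> y) = 8" "card (orbit G \<phi> z) = 6" using co s h by auto
    ultimately show ?thesis using l by simp
  next
    assume h: "card (stab z) = 5" "order G = 60"
    have "G \<cong> alt_group 5" by (rule iso_alt_group_5_three_orbits[OF N m k(1) s(1,2) h])
    moreover have "card (orbit G \<phi> x) = 30" "card (orbit G \<phi> y) = 20" "card (orbit G \<phi> z) = 12" using co s h by auto
    ultimately show ?thesis using l by simp
  qed
  thus ?thesis using NR faithful[OF E(1) big[OF E(1)]] by (simp add: platonic_group_def)
qed

end

theorem theoremE: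
  fixes G :: "('a, 'm) monoid_scheme"
    and \<Omega> :: "'b set"
    and \<phi> :: "'a \<Rightarrow> 'b \<Rightarrow> 'b"
  assumes "group_action G \<Omega> \<phi>"
    and "finite (carrier G)"
    and "\<Omega> \<noteq> {}"
    and "\<forall>g \<in> carrier G - {\<one>\<^bsub>G\<^esub>}. card (invariants \<Omega> \<phi> g) \<in> {1, 2}"
  shows
    "(\<exists>\<Gamma> \<in> orbits G \<Omega> \<phi>. card \<Gamma> = 1 \<or> card \<Gamma> = 2)
   \<or> platonic_group G \<Omega> \<phi>
   \<or> (\<exists>F :: nat ring. field F \<and> finite (carrier F) \<and>
       (\<exists>L \<in> {PSL2 F, PGL2 F}. G \<cong> L \<and>
         (\<exists>\<Gamma> \<in> nonregular_orbits G \<Omega> \<phi>.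
           (\<exists>\<beta>. bij_betw \<beta> \<Gamma> (proj_line F) \<and>
              (\<forall>g \<in> carrier G. transport \<beta> \<Gamma> (proj_line F) (\<phi> g) \<in> carrier (PGL2 F)) \<and>
              faithful_action G \<Gamma> (\<lambda>g. restrict (\<phi> g) \<Gamma>) \<and>
              (\<lambda>g. transport \<beta> \<Gamma> (proj_line F) (\<phi> g)) ` carrier G = carrier L) \<and>
           (\<exists>\<Delta>. nonregular_orbits G \<Omega> \<phi> - {\<Gamma>} = {\<Delta>} \<and>
              card \<Delta> = card (carrier F) * (card (carrier F) - 1)))))
   \<or> (G \<cong> alt_group 5 \<and> card (nonregular_orbits G \<Omega> \<phi>) = 2 \<and>
       nonregular_lengths G \<Omega> \<phi> = {#10, 12#})"
proof (cases "\<exists>\<Gamma> \<in> orbits G \<Omega> \<phi>. card \<Gamma> = 1 \<or> card \<Gamma> = 2")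
  case small: False
  have inv: "finite (invariants \<Omega> \<phi> g) \<and> invariants \<Omega> \<phi> g \<noteq> {} \<and> card (invariants \<Omega> \<phi> g) \<le> 2"
    if "g \<in> carrier G" "g \<noteq> \<one>\<^bsub>G\<^esub>" for g
  proof -
    have "card (invariants \<Omega> \<phi> g) = 1 \<or> card (invariants \<Omega> \<phi> g) = 2" using assms(4) that by blast
    thus ?thesis by (auto intro: card_ge_0_finite)
  qed
  interpret one_or_two_fixed_points G \<Omega> \<phi>
  proof (intro one_or_two_fixed_points.intro two_fixed_points.intro finite_action.intro assms(1)
      finite_action_axioms.intro two_fixed_points_axioms.intro one_or_two_fixed_points_axioms.intro assms(2))
    show "x = y \<or> y = z \<or> x = z" if g: "g \<in> carrier G" "g \<noteq> \<one>\<^bsub>G\<^esub>" and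
       p: "x \<in> \<Omega>" "y \<in> \<Omega>" "z \<in> \<Omega>" "\<phi> g x = x" "\<phi> g y = y" "\<phi> g z = z" for g x y z
    proof (rule ccontr)
      assume "\<not> ?thesis"
      hence "card {x, y, z} = 3" by simp
      moreover have "{x, y, z} \<subseteq> invariants \<Omega> \<phi> g" using p unfolding invariants_def by blast
      hence "card {x, y, z} \<le> card (invariants \<Omega> \<phi> g)"
        by (rule card_mono[OF inv[OF g, THEN conjunct1]])
      ultimately show False using inv[OF g] by simp
    qed
    show "\<exists>x\<in>\<Omega>. \<phi> g x = x" if "g \<in> carrier G" "g \<noteq> \<one>\<^bsub>G\<^esub>" for g
      using inv[OF that] unfolding invariants_def by blast
  qed
  \<comment> \<open>The cardinality 0 of an infinite or empty set has to be excluded along with 1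
    and 2; orbits are finite and nonempty.\<close>
  have big: "3 \<le> card (orbit G \<phi> x)" if x: "x \<in> \<Omega>" for x
  proof -
    have "orbit G \<phi> x \<in> orbits G \<Omega> \<phi>" using x by (auto simp: orbits_def)
    hence "card (orbit G \<phi> x) \<noteq> 1" "card (orbit G \<phi> x) \<noteq> 2" using small by auto
    moreover have "card (orbit G \<phi> x) \<noteq> 0" using orbit_refl[OF x] finite_orbit by auto
    ultimately show ?thesis by linarith
  qed
  from card_nonregular_orbits[OF assms(3) big] show ?thesis
  proof
    assume "card (nonregular_orbits G \<Omega> \<phi>) = 3"
    thus ?thesis using platonic_case[OF big] by blast
  next
    assume c2: "card (nonregular_orbits G \<Omega> \<phi>) = 2"
    obtain x y where m: "x \<in> nonregular_points" "y \<in> nonregular_points"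
      and N: "nonregular_orbits G \<Omega> \<phi> = {orbit G \<phi> x, orbit G \<phi> y}" "orbit G \<phi> x \<noteq> orbit G \<phi> y"
      and ul: "\<not> linked x y"
      and alt: "((\<exists>c. (c = 1 \<or> c = 2) \<and> c * comp_order x = kernel_order x - 1 \<and> c * card (stab y) = kernel_order x + 1)
        \<and> kernel_order x \<ge> 3 \<and> card (orbit G \<phi> x) = kernel_order x + 1)
       \<or> (kernel_order x = 3 \<and> comp_order x = 2 \<and> card (orbit G \<phi> x) = 10 \<and> card (stab y) = 5)"
      using two_orbits[OF big c2] by blast
    from alt show ?thesis
    proof
      assume h: "(\<exists>c. (c = 1 \<or> c = 2) \<and> c * comp_order x = kernel_order x - 1 \<and> c * card (stab y) = kernel_order x + 1)
        \<and> kernel_order x \<ge> 3 \<and> card (orbit G \<phi> x) = kernel_order x + 1"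
      then obtain c where c: "c = 1 \<or> c = 2" "c * comp_order x = kernel_order x - 1"
        "c * card (stab y) = kernel_order x + 1" by blast
      have "kernel_order x \<ge> 3" "card (orbit G \<phi> x) = kernel_order x + 1" using h by auto
      from zassenhaus_case[OF m N ul c this] show ?thesis by (rule disjI2[OF disjI2[OF disjI1]])
    next
      assume h: "kernel_order x = 3 \<and> comp_order x = 2 \<and> card (orbit G \<phi> x) = 10 \<and> card (stab y) = 5"
      hence "G \<cong> alt_group 5" "order G = 60" using iso_alt_group_5_two_orbits[OF N(1) m ul] by auto
      moreover have yE: "y \<in> \<Omega>" using m by (simp add: nonregular_points_def)
      ultimately have "card (orbit G \<phi> y) = 12" using card_orbit[OF yE] h by simp
      hence "nonregular_lengths G \<Omega> \<phi> = {#10, 12#}" using N h by (simp add: nonregular_lengths_def)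
      thus ?thesis using \<open>G \<cong> alt_group 5\<close> c2 by blast
    qed
  qed
qed blast

end
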